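(* Let $a\in\mathcal P$ be an element of antighost number $i>0$ satisfying $\delta a=0$. Then there exists $b\in\mathcal P$ (of antighost number $i+1$) such that $a=\delta b$. In other words, the homology $H_i(\delta)$ of the covariant Koszul–Tate differential $\delta$ vanishes for all antighost numbers $i>0$.
   Context: Spacetime is $\mathbb R^n$ with the Minkowski metric, used to raise and lower spacetime indices $\mu,\nu,\dots$. $G$ is a simple Lie group with Lie algebra basis indices $a,b,c$ and structure constants $C^a_{bc}$; internal indices are moved with an invariant nondegenerate metric, so that $C_{abc}$ is totally antisymmetric. $\lambda$ is a real coupling constant. The Chapline–Manton model has fields $A^a_\mu$ and $B_{\mu\nu}=-B_{\nu\mu}$, with $F^a_{\mu\nu}=\partial_\mu A^a_\nu-\partial_\nu A^a_\mu-C^a_{bc}A^b_\mu A^c_\nu$ and $H_{\mu\nu\rho}=\partial_\mu B_{\nu\rho}+\partial_\nu B_{\rho\mu}+\partial_\rho B_{\mu\nu}-2\lambda C_{abc}A^a_\mu A^b_\nu A^c_\rho-2\lambda(A^a_\mu F_{a\nu\rho}+A^a_\nu F_{a\rho\mu}+A^a_\rho F_{a\mu\nu})$, and Lagrangian $-\frac14F^a_{\mu\nu}F_a^{\mu\nu}-\frac1{12}H_{\mu\nu\rho}H^{\mu\nu\rho}$. One adds ghosts $C^a$ (Grassmann odd), $\eta_\mu$ (odd), $\rho$ (even) and antifields $A^{*\mu}_a$ (odd), $C^*_a$ (even), $B^{*\mu\nu}=-B^{*\nu\mu}$ (odd), $\eta^{*\mu}$ (even), $\rho^*$ (odd). $\mathcal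 P$ is the algebra of spacetime exterior forms whose coefficients are polynomials in all these variables and their partial derivatives of all orders. $D_\mu$ is the gauge covariant derivative in the adjoint representation, $D_\mu X^a=\partial_\mu X^a-C^a_{bc}A^b_\mu X^c$ (indices moved with the invariant metric). The differential $\delta$ is the odd derivation of $\mathcal P$ commuting with $\partial_\mu$ defined by: $\delta$ vanishes on $A^a_\mu,B_{\mu\nu},C^a,\eta_\mu,\rho$; $\delta B^{*\mu\nu}=\partial_\rho H^{\rho\mu\nu}$, $\delta\eta^{*\mu}=-\partial_\nu B^{*\nu\mu}$, $\delta\rho^*=-\partial_\mu\eta^{*\mu}$, $\delta A^{*\mu}_a=D_\nu F_a^{\nu\mu}+2\lambda H^{\mu\nu\rho}F_{a\nu\rho}$, $\delta C^*_a=2\lambda B^{*\mu\nu}F_{a\mu\nu}-D_\mu A^{*\mu}_a$. The antighost number is the grading with: fields and ghosts $0$; $A^{*\mu}_a$ and $B^{*\mu\nu}$: $1$; $C^*_a$ and $\eta^{*\mu}$: $2$; $\rho^*$: $3$ ($\delta$ lowers it by one).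
   Formalization: The formal theorem assumes spacetime dimension n ≥ 3; for n ≤ 2 the claim fails (for n = 2, H vanishes identically, so B*^{01} is a δ-cycle of antighost number 1 that is not a boundary). *)

theory Defs
  imports "HOL-Library.Poly_Mapping" "HOL-Library.Countable" "HOL-Analysis.Analysis"
begin

text \<open>Spacetime indices: a finite linearly ordered type 'n (dimension CARD('n)).
  Lie algebra indices: a finite type 'g.\<close>

datatype ('n, 'g) fld =
    FA 'g 'n
  | FB 'n 'n        \<comment> \<open>B_{mu nu}, only mu < nu used, even\<close>
  | FC 'g           \<comment> \<open>ghost C^a, odd\<close>
  | Feta 'n         \<comment> \<open>ghost eta_mu, odd\<close>
  | Frho            \<comment> \<open>ghost rho, even\<close>
  | FAs 'g 'n       \<comment> \<open>antifield A*^mu_a, odd\<close>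
  | FCs 'g          \<comment> \<open>antifield C*_a, even\<close>
  | FBs 'n 'n       \<comment> \<open>antifield B*^{mu nu}, only mu < nu used, odd\<close>
  | Fetas 'n        \<comment> \<open>antifield eta*^mu, even\<close>
  | Frhos           \<comment> \<open>antifield rho*, odd\<close>

text \<open>A generator is either a jet coordinate (a field/antifield/ghost together with a
  multi-index J, J mu = number of derivatives in direction mu) or a differential dx^mu.\<close>
datatype ('n, 'g) gen = Jet "('n, 'g) fld" "'n \<Rightarrow> nat" | Dx 'n

instance fld :: (countable, countable) countable by countable_datatype
fun gen_code :: "('n, 'g) gen \<Rightarrow> (('n, 'g) fld \<times> ('n \<Rightarrow> nat)) + 'n" where
  "gen_code (Jet f J) = Inl (f, J)" | "gen_code (Dx m) = Inr m"

instance gen :: (finite, countable) countable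
proof
  have "inj (gen_code :: ('a, 'b) gen \<Rightarrow> _)"
    by (rule injI) (case_tac x; case_tac y; auto)
  then show "\<exists>to_nat :: ('a, 'b) gen \<Rightarrow> nat. inj to_nat"
    by (intro exI[of _ "to_nat \<circ> gen_code"]) (simp add: inj_compose)
qed

fun fld_odd :: "('n, 'g) fld \<Rightarrow> bool" where
  "fld_odd (FA a m) = False" | "fld_odd (FB m n) = False" | "fld_odd (FC a) = True"
| "fld_odd (Feta m) = True" | "fld_odd Frho = False" | "fld_odd (FAs a m) = True"
| "fld_odd (FCs a) = False" | "fld_odd (FBs m n) = True" | "fld_odd (Fetas m) = False"
| "fld_odd Frhos = True"

fun gen_odd :: "('n, 'g) gen \<Rightarrow> bool" where
  "gen_odd (Jet f J) = fld_odd f" | "gen_odd (Dx m) = True"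

fun fld_agh :: "('n, 'g) fld \<Rightarrow> nat" where
  "fld_agh (FAs a m) = 1" | "fld_agh (FBs m n) = 1" | "fld_agh (FCs a) = 2"
| "fld_agh (Fetas m) = 2" | "fld_agh Frhos = 3" | "fld_agh _ = 0"

fun gen_agh :: "('n, 'g) gen \<Rightarrow> nat" where
  "gen_agh (Jet f J) = fld_agh f" | "gen_agh (Dx m) = 0"

text \<open>Only independent components of the antisymmetric B and B* are generators.\<close>
fun gen_ok :: "('n::linorder, 'g) gen \<Rightarrow> bool" where
  "gen_ok (Jet (FB m n) J) = (m < n)" | "gen_ok (Jet (FBs m n) J) = (m < n)"
| "gen_ok _ = True"

text \<open>A monomial is (E, O): a multiset E of even generators times the product of the
  finitely many distinct odd generators in O, taken in increasing order of to_nat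
  (a fixed enumeration). Elements are finite real linear combinations of monomials.\<close>

type_synonym ('n, 'g) mon = "('n, 'g) gen multiset \<times> ('n, 'g) gen set"
type_synonym ('n, 'g) poly = "('n, 'g) mon \<Rightarrow>\<^sub>0 real"

definition mon_ok :: "('n::{finite,countable,linorder}, 'g::countable) mon \<Rightarrow> bool" where
  "mon_ok m = ((\<forall>x\<in>#fst m. \<not> gen_odd x \<and> gen_ok x) \<and> finite (snd m) \<and>
               (\<forall>x\<in>snd m. gen_odd x \<and> gen_ok x))"

definition PP :: "('n::{finite,countable,linorder}, 'g::countable) poly set" where
  "PP = {p. \<forall>m\<in>Poly_Mapping.keys p. mon_ok m}"

text \<open>Sign of the permutation sorting the concatenation O1 O2 (each sorted).\<close>
definition osign :: "('n::{finite,countable}, 'g::countable) gen set \<Rightarrow> ('n, 'g) gen set \<Rightarrow> real" where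
  "osign O1 O2 = (-1) ^ card {(x, y). x \<in> O1 \<and> y \<in> O2 \<and> to_nat y < to_nat x}"

definition mmul :: "real \<Rightarrow> ('n::{finite,countable}, 'g::countable) mon \<Rightarrow> ('n, 'g) mon \<Rightarrow> ('n, 'g) poly" where
  "mmul c m1 m2 = (if snd m1 \<inter> snd m2 \<noteq> {} then 0
      else Poly_Mapping.single (fst m1 + fst m2, snd m1 \<union> snd m2) (osign (snd m1) (snd m2) * c))"

definition pmul :: "('n::{finite,countable}, 'g::countable) poly \<Rightarrow> ('n, 'g) poly \<Rightarrow> ('n, 'g) poly"
  (infixl "\<star>" 70) where
  "p \<star> q = (\<Sum>m1\<in>Poly_Mapping.keys p. \<Sum>m2\<in>Poly_Mapping.keys q. mmul (Poly_Mapping.lookup p m1 * Poly_Mapping.lookup q m2) m1 m2)"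

definition sc :: "real \<Rightarrow> ('n, 'g) poly \<Rightarrow> ('n, 'g) poly" where
  "sc r p = (\<Sum>m\<in>Poly_Mapping.keys p. Poly_Mapping.single m (r * Poly_Mapping.lookup p m))"

definition one :: "('n, 'g) poly" where
  "one = Poly_Mapping.single ({#}, {}) 1"

definition gv :: "('n, 'g) gen \<Rightarrow> ('n, 'g) poly" where
  "gv x = (if gen_odd x then Poly_Mapping.single ({#}, {x}) 1 else Poly_Mapping.single ({#x#}, {}) 1)"

definition monp :: "('n, 'g) mon \<Rightarrow> ('n, 'g) poly" where
  "monp m = Poly_Mapping.single m 1"

definition sorted_odd :: "('n::{finite,countable}, 'g::countable) gen set \<Rightarrow> ('n, 'g) gen list" where
  "sorted_odd S = sorted_key_list_of_set to_nat S"

text \<open>Extension of a map on generators to a (left) derivation of parity pd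
  (pd = 0: even, pd = 1: odd), acting by the graded Leibniz rule
  D(x y) = D(x) y + (-1)^(pd |x|) x D(y).\<close>

fun dlist :: "nat \<Rightarrow> (('n::{finite,countable}, 'g::countable) gen \<Rightarrow> ('n, 'g) poly) \<Rightarrow> ('n, 'g) gen list \<Rightarrow> ('n, 'g) poly" where
  "dlist pd f [] = 0"
| "dlist pd f (x # xs) = f x \<star> foldr (\<lambda>y q. gv y \<star> q) xs one
      + sc ((-1) ^ (pd * (if gen_odd x then 1 else 0))) (gv x \<star> dlist pd f xs)"

definition dmon :: "nat \<Rightarrow> (('n::{finite,countable}, 'g::countable) gen \<Rightarrow> ('n, 'g) poly) \<Rightarrow> ('n, 'g) mon \<Rightarrow> ('n, 'g) poly" where
  "dmon pd f m = (\<Sum>e\<in>set_mset (fst m). sc (real (count (fst m) e)) (f e \<star> monp (fst m - {#e#}, snd m)))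
      + monp (fst m, {}) \<star> dlist pd f (sorted_odd (snd m))"

definition der :: "nat \<Rightarrow> (('n::{finite,countable}, 'g::countable) gen \<Rightarrow> ('n, 'g) poly) \<Rightarrow> ('n, 'g) poly \<Rightarrow> ('n, 'g) poly" where
  "der pd f p = (\<Sum>m\<in>Poly_Mapping.keys p. sc (Poly_Mapping.lookup p m) (dmon pd f m))"

fun pd_gen :: "'n \<Rightarrow> ('n::{finite,countable}, 'g::countable) gen \<Rightarrow> ('n, 'g) poly" where
  "pd_gen mu (Jet f J) = gv (Jet f (J(mu := Suc (J mu))))"
| "pd_gen mu (Dx nu) = 0"

definition PD :: "'n \<Rightarrow> ('n::{finite,countable}, 'g::countable) poly \<Rightarrow> ('n, 'g) poly" where
  "PD mu = der 0 (pd_gen mu)"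

definition PDJ :: "('n \<Rightarrow> nat) \<Rightarrow> ('n::{finite,countable,linorder}, 'g::countable) poly \<Rightarrow> ('n, 'g) poly" where
  "PDJ J p = fold (\<lambda>mu q. (PD mu ^^ J mu) q) (sorted_list_of_set UNIV) p"

text \<open>Minkowski metric: diagonal, -1 at the time index t0, +1 otherwise (so it is its own inverse).\<close>
definition msig :: "'n \<Rightarrow> 'n \<Rightarrow> real" where
  "msig t0 mu = (if mu = t0 then -1 else 1)"

definition undiff :: "'n \<Rightarrow> nat" where "undiff = (\<lambda>_. 0)"

definition fv :: "('n, 'g) fld \<Rightarrow> ('n, 'g) poly" where
  "fv f = gv (Jet f undiff)"

definition Afd :: "'g \<Rightarrow> 'n \<Rightarrow> ('n, 'g) poly" where "Afd a mu = fv (FA a mu)"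

definition Bfd :: "'n::linorder \<Rightarrow> 'n \<Rightarrow> ('n, 'g) poly" where
  "Bfd mu nu = (if mu < nu then fv (FB mu nu) else if nu < mu then - fv (FB nu mu) else 0)"

definition Bsfd :: "'n::linorder \<Rightarrow> 'n \<Rightarrow> ('n, 'g) poly" where
  "Bsfd mu nu = (if mu < nu then fv (FBs mu nu) else if nu < mu then - fv (FBs nu mu) else 0)"

text \<open>Lie algebra data: C a b c = C^a_{bc}, k a b = invariant metric k_{ab}.\<close>

definition Clow :: "('g::finite \<Rightarrow> 'g \<Rightarrow> real) \<Rightarrow> ('g \<Rightarrow> 'g \<Rightarrow> 'g \<Rightarrow> real) \<Rightarrow> 'g \<Rightarrow> 'g \<Rightarrow> 'g \<Rightarrow> real" where
  "Clow k C a b c = (\<Sum>d\<in>UNIV. k a d * C d b c)"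

definition kinv :: "('g::finite \<Rightarrow> 'g \<Rightarrow> real) \<Rightarrow> 'g \<Rightarrow> 'g \<Rightarrow> real" where
  "kinv k a b = matrix_inv (\<chi> i j. k i j) $ a $ b"

definition Ffd :: "('g::finite \<Rightarrow> 'g \<Rightarrow> 'g \<Rightarrow> real) \<Rightarrow> 'g \<Rightarrow> 'n::{finite,countable} \<Rightarrow> 'n \<Rightarrow> ('n, 'g) poly" where
  "Ffd C a mu nu = PD mu (Afd a nu) - PD nu (Afd a mu)
     - (\<Sum>b\<in>UNIV. \<Sum>c\<in>UNIV. sc (C a b c) (Afd b mu \<star> Afd c nu))"

definition Flow :: "('g::finite \<Rightarrow> 'g \<Rightarrow> real) \<Rightarrow> ('g \<Rightarrow> 'g \<Rightarrow> 'g \<Rightarrow> real) \<Rightarrow> 'g \<Rightarrow> 'n::{finite,countable} \<Rightarrow> 'n \<Rightarrow> ('n, 'g) poly" where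
  "Flow k C a mu nu = (\<Sum>b\<in>UNIV. sc (k a b) (Ffd C b mu nu))"

definition Hfd :: "real \<Rightarrow> ('g::finite \<Rightarrow> 'g \<Rightarrow> real) \<Rightarrow> ('g \<Rightarrow> 'g \<Rightarrow> 'g \<Rightarrow> real) \<Rightarrow> 'n::{finite,countable,linorder} \<Rightarrow> 'n \<Rightarrow> 'n \<Rightarrow> ('n, 'g) poly" where
  "Hfd lam k C mu nu rho =
     PD mu (Bfd nu rho) + PD nu (Bfd rho mu) + PD rho (Bfd mu nu)
     - sc (2 * lam) (\<Sum>a\<in>UNIV. \<Sum>b\<in>UNIV. \<Sum>c\<in>UNIV. sc (Clow k C a b c) (Afd a mu \<star> Afd b nu \<star> Afd c rho))
     - sc (2 * lam) (\<Sum>a\<in>UNIV. Afd a mu \<star> Flow k C a nu rho + Afd a nu \<star> Flow k C a rho mu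
                                + Afd a rho \<star> Flow k C a mu nu)"

text \<open>Indices raised with the (diagonal) Minkowski metric.\<close>
definition Hup :: "'n \<Rightarrow> real \<Rightarrow> ('g::finite \<Rightarrow> 'g \<Rightarrow> real) \<Rightarrow> ('g \<Rightarrow> 'g \<Rightarrow> 'g \<Rightarrow> real) \<Rightarrow> 'n::{finite,countable,linorder} \<Rightarrow> 'n \<Rightarrow> 'n \<Rightarrow> ('n, 'g) poly" where
  "Hup t0 lam k C mu nu rho = sc (msig t0 mu * msig t0 nu * msig t0 rho) (Hfd lam k C mu nu rho)"

definition Fup :: "'n \<Rightarrow> ('g::finite \<Rightarrow> 'g \<Rightarrow> 'g \<Rightarrow> real) \<Rightarrow> 'g \<Rightarrow> 'n::{finite,countable} \<Rightarrow> 'n \<Rightarrow> ('n, 'g) poly" where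
  "Fup t0 C a mu nu = sc (msig t0 mu * msig t0 nu) (Ffd C a mu nu)"

definition Flowup :: "'n \<Rightarrow> ('g::finite \<Rightarrow> 'g \<Rightarrow> real) \<Rightarrow> ('g \<Rightarrow> 'g \<Rightarrow> 'g \<Rightarrow> real) \<Rightarrow> 'g \<Rightarrow> 'n::{finite,countable} \<Rightarrow> 'n \<Rightarrow> ('n, 'g) poly" where
  "Flowup t0 k C a mu nu = sc (msig t0 mu * msig t0 nu) (Flow k C a mu nu)"

fun delta0 :: "'n \<Rightarrow> real \<Rightarrow> ('g::finite \<Rightarrow> 'g \<Rightarrow> real) \<Rightarrow> ('g \<Rightarrow> 'g \<Rightarrow> 'g \<Rightarrow> real) \<Rightarrow> ('n::{finite,countable,linorder}, 'g) fld \<Rightarrow> ('n, 'g) poly" where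
  "delta0 t0 lam k C (FBs mu nu) = (\<Sum>rho\<in>UNIV. PD rho (Hup t0 lam k C rho mu nu))"
| "delta0 t0 lam k C (Fetas mu) = - (\<Sum>nu\<in>UNIV. PD nu (Bsfd nu mu))"
| "delta0 t0 lam k C Frhos = - (\<Sum>mu\<in>UNIV. PD mu (fv (Fetas mu)))"
| "delta0 t0 lam k C (FAs a mu) =
     (\<Sum>nu\<in>UNIV. PD nu (Flowup t0 k C a nu mu)
        - (\<Sum>b\<in>UNIV. \<Sum>c\<in>UNIV. sc (Clow k C a b c) (Afd b nu \<star> Fup t0 C c nu mu)))
     + sc (2 * lam) (\<Sum>nu\<in>UNIV. \<Sum>rho\<in>UNIV. Hup t0 lam k C mu nu rho \<star> Flow k C a nu rho)"
| "delta0 t0 lam k C (FCs a) =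
     sc (2 * lam) (\<Sum>mu\<in>UNIV. \<Sum>nu\<in>UNIV. Bsfd mu nu \<star> Flow k C a mu nu)
     - (\<Sum>mu\<in>UNIV. PD mu (fv (FAs a mu))
        - (\<Sum>b\<in>UNIV. \<Sum>c\<in>UNIV. sc (Clow k C a b c)
             (Afd b mu \<star> (\<Sum>e\<in>UNIV. sc (kinv k c e) (fv (FAs e mu))))))"
| "delta0 t0 lam k C _ = 0"

fun delta_gen :: "'n \<Rightarrow> real \<Rightarrow> ('g::finite \<Rightarrow> 'g \<Rightarrow> real) \<Rightarrow> ('g \<Rightarrow> 'g \<Rightarrow> 'g \<Rightarrow> real) \<Rightarrow> ('n::{finite,countable,linorder}, 'g) gen \<Rightarrow> ('n, 'g) poly" where
  "delta_gen t0 lam k C (Jet f J) = PDJ J (delta0 t0 lam k C f)"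
| "delta_gen t0 lam k C (Dx nu) = 0"

text \<open>The Koszul--Tate differential: odd derivation commuting with the total derivatives.\<close>
definition KT :: "'n \<Rightarrow> real \<Rightarrow> ('g::finite \<Rightarrow> 'g \<Rightarrow> real) \<Rightarrow> ('g \<Rightarrow> 'g \<Rightarrow> 'g \<Rightarrow> real) \<Rightarrow> ('n::{finite,countable,linorder}, 'g) poly \<Rightarrow> ('n, 'g) poly" where
  "KT t0 lam k C = der 1 (delta_gen t0 lam k C)"

definition mon_agh :: "('n, 'g) mon \<Rightarrow> nat" where
  "mon_agh m = sum_mset (image_mset gen_agh (fst m)) + sum gen_agh (snd m)"

definition has_agh :: "nat \<Rightarrow> ('n, 'g) poly \<Rightarrow> bool" where
  "has_agh i p = (\<forall>m\<in>Poly_Mapping.keys p. mon_agh m = i)"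

definition lbr :: "('g::finite \<Rightarrow> 'g \<Rightarrow> 'g \<Rightarrow> real) \<Rightarrow> ('g \<Rightarrow> real) \<Rightarrow> ('g \<Rightarrow> real) \<Rightarrow> 'g \<Rightarrow> real" where
  "lbr C x y = (\<lambda>a. \<Sum>b\<in>UNIV. \<Sum>c\<in>UNIV. C a b c * x b * y c)"

definition lie_ideal :: "('g::finite \<Rightarrow> 'g \<Rightarrow> 'g \<Rightarrow> real) \<Rightarrow> ('g \<Rightarrow> real) set \<Rightarrow> bool" where
  "lie_ideal C I = ((\<lambda>_. 0) \<in> I \<and> (\<forall>x\<in>I. \<forall>y\<in>I. (\<lambda>a. x a + y a) \<in> I)
      \<and> (\<forall>r. \<forall>x\<in>I. (\<lambda>a. r * x a) \<in> I) \<and> (\<forall>x. \<forall>y\<in>I. lbr C x y \<in> I))"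

definition simple_lie_algebra :: "('g::finite \<Rightarrow> 'g \<Rightarrow> 'g \<Rightarrow> real) \<Rightarrow> bool" where
  "simple_lie_algebra C =
     ((\<forall>a b c. C a b c = - C a c b)
      \<and> (\<forall>x y z. (\<lambda>a. lbr C (lbr C x y) z a + lbr C (lbr C y z) x a + lbr C (lbr C z x) y a) = (\<lambda>_. 0))
      \<and> (\<exists>x y. lbr C x y \<noteq> (\<lambda>_. 0))
      \<and> (\<forall>I. lie_ideal C I \<longrightarrow> I = {\<lambda>_. 0} \<or> I = UNIV))"

definition kform :: "('g::finite \<Rightarrow> 'g \<Rightarrow> real) \<Rightarrow> ('g \<Rightarrow> real) \<Rightarrow> ('g \<Rightarrow> real) \<Rightarrow> real" where
  "kform k x y = (\<Sum>a\<in>UNIV. \<Sum>b\<in>UNIV. k a b * x a * y b)"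

definition invariant_metric :: "('g::finite \<Rightarrow> 'g \<Rightarrow> 'g \<Rightarrow> real) \<Rightarrow> ('g \<Rightarrow> 'g \<Rightarrow> real) \<Rightarrow> bool" where
  "invariant_metric C k =
     ((\<forall>a b. k a b = k b a)
      \<and> (\<forall>x. (\<forall>y. kform k x y = 0) \<longrightarrow> x = (\<lambda>_. 0))
      \<and> (\<forall>x y z. kform k (lbr C x y) z = kform k x (lbr C y z)))"

end

theory Submission
  imports Defs
begin

text \<open>
  The differential is triangular with respect to a rank on jet coordinates. Fix the three smallest
  spacetime indices \<open>e0 < e1 < e2\<close>, weight a derivative along them by 4, 3, 2 and along the other
  directions by 1, and give \<open>B\<close> one unit more than \<open>A\<close>. Ranking antifields suitably, the image of an
  antifield jet is a leading linear term of equal rank plus terms all of whose factors have smaller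
  rank; in the equations of \<open>A\<^sup>*\<close> and \<open>B\<^sup>*\<close> the leading term is a second derivative of \<open>A\<close> or \<open>B\<close>,
  in the others it is a first derivative of an antifield. The leading terms pair every antifield jet
  with a field jet or with another antifield jet, so the leading part \<open>dl\<close> of the differential has the
  contracting homotopy \<open>hs\<close>, the inverse pairing: their anticommutator counts paired generators, and
  this number is positive in positive antighost number. Nonlinear terms have at most five factors,
  hence weighting a generator of rank \<open>r\<close> by \<open>6 ^ r\<close> makes the difference between the differential and
  \<open>dl\<close> strictly weight-decreasing. Since the differential squares to zero (by the Bianchi and Jacobi
  identities), subtracting \<open>D (hs (a / count))\<close> from a cycle \<open>a\<close> leaves a cycle of smaller weight, and
  induction on the weight finishes the proof.
\<close>

section \<open>The graded-commutative algebra as a ring type\<close>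

text \<open>Gauge invariance is the obstacle. Antisymmetry of \<open>F\<close> and \<open>H\<close>
  removes the second \<open>e0\<close> derivative from every equation carrying an index
  \<open>e0\<close>, so one favoured direction cannot lead them all. The \<open>e0\<close> component
  of the \<open>A\<close> equation is led by a mixed derivative along \<open>e0\<close> and
  \<open>e1\<close>; the \<open>e0 e1\<close> component of the \<open>B\<close> equation loses the
  summands of both directions and is led by a derivative along \<open>e0\<close> and a third one,
  whence dimension at least 3. Not all jets of these antifields need such a leading term: those
  differentiated along \<open>e0\<close> are leading terms of images of \<open>FCs\<close> or
  \<open>Fetas\<close>, and those of \<open>FBs e0 e1\<close> differentiated along \<open>e1\<close>
  but not \<open>e0\<close> come from \<open>Fetas e0\<close>, whose jets differentiated along
  \<open>e0\<close> are in turn taken by \<open>Frhos\<close>. The extra unit for \<open>B\<close>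
  makes its second derivatives outrank those of \<open>A\<close> that the Chern-Simons part of
  \<open>H\<close> brings into the \<open>B\<close> equation. Five factors come from the product of
  \<open>H\<close>, of degree 3, with \<open>F\<close>, of degree 2.\<close>

lemma lookup_sc: "Poly_Mapping.lookup (sc r p) m = r * Poly_Mapping.lookup p m"
  unfolding sc_def lookup_sum
  by (simp add: lookup_single when_def in_keys_iff)

lemma mmul_add: "mmul (c + d) m1 m2 = mmul c m1 m2 + mmul d m1 m2"
  by (simp add: mmul_def single_add distrib_left)

lemma mmul_zero: "mmul 0 m1 m2 = 0"
  by (simp add: mmul_def)

lemma sc_single: "sc r (Poly_Mapping.single m c) = Poly_Mapping.single m (r * c)"
  by (rule poly_mapping_eqI) (simp add: lookup_sc lookup_single when_def)

lemma sc_add: "sc r (p + q) = sc r p + sc r q"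
  by (rule poly_mapping_eqI) (simp add: lookup_sc lookup_add distrib_left)

lemma sc_zero [simp]: "sc r 0 = 0"
  by (rule poly_mapping_eqI) (simp add: lookup_sc)

lemma sc_sum: "sc r (sum f A) = (\<Sum>x\<in>A. sc r (f x))"
  by (induction A rule: infinite_finite_induct) (auto simp: sc_add)

lemma sc_mmul: "sc r (mmul c m1 m2) = mmul (r * c) m1 m2"
  by (simp add: mmul_def sc_single mult.left_commute)

text \<open>The supports in the definition of \<open>pmul\<close> change under addition and scaling.
  Over common finite index sets bilinearity becomes a statement about single coefficients.\<close>

lemma pmul_superset:
  assumes "finite A" "Poly_Mapping.keys p \<subseteq> A" "finite B" "Poly_Mapping.keys q \<subseteq> B"
  shows "p \<star> q = (\<Sum>m1\<in>A. \<Sum>m2\<in>B. mmul (Poly_Mapping.lookup p m1 * Poly_Mapping.lookup q m2) m1 m2)"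
proof -
  have "p \<star> q = (\<Sum>m1\<in>Poly_Mapping.keys p. \<Sum>m2\<in>B. mmul (Poly_Mapping.lookup p m1 * Poly_Mapping.lookup q m2) m1 m2)"
    unfolding pmul_def
    by (intro sum.cong refl sum.mono_neutral_left) (use assms in \<open>auto simp: in_keys_iff mmul_zero\<close>)
  also have "\<dots> = (\<Sum>m1\<in>A. \<Sum>m2\<in>B. mmul (Poly_Mapping.lookup p m1 * Poly_Mapping.lookup q m2) m1 m2)"
    by (intro sum.mono_neutral_left) (use assms in \<open>auto simp: in_keys_iff mmul_zero\<close>)
  finally show ?thesis .
qed

lemma pmul_add_left: "(p + p') \<star> q = p \<star> q + p' \<star> q"
proof -
  let ?A = "Poly_Mapping.keys p \<union> Poly_Mapping.keys p'" and ?B = "Poly_Mapping.keys q"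
  have s: "Poly_Mapping.keys (p + p') \<subseteq> ?A" by (rule Poly_Mapping.keys_add)
  show ?thesis
    by (subst (1 2 3) pmul_superset[where A = ?A and B = ?B])
      (use s in \<open>auto simp: lookup_add distrib_right mmul_add sum.distrib\<close>)
qed

lemma pmul_add_right: "q \<star> (p + p') = q \<star> p + q \<star> p'"
proof -
  let ?A = "Poly_Mapping.keys p \<union> Poly_Mapping.keys p'" and ?B = "Poly_Mapping.keys q"
  have s: "Poly_Mapping.keys (p + p') \<subseteq> ?A" by (rule Poly_Mapping.keys_add)
  show ?thesis
    by (subst (1 2 3) pmul_superset[where A = ?B and B = ?A])
      (use s in \<open>auto simp: lookup_add distrib_left mmul_add sum.distrib\<close>)
qed

lemma keys_sc_subset: "Poly_Mapping.keys (sc r p) \<subseteq> Poly_Mapping.keys p"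
  by (auto simp: in_keys_iff lookup_sc)

lemma pmul_sc_left: "sc r p \<star> q = sc r (p \<star> q)"
  by (subst (1 2) pmul_superset[where A = "Poly_Mapping.keys p" and B = "Poly_Mapping.keys q"])
    (use keys_sc_subset[of r p] in \<open>auto simp: lookup_sc sc_sum sc_mmul mult.assoc\<close>)

lemma pmul_sc_right: "p \<star> sc r q = sc r (p \<star> q)"
  by (subst (1 2) pmul_superset[where A = "Poly_Mapping.keys p" and B = "Poly_Mapping.keys q"])
    (use keys_sc_subset[of r q] in \<open>auto simp: lookup_sc sc_sum sc_mmul mult.left_commute\<close>)

lemma pmul_single: "Poly_Mapping.single m c \<star> Poly_Mapping.single m' d = mmul (c * d) m m'"
  by (subst pmul_superset[where A = "{m}" and B = "{m'}"]) (auto simp: lookup_single)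

lemma pmul_zero [simp]: "0 \<star> q = 0" "q \<star> 0 = 0"
  by (simp_all add: pmul_def)

section \<open>Closure of \<open>PP\<close> under the algebra operations\<close>

lemma PP_zero [simp]: "0 \<in> PP"
  by (simp add: PP_def)

lemma PP_add: "p \<in> PP \<Longrightarrow> q \<in> PP \<Longrightarrow> p + q \<in> PP"
  unfolding PP_def using Poly_Mapping.keys_add[of p q] by blast

lemma PP_uminus: "p \<in> PP \<Longrightarrow> - p \<in> PP"
  by (simp add: PP_def)

lemma PP_minus: "p \<in> PP \<Longrightarrow> q \<in> PP \<Longrightarrow> p - q \<in> PP"
  using PP_add[of p "- q"] PP_uminus[of q] by simp

lemma PP_sum: "(\<And>x. x \<in> A \<Longrightarrow> f x \<in> PP) \<Longrightarrow> sum f A \<in> PP"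
  by (induction A rule: infinite_finite_induct) (auto intro: PP_add)

lemma PP_sc: "p \<in> PP \<Longrightarrow> sc r p \<in> PP"
  unfolding PP_def using keys_sc_subset[of r p] by blast

lemma PP_single: "mon_ok m \<Longrightarrow> Poly_Mapping.single m c \<in> PP"
  by (auto simp: PP_def)

lemma PP_mmul: "mon_ok m1 \<Longrightarrow> mon_ok m2 \<Longrightarrow> mmul c m1 m2 \<in> PP"
  by (auto simp: mmul_def mon_ok_def intro!: PP_single)

lemma PP_pmul: "p \<in> PP \<Longrightarrow> q \<in> PP \<Longrightarrow> p \<star> q \<in> PP"
  unfolding pmul_def by (intro PP_sum PP_mmul) (auto simp: PP_def)

lemma PP_one: "one \<in> PP"
  by (auto simp: one_def mon_ok_def intro!: PP_single)

lemma poly_sum_singles: "p = (\<Sum>m\<in>Poly_Mapping.keys p. Poly_Mapping.single m (Poly_Mapping.lookup p m))"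
  by (rule poly_mapping_eqI) (simp add: lookup_sum lookup_single when_def in_keys_iff)

lemma PP_induct [consumes 1, case_names single zero add]:
  assumes "p \<in> PP" and single: "\<And>m c. mon_ok m \<Longrightarrow> P (Poly_Mapping.single m c)"
    and zero: "P 0" and add: "\<And>p q. p \<in> PP \<Longrightarrow> q \<in> PP \<Longrightarrow> P p \<Longrightarrow> P q \<Longrightarrow> P (p + q)"
  shows "P p"
proof -
  have "finite A \<Longrightarrow> A \<subseteq> Poly_Mapping.keys p \<Longrightarrow>
      P (\<Sum>m\<in>A. Poly_Mapping.single m (Poly_Mapping.lookup p m))" for A
  proof (induction A rule: finite_induct)
    case (insert m A)
    have ok: "mon_ok m'" if "m' \<in> insert m A" for m'
      using insert.prems that assms(1) by (auto simp: PP_def)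
    have "P (Poly_Mapping.single m (Poly_Mapping.lookup p m) +
        (\<Sum>m\<in>A. Poly_Mapping.single m (Poly_Mapping.lookup p m)))"
      using insert.IH insert.prems ok by (intro add single PP_single PP_sum) auto
    with insert.hyps show ?case by simp
  qed (simp add: zero)
  from this[of "Poly_Mapping.keys p"] show ?thesis
    using poly_sum_singles[of p] by simp
qed

section \<open>Signs of odd products and associativity\<close>

lemma osign_Un_left:
  assumes "finite A" "finite B" "finite D" "A \<inter> B = {}"
  shows "osign (A \<union> B) D = osign A D * osign B D"
proof -
  let ?i = "\<lambda>A B. {(x, y). x \<in> A \<and> y \<in> B \<and> to_nat y < to_nat x}"
  have "?i (A \<union> B) D = ?i A D \<union> ?i B D" by auto
  moreover have "?i A D \<inter> ?i B D = {}" using assms by auto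
  moreover have "finite (?i A D)" "finite (?i B D)"
    by (rule finite_subset[of _ "A \<times> D"]; use assms in auto)
      (rule finite_subset[of _ "B \<times> D"]; use assms in auto)
  ultimately show ?thesis by (simp add: osign_def card_Un_disjoint power_add)
qed

lemma osign_Un_right:
  assumes "finite A" "finite B" "finite D" "A \<inter> B = {}"
  shows "osign D (A \<union> B) = osign D A * osign D B"
proof -
  let ?i = "\<lambda>A B. {(x, y). x \<in> A \<and> y \<in> B \<and> to_nat y < to_nat x}"
  have "?i D (A \<union> B) = ?i D A \<union> ?i D B" by auto
  moreover have "?i D A \<inter> ?i D B = {}" using assms by auto
  moreover have "finite (?i D A)" "finite (?i D B)"
    by (rule finite_subset[of _ "D \<times> A"]; use assms in auto)
      (rule finite_subset[of _ "D \<times> B"]; use assms in auto)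
  ultimately show ?thesis by (simp add: osign_def card_Un_disjoint power_add)
qed

lemma osign_empty [simp]: "osign {} A = 1" "osign A {} = 1"
  by (simp_all add: osign_def)

text \<open>\<open>osign\<close> is multiplicative over finite disjoint unions, so both bracketings
  carry the product of the three pairwise signs; if two of the odd parts meet, both vanish.\<close>

lemma mmul_assoc:
  assumes "mon_ok m1" "mon_ok m2" "mon_ok m3"
  shows "mmul c m1 m2 \<star> Poly_Mapping.single m3 d = Poly_Mapping.single m1 c \<star> mmul d m2 m3"
proof -
  have f: "finite (snd m1)" "finite (snd m2)" "finite (snd m3)"
    using assms by (auto simp: mon_ok_def)
  show ?thesis
  proof (cases "snd m1 \<inter> snd m2 = {} \<and> snd m2 \<inter> snd m3 = {} \<and> snd m1 \<inter> snd m3 = {}")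
    case True
    then show ?thesis using f
      by (simp add: mmul_def pmul_single Int_Un_distrib Int_Un_distrib2 osign_Un_left osign_Un_right Un_assoc ac_simps)
  next
    case False
    then show ?thesis
      by (auto simp: mmul_def pmul_single Int_Un_distrib Int_Un_distrib2)
  qed
qed

lemma pmul_assoc:
  assumes "p \<in> PP" "q \<in> PP" "r \<in> PP"
  shows "(p \<star> q) \<star> r = p \<star> (q \<star> r)"
  using assms(1)
proof (induction rule: PP_induct)
  case (single m1 c)
  from assms(2) show ?case
  proof (induction rule: PP_induct)
    case (single m2 d)
    from assms(3) show ?case
    proof (induction rule: PP_induct)
      case (single m3 e)
      then show ?case using \<open>mon_ok m1\<close> \<open>mon_ok m2\<close>
        using mmul_assoc[of m1 m2 m3 "c * d" e] mmul_assoc[of m1 m2 m3 "c" "d * e"]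
        by (simp add: pmul_single mmul_def mult.assoc mult.left_commute)
    qed (simp_all add: pmul_add_right)
  qed (simp_all add: pmul_add_right pmul_add_left)
qed (simp_all add: pmul_add_left)

lemma pmul_one: "one \<star> p = p" "p \<star> one = p"
proof -
  have "one \<star> p = (\<Sum>m\<in>Poly_Mapping.keys p. Poly_Mapping.single m (Poly_Mapping.lookup p m))"
    by (subst pmul_superset[where A = "{({#}, {})}" and B = "Poly_Mapping.keys p"])
      (auto simp: one_def mmul_def)
  then show "one \<star> p = p" using poly_sum_singles[of p] by simp
  have "p \<star> one = (\<Sum>m\<in>Poly_Mapping.keys p. Poly_Mapping.single m (Poly_Mapping.lookup p m))"
    by (subst pmul_superset[where B = "{({#}, {})}" and A = "Poly_Mapping.keys p"])
      (auto simp: one_def mmul_def)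
  then show "p \<star> one = p" using poly_sum_singles[of p] by simp
qed

text \<open>Associativity has been shown on \<open>PP\<close> only, where odd parts are finite. As a
  type of its own, \<open>PP\<close> becomes a \<open>real_algebra_1\<close>, and ring
  simplification is available.\<close>

typedef (overloaded) ('n, 'g) salg = "PP :: ('n::{finite,linorder}, 'g::finite) poly set"
  by (rule exI[of _ 0]) simp

setup_lifting type_definition_salg

instantiation salg :: ("{finite,linorder}", finite) real_algebra_1
begin

lift_definition zero_salg :: "('a, 'b) salg" is 0 by simp
lift_definition one_salg :: "('a, 'b) salg" is one by (rule PP_one)
lift_definition plus_salg :: "('a, 'b) salg \<Rightarrow> ('a, 'b) salg \<Rightarrow> ('a, 'b) salg" is "(+)" by (rule PP_add)
lift_definition minus_salg :: "('a, 'b) salg \<Rightarrow> ('a, 'b) salg \<Rightarrow> ('a, 'b) salg" is "(-)" by (rule PP_minus)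
lift_definition uminus_salg :: "('a, 'b) salg \<Rightarrow> ('a, 'b) salg" is uminus by (rule PP_uminus)
lift_definition times_salg :: "('a, 'b) salg \<Rightarrow> ('a, 'b) salg \<Rightarrow> ('a, 'b) salg" is "(\<star>)" by (rule PP_pmul)
lift_definition scaleR_salg :: "real \<Rightarrow> ('a, 'b) salg \<Rightarrow> ('a, 'b) salg" is sc by (rule PP_sc)

instance
proof
  fix p q r :: "('a, 'b) salg" and x y :: real
  show "p + q + r = p + (q + r)" by transfer (simp add: add.assoc)
  show "p + q = q + p" by transfer (simp add: add.commute)
  show "0 + p = p" by transfer simp
  show "- p + p = 0" by transfer simp
  show "p - q = p + - q" by transfer simp
  show "p * q * r = p * (q * r)" by transfer (rule pmul_assoc)
  show "(p + q) * r = p * r + q * r" by transfer (rule pmul_add_left)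
  show "p * (q + r) = p * q + p * r" by transfer (rule pmul_add_right)
  show "1 * p = p" by transfer (rule pmul_one)
  show "p * 1 = p" by transfer (rule pmul_one)
  show "(0 :: ('a, 'b) salg) \<noteq> 1" by transfer (metis one_def one_neq_zero lookup_single_eq lookup_zero)
  show "x *\<^sub>R (p + q) = x *\<^sub>R p + x *\<^sub>R q" by transfer (rule sc_add)
  show "(x + y) *\<^sub>R p = x *\<^sub>R p + y *\<^sub>R p"
    by transfer (rule poly_mapping_eqI, simp add: lookup_sc lookup_add distrib_right)
  show "x *\<^sub>R y *\<^sub>R p = (x * y) *\<^sub>R p"
    by transfer (rule poly_mapping_eqI, simp add: lookup_sc)
  show "1 *\<^sub>R p = p"
    by transfer (rule poly_mapping_eqI, simp add: lookup_sc)
  show "x *\<^sub>R p * q = x *\<^sub>R (p * q)" by transfer (rule pmul_sc_left)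
  show "p * x *\<^sub>R q = x *\<^sub>R (p * q)" by transfer (rule pmul_sc_right)
qed

end

section \<open>Monomials and generators in the ring type\<close>

lemma Rep_salg_sum: "Rep_salg (sum f A) = (\<Sum>x\<in>A. Rep_salg (f x))"
  by (induction A rule: infinite_finite_induct) (auto simp: zero_salg.rep_eq plus_salg.rep_eq)

text \<open>Even and odd factors share one multiset: nonzero products of monomials then add these
  multisets, and parity, antighost number and weight are all functions of them.\<close>

definition gm :: "('n, 'g) mon \<Rightarrow> ('n, 'g) gen multiset" where
  "gm m = fst m + mset_set (snd m)"

definition mons :: "('n::{finite,linorder}, 'g::finite) salg \<Rightarrow> ('n, 'g) mon set" where
  "mons p = Poly_Mapping.keys (Rep_salg p)"

definition coef :: "('n::{finite,linorder}, 'g::finite) salg \<Rightarrow> ('n, 'g) mon \<Rightarrow> real" where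
  "coef p m = Poly_Mapping.lookup (Rep_salg p) m"

lemma PP_gv: "gen_ok x \<Longrightarrow> gv x \<in> PP"
  by (auto simp: gv_def mon_ok_def intro!: PP_single)

lemma PP_monp: "mon_ok m \<Longrightarrow> monp m \<in> PP"
  by (auto simp: monp_def intro!: PP_single)

text \<open>The default 0 on dependent components such as \<open>FB m m\<close> keeps
  \<open>sgen\<close> total and lets the rules for total derivatives hold for every jet without a
  side condition.\<close>

lift_definition sgen :: "('n::{finite,linorder}, 'g::finite) gen \<Rightarrow> ('n, 'g) salg"
  is "\<lambda>x. if gen_ok x then gv x else 0" by (simp add: PP_gv)

lift_definition smon :: "('n::{finite,linorder}, 'g::finite) mon \<Rightarrow> ('n, 'g) salg"
  is "\<lambda>m. if mon_ok m then monp m else 0" by (simp add: PP_monp)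

lemma (in linorder) sorted_key_list_of_set_inj:
  assumes "inj f"
  shows "sorted_key_list_of_set f {} = []"
    and "finite A \<Longrightarrow> x \<notin> A \<Longrightarrow> sorted_key_list_of_set f (insert x A) = insort_key f x (sorted_key_list_of_set f A)"
    and "finite A \<Longrightarrow> set (sorted_key_list_of_set f A) = A"
    and "sorted_wrt (<) (map f (sorted_key_list_of_set f A))"
proof -
  interpret folding_insort_key "(\<le>)" "(<)" UNIV f
    by unfold_locales (rule assms)
  show "sorted_key_list_of_set f {} = []"
    and "finite A \<Longrightarrow> x \<notin> A \<Longrightarrow> sorted_key_list_of_set f (insert x A) = insort_key f x (sorted_key_list_of_set f A)"
    and "finite A \<Longrightarrow> set (sorted_key_list_of_set f A) = A"
    and "sorted_wrt (<) (map f (sorted_key_list_of_set f A))"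
    by (simp_all add: sorted_key_list_of_set_insert)
qed

lemma sorted_odd_empty [simp]: "sorted_odd {} = []"
  by (simp add: sorted_odd_def sorted_key_list_of_set_inj)

lemma sorted_odd_insert:
  "finite A \<Longrightarrow> x \<notin> A \<Longrightarrow> sorted_odd (insert x A) = insort_key to_nat x (sorted_odd A)"
  by (simp add: sorted_odd_def sorted_key_list_of_set_inj)

lemma set_sorted_odd [simp]: "finite A \<Longrightarrow> set (sorted_odd A) = A"
  by (simp add: sorted_odd_def sorted_key_list_of_set_inj)

lemma sorted_sorted_odd: "sorted_wrt (<) (map to_nat (sorted_odd A))"
  by (simp only: sorted_odd_def sorted_key_list_of_set_inj inj_to_nat)

lemma mons_finite [simp]: "finite (mons p)"
  by (simp add: mons_def)

lemma mons_ok: "m \<in> mons p \<Longrightarrow> mon_ok m"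
  using Rep_salg[of p] by (auto simp: mons_def PP_def)

lemma mons_0 [simp]: "mons 0 = {}"
  by (simp add: mons_def zero_salg.rep_eq)

lemma mons_1 [simp]: "mons 1 = {({#}, {})}"
  by (simp add: mons_def one_salg.rep_eq one_def)

lemma mons_add: "mons (p + q) \<subseteq> mons p \<union> mons q"
  unfolding mons_def plus_salg.rep_eq by (rule Poly_Mapping.keys_add)

lemma mons_uminus [simp]: "mons (- p) = mons p"
  by (simp add: mons_def uminus_salg.rep_eq)

lemma mons_scaleR: "mons (r *\<^sub>R p) \<subseteq> mons p"
  unfolding mons_def scaleR_salg.rep_eq by (rule keys_sc_subset)

lemma mons_sgen: "m \<in> mons (sgen x) \<Longrightarrow> gm m = {#x#}"
  by (auto simp: mons_def sgen.rep_eq gv_def gm_def split: if_splits)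

lemma gm_empty [simp]: "gm ({#}, {}) = {#}"
  by (simp add: gm_def)

lemma keys_sum_subset: "Poly_Mapping.keys (sum f A) \<subseteq> (\<Union>x\<in>A. Poly_Mapping.keys (f x))"
proof (induction A rule: infinite_finite_induct)
  case (insert x F)
  then show ?case using Poly_Mapping.keys_add[of "f x" "sum f F"] by auto
qed auto

lemma mons_mult:
  assumes "m \<in> mons (p * q)"
  shows "\<exists>m1\<in>mons p. \<exists>m2\<in>mons q. gm m = gm m1 + gm m2"
proof -
  from assms have "m \<in> Poly_Mapping.keys (Rep_salg p \<star> Rep_salg q)"
    by (simp add: mons_def times_salg.rep_eq)
  then obtain m1 m2 where m: "m1 \<in> mons p" "m2 \<in> mons q"
      "m \<in> Poly_Mapping.keys (mmul (Poly_Mapping.lookup (Rep_salg p) m1 * Poly_Mapping.lookup (Rep_salg q) m2) m1 m2)"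
    unfolding pmul_def mons_def by (blast dest!: subsetD[OF keys_sum_subset])
  then have "snd m1 \<inter> snd m2 = {}" "m = (fst m1 + fst m2, snd m1 \<union> snd m2)"
    by (auto simp: mmul_def split: if_splits)
  with mons_ok[OF m(1)] mons_ok[OF m(2)] have "gm m = gm m1 + gm m2"
    by (simp add: gm_def mon_ok_def mset_set_Union)
  with m show ?thesis by blast
qed

lemma salg_expand: "p = (\<Sum>m\<in>mons p. coef p m *\<^sub>R smon m)"
proof -
  have "Rep_salg p = (\<Sum>m\<in>mons p. sc (coef p m) (Rep_salg (smon m)))"
    using poly_sum_singles[of "Rep_salg p"] mons_ok[of _ p]
    by (simp add: mons_def coef_def smon.rep_eq monp_def sc_single)
  then show ?thesis
    by (simp add: Rep_salg_inject[symmetric] Rep_salg_sum scaleR_salg.rep_eq)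
qed

lemma salg_linear_induct [case_names smon zero add scaleR]:
  assumes "\<And>m. m \<in> mons p \<Longrightarrow> P (smon m)" "P 0" "\<And>p q. P p \<Longrightarrow> P q \<Longrightarrow> P (p + q)" "\<And>r p. P p \<Longrightarrow> P (r *\<^sub>R p)"
  shows "P p"
proof -
  have "A \<subseteq> mons p \<Longrightarrow> P (\<Sum>m\<in>A. coef p m *\<^sub>R smon m)" for A
    by (induction A rule: infinite_finite_induct) (auto intro: assms)
  from this[of "mons p"] show ?thesis using salg_expand[of p] by simp
qed

lemma smon_central: "smon (E, {}) * p = p * smon (E, {})"
proof (induction p rule: salg_linear_induct)
  case (smon m)
  show ?case
    by (transfer, cases m) (auto simp: monp_def pmul_single mmul_def add.commute)
qed (simp_all add: distrib_left distrib_right)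

lemma smon_mult: "mon_ok (E, {}) \<Longrightarrow> mon_ok (E', O') \<Longrightarrow> smon (E, {}) * smon (E', O') = smon (E + E', O')"
  by transfer (auto simp: monp_def pmul_single mmul_def mon_ok_def)

lemma sgen_even: "gen_ok x \<Longrightarrow> \<not> gen_odd x \<Longrightarrow> sgen x = smon ({#x#}, {})"
  by transfer (auto simp: gv_def monp_def mon_ok_def)

lemma smon_1: "smon ({#}, {}) = 1"
  by transfer (auto simp: monp_def mon_ok_def one_def)

lemma sgen_odd_square: "gen_odd x \<Longrightarrow> sgen x * sgen x = 0"
  by transfer (simp add: gv_def pmul_single mmul_def)

lemma osign_pair:
  "osign {x} {y} = (if to_nat y < to_nat x then -1 else 1)"
proof -
  have "{(a, b). a \<in> {x} \<and> b \<in> {y} \<and> to_nat b < to_nat a} = (if to_nat y < to_nat x then {(x, y)} else {})"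
    by auto
  then show ?thesis by (simp add: osign_def)
qed

lemma sgen_odd_swap:
  assumes "gen_odd x" "gen_odd y"
  shows "sgen x * sgen y = - (sgen y * sgen x)"
proof (cases "x = y")
  case True
  then show ?thesis using sgen_odd_square[of x] assms by simp
next
  case False
  then have "to_nat x \<noteq> to_nat y" by simp
  then show ?thesis using assms False
    by transfer (auto simp: gv_def pmul_single mmul_def osign_pair insert_commute single_uminus)
qed

lemma sgen_not_ok: "\<not> gen_ok x \<Longrightarrow> sgen x = 0"
  by transfer simp

lemma sgen_even_central: "\<not> gen_odd x \<Longrightarrow> sgen x * p = p * sgen x"
  using sgen_not_ok[of x] by (cases "gen_ok x") (simp_all add: sgen_even smon_central)

lemma smon_insert_min:
  assumes "gen_ok x" "gen_odd x" "mon_ok (E, S)" "\<And>y. y \<in> S \<Longrightarrow> to_nat x < to_nat y"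
  shows "sgen x * smon (E, S) = smon (E, insert x S)"
proof -
  have "{(a, b). a \<in> {x} \<and> b \<in> S \<and> to_nat b < to_nat a} = {}"
    using assms(4) by fastforce
  then have "osign {x} S = 1" by (simp only: osign_def) simp
  moreover have "x \<notin> S" using assms(4) by auto
  ultimately show ?thesis using assms(1-3)
    by transfer (auto simp: gv_def monp_def pmul_single mmul_def mon_ok_def)
qed

text \<open>Peels off one generator on the left: an even one, which is central, as long as there is
  any, then the odd one that comes first in the enumeration. Neither choice produces a sign.\<close>

lemma mon_gen_induct [consumes 1, case_names empty step]:
  assumes "mon_ok m" and empty: "P ({#}, {})"
    and step: "\<And>x m m0. gen_ok x \<Longrightarrow> mon_ok m0 \<Longrightarrow> mon_ok m \<Longrightarrow> smon m = sgen x * smon m0 \<Longrightarrow>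
      gm m = add_mset x (gm m0) \<Longrightarrow> P m0 \<Longrightarrow> P m"
  shows "P m"
  using assms(1)
proof (induction "size (gm m)" arbitrary: m rule: less_induct)
  case less
  obtain E S where m: "m = (E, S)" by (cases m)
  have fin: "finite S" using less.prems m by (simp add: mon_ok_def)
  show ?case
  proof (cases "E = {#}")
    case False
    then obtain x E' where E: "E = add_mset x E'" by (meson multiset_cases)
    have "mon_ok (E', S)" "gen_ok x" "\<not> gen_odd x" "mon_ok ({#x#}, {})"
      using less.prems by (auto simp: m E mon_ok_def)
    moreover from this have "smon m = sgen x * smon (E', S)"
      by (simp add: sgen_even smon_mult m E)
    moreover have "gm m = add_mset x (gm (E', S))" by (simp add: gm_def m E)
    ultimately show ?thesis using step[of x "(E', S)" m] less by simp
  next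
    case True
    show ?thesis
    proof (cases "S = {}")
      case False
      define x where "x = arg_min_on to_nat S"
      have x: "x \<in> S" "\<And>y. y \<in> S \<Longrightarrow> to_nat x \<le> to_nat y"
        using arg_min_if_finite[OF fin False, of to_nat] unfolding x_def
        by (auto simp: not_less intro: leI)
      define S' where "S' = S - {x}"
      have S: "S = insert x S'" "x \<notin> S'" using x S'_def by auto
      have lt: "to_nat x < to_nat y" if "y \<in> S'" for y
      proof -
        have "to_nat x \<le> to_nat y" "x \<noteq> y" using x(2)[of y] that S by auto
        then show ?thesis by (simp add: order_less_le)
      qed
      have ok: "mon_ok ({#}, S')" "gen_ok x" "gen_odd x"
        using less.prems by (auto simp: m S True mon_ok_def)
      have "smon m = sgen x * smon ({#}, S')"
        using smon_insert_min[OF ok(2,3,1) lt] by (simp add: m True S)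
      moreover have "gm m = add_mset x (gm ({#}, S'))"
        using S fin by (simp add: gm_def m True)
      ultimately show ?thesis using step[of x "({#}, S')" m] less ok by simp
    qed (use empty m True in simp)
  qed
qed

lemma salg_induct [case_names one zero add scaleR gen]:
  assumes "P 1" "P 0" "\<And>p q. P p \<Longrightarrow> P q \<Longrightarrow> P (p + q)" "\<And>r p. P p \<Longrightarrow> P (r *\<^sub>R p)"
    "\<And>x p. gen_ok x \<Longrightarrow> P p \<Longrightarrow> P (sgen x * p)"
  shows "P p"
proof (induction p rule: salg_linear_induct)
  case (smon m)
  from mons_ok[OF this] show ?case
    by (induction rule: mon_gen_induct) (use assms in \<open>auto simp: smon_1\<close>)
qed (use assms in auto)

lemma prod_sorted_odd:
  fixes S :: "('n::{finite,linorder}, 'g::finite) gen set"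
  assumes "finite S" "\<And>x. x \<in> S \<Longrightarrow> gen_ok x \<and> gen_odd x"
  shows "smon ({#}, S) = prod_list (map sgen (sorted_odd S))"
proof -
  have "sorted_wrt (<) (map to_nat xs) \<Longrightarrow> (\<And>x. x \<in> set xs \<Longrightarrow> gen_ok x \<and> gen_odd x) \<Longrightarrow>
      smon ({#}, set xs) = prod_list (map sgen xs)" for xs :: "('n, 'g) gen list"
  proof (induction xs)
    case (Cons x xs)
    then have "sgen x * smon ({#}, set xs) = smon ({#}, insert x (set xs))"
      by (intro smon_insert_min) (auto simp: mon_ok_def)
    then show ?case using Cons by simp
  qed (simp add: smon_1)
  from this[of "sorted_odd S"] assms show ?thesis
    by (simp add: sorted_sorted_odd)
qed

subsection \<open>Derivations\<close>

lemma PP_foldr: "(\<And>x. x \<in> set xs \<Longrightarrow> gen_ok x) \<Longrightarrow> foldr (\<lambda>y q. gv y \<star> q) xs one \<in> PP"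
  by (induction xs) (auto intro!: PP_one PP_pmul PP_gv)

lemma PP_dlist:
  "(\<And>x. f x \<in> PP) \<Longrightarrow> (\<And>x. x \<in> set xs \<Longrightarrow> gen_ok x) \<Longrightarrow> dlist d f xs \<in> PP"
  by (induction xs) (auto intro!: PP_add PP_pmul PP_sc PP_foldr PP_gv)

lemma PP_der: "(\<And>x. f x \<in> PP) \<Longrightarrow> p \<in> PP \<Longrightarrow> der d f p \<in> PP"
  unfolding der_def dmon_def
proof (intro PP_sum PP_sc PP_add PP_pmul PP_dlist PP_monp)
qed (auto simp: PP_def mon_ok_def dest: in_diffD)

lift_definition sder :: "nat \<Rightarrow> (('n::{finite,linorder}, 'g::finite) gen \<Rightarrow> ('n, 'g) salg) \<Rightarrow> ('n, 'g) salg \<Rightarrow> ('n, 'g) salg"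
  is der by (rule PP_der) auto

lemma der_superset:
  assumes "finite A" "Poly_Mapping.keys p \<subseteq> A"
  shows "der d f p = (\<Sum>m\<in>A. sc (Poly_Mapping.lookup p m) (dmon d f m))"
proof -
  have "sc 0 q = 0" for q :: "('n, 'g) poly" by (rule poly_mapping_eqI) (simp add: lookup_sc)
  then show ?thesis unfolding der_def
    by (intro sum.mono_neutral_left) (use assms in \<open>auto simp: in_keys_iff\<close>)
qed

lemma sc_add_left: "sc (a + b) q = sc a q + sc b q"
  by (rule poly_mapping_eqI) (simp add: lookup_sc lookup_add distrib_right)

lemma sc_sc: "sc a (sc b q) = sc (a * b) q"
  by (rule poly_mapping_eqI) (simp add: lookup_sc)

lemma sder_add: "sder d f (p + q) = sder d f p + sder d f q"
proof (transfer, goal_cases)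
  case (1 d f p q)
  let ?A = "Poly_Mapping.keys p \<union> Poly_Mapping.keys q"
  show ?case
    by (subst (1 2 3) der_superset[where A = ?A])
      (use Poly_Mapping.keys_add[of p q] in \<open>auto simp: lookup_add sc_add_left sum.distrib\<close>)
qed

lemma sder_scaleR: "sder d f (r *\<^sub>R p) = r *\<^sub>R sder d f p"
proof (transfer, goal_cases)
  case (1 d f r p)
  show ?case
    by (subst (1 2) der_superset[where A = "Poly_Mapping.keys p"])
      (use keys_sc_subset[of r p] in \<open>auto simp: lookup_sc sc_sc sc_sum\<close>)
qed

lemma sder_0 [simp]: "sder d f 0 = 0"
  using sder_scaleR[of d f 0 0] by simp

lemma sder_uminus: "sder d f (- p) = - sder d f p"
  using sder_scaleR[of d f "-1" p] by simp

lemma sder_diff: "sder d f (p - q) = sder d f p - sder d f q"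
  using sder_add[of d f p "- q"] by (simp add: sder_uminus)

lemma sder_sum: "sder d f (sum g A) = (\<Sum>x\<in>A. sder d f (g x))"
  by (induction A rule: infinite_finite_induct) (auto simp: sder_add)

definition psg :: "nat \<Rightarrow> ('n, 'g) gen \<Rightarrow> real" where
  "psg d x = (-1) ^ (d * (if gen_odd x then 1 else 0))"

fun sdl :: "nat \<Rightarrow> (('n::{finite,linorder}, 'g::finite) gen \<Rightarrow> ('n, 'g) salg) \<Rightarrow> ('n, 'g) gen list \<Rightarrow> ('n, 'g) salg" where
  "sdl d f [] = 0"
| "sdl d f (x # xs) = f x * prod_list (map sgen xs) + psg d x *\<^sub>R (sgen x * sdl d f xs)"

lemma Rep_prod_list:
  "(\<And>x. x \<in> set xs \<Longrightarrow> gen_ok x) \<Longrightarrow> Rep_salg (prod_list (map sgen xs)) = foldr (\<lambda>y q. gv y \<star> q) xs one"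
  by (induction xs) (auto simp: one_salg.rep_eq times_salg.rep_eq sgen.rep_eq)

lemma Rep_sdl:
  "(\<And>x. x \<in> set xs \<Longrightarrow> gen_ok x) \<Longrightarrow> Rep_salg (sdl d f xs) = dlist d (\<lambda>x. Rep_salg (f x)) xs"
  by (induction xs)
    (auto simp: zero_salg.rep_eq times_salg.rep_eq sgen.rep_eq plus_salg.rep_eq scaleR_salg.rep_eq psg_def Rep_prod_list)

lemma sum_mset_count_scaleR:
  fixes h :: "'a \<Rightarrow> 'b::real_vector"
  shows "(\<Sum>e\<in>set_mset E. real (count E e) *\<^sub>R h e) = (\<Sum>e\<in>#E. h e)"
proof (induction E)
  case (add x E)
  have "(\<Sum>e\<in>set_mset (add_mset x E). real (count (add_mset x E) e) *\<^sub>R h e)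
      = (\<Sum>e\<in>insert x (set_mset E). real (count E e) *\<^sub>R h e + (if e = x then h x else 0))"
    by (intro sum.cong) (auto simp: scaleR_left_distrib)
  also have "\<dots> = (\<Sum>e\<in>set_mset E. real (count E e) *\<^sub>R h e) + h x"
    by (cases "x \<in># E") (auto simp: sum.distrib insert_absorb not_in_iff)
  finally show ?case using add by (simp add: add.commute)
qed simp

lemma scaleR_sum_mset: "r *\<^sub>R (\<Sum>e\<in>#E. h e) = (\<Sum>e\<in>#E. r *\<^sub>R h e :: 'b::real_vector)"
  by (induction E) (auto simp: scaleR_add_right)

lemma sder_smon:
  assumes "mon_ok (E, S)"
  shows "sder d f (smon (E, S)) = (\<Sum>e\<in>#E. f e * smon (E - {#e#}, S)) + smon (E, {}) * sdl d f (sorted_odd S)"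
proof -
  have ok: "mon_ok (E, {})" "\<And>e. mon_ok (E - {#e#}, S)" "\<And>x. x \<in> set (sorted_odd S) \<Longrightarrow> gen_ok x"
    using assms by (auto simp: mon_ok_def dest: in_diffD)
  have "Rep_salg (sder d f (smon (E, S))) = dmon d (\<lambda>x. Rep_salg (f x)) (E, S)"
    using assms by (subst sder.rep_eq, subst der_superset[where A = "{(E, S)}"])
      (auto simp: smon.rep_eq monp_def lookup_single intro!: poly_mapping_eqI simp: lookup_sc comp_def)
  also have "\<dots> = Rep_salg ((\<Sum>e\<in>set_mset E. real (count E e) *\<^sub>R (f e * smon (E - {#e#}, S)))
      + smon (E, {}) * sdl d f (sorted_odd S))"
    using ok by (simp add: dmon_def plus_salg.rep_eq times_salg.rep_eq Rep_salg_sum scaleR_salg.rep_eq smon.rep_eq Rep_sdl)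
  finally show ?thesis by (simp add: Rep_salg_inject sum_mset_count_scaleR)
qed

definition par :: "bool \<Rightarrow> ('n::{finite,linorder}, 'g::finite) salg \<Rightarrow> bool" where
  "par b p = (\<forall>m\<in>mons p. odd (size (filter_mset gen_odd (gm m))) = b)"

lemma par_commute_gen:
  assumes "par b p"
  shows "p * sgen y = (if b \<and> gen_odd y then -1 else 1) *\<^sub>R (sgen y * p)"
proof (cases "gen_odd y")
  case True
  have *: "smon m * sgen y = (-1) ^ size (filter_mset gen_odd (gm m)) *\<^sub>R (sgen y * smon m)" if "mon_ok m" for m
    using that
  proof (induction rule: mon_gen_induct)
    case empty
    then show ?case by (simp add: smon_1)
  next
    case (step x m m0)
    show ?case
    proof (cases "gen_odd x")
      case odd: True
      have "sgen x * (sgen y * smon m0) = - (sgen y * (sgen x * smon m0))"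
        using sgen_odd_swap[OF odd True] by (simp flip: mult.assoc)
      then show ?thesis using step odd by (simp add: mult.assoc)
    next
      case False
      have "sgen x * (sgen y * smon m0) = (sgen y * (sgen x * smon m0))"
        using sgen_even_central[OF False, of "sgen y"] by (simp flip: mult.assoc)
      then show ?thesis using step False by (simp add: mult.assoc)
    qed
  qed
  have "p * sgen y = (\<Sum>m\<in>mons p. coef p m *\<^sub>R (smon m * sgen y))"
    by (subst salg_expand[of p]) (simp add: sum_distrib_right)
  also have "\<dots> = (\<Sum>m\<in>mons p. (if b then -1 else 1) *\<^sub>R (sgen y * coef p m *\<^sub>R smon m))"
    using assms by (intro sum.cong) (auto simp: * mons_ok par_def)
  also have "\<dots> = (if b then -1 else 1) *\<^sub>R (sgen y * p)"
    by (subst (2) salg_expand[of p]) (simp add: sum_distrib_left scaleR_sum_right)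
  finally show ?thesis using True by simp
qed (simp add: sgen_even_central)

text \<open>The parity condition that makes the graded Leibniz rule compatible with the
  anticommutation of odd generators.\<close>

definition graded_on_gens :: "nat \<Rightarrow> (('n::{finite,linorder}, 'g::finite) gen \<Rightarrow> ('n, 'g) salg) \<Rightarrow> bool" where
  "graded_on_gens d f = (\<forall>x. gen_ok x \<longrightarrow> par (gen_odd x \<noteq> odd d) (f x))"

text \<open>Passing an odd generator, \<open>f x\<close> and \<open>f y\<close> pick up the sign
  \<open>(-1) ^ Suc d\<close>. This is opposite to the sign \<open>psg d\<close> of the Leibniz
  rule, so the two terms trade places with a minus sign.\<close>

lemma sdl_swap:
  assumes "graded_on_gens d f" "gen_ok x" "gen_ok y" "gen_odd x" "gen_odd y"
  shows "sdl d f (x # y # xs) = - sdl d f (y # x # xs)"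
proof -
  have 1: "f x * (sgen y * q) = (-1) ^ Suc d *\<^sub>R (sgen y * (f x * q))" for q
    using par_commute_gen[of _ "f x" y] assms by (auto simp: graded_on_gens_def mult.assoc[symmetric])
  have 2: "f y * (sgen x * q) = (-1) ^ Suc d *\<^sub>R (sgen x * (f y * q))" for q
    using par_commute_gen[of _ "f y" x] assms by (auto simp: graded_on_gens_def mult.assoc[symmetric])
  have 3: "sgen x * (sgen y * q) = - (sgen y * (sgen x * q))" for q
    using sgen_odd_swap[OF assms(4,5)] by (simp flip: mult.assoc)
  show ?thesis using assms(4,5)
    by (simp add: 1 2 3 psg_def scaleR_add_right distrib_left minus_one_power_iff)
qed

text \<open>The product with a repeated odd letter is 0, so its formal derivative has to vanish too.
  Transpositions bring the two copies together, and there \<open>sdl_swap\<close> equates the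
  derivative with its own negative.\<close>

lemma sdl_repeat:
  assumes "graded_on_gens d f" "\<And>z. z \<in> set ys \<Longrightarrow> gen_ok z \<and> gen_odd z" "x \<in> set ys"
  shows "sdl d f (x # ys) = 0 \<and> sgen x * prod_list (map sgen ys) = 0"
  using assms(2,3)
proof (induction ys)
  case (Cons y ys)
  have xy: "gen_ok x" "gen_ok y" "gen_odd x" "gen_odd y" using Cons.prems by auto
  have s: "sdl d f (x # y # ys) = - sdl d f (y # x # ys)"
    by (rule sdl_swap) (use xy assms(1) in auto)
  have p: "sgen x * (sgen y * q) = - (sgen y * (sgen x * q))" for q
    using sgen_odd_swap[OF xy(3,4)] by (simp flip: mult.assoc)
  show ?case
  proof (cases "x = y")
    case True
    then have "2 *\<^sub>R sdl d f (x # y # ys) = 0"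
      using s unfolding scaleR_2 by (metis add.right_inverse)
    then show ?thesis using True sgen_odd_square[OF xy(3)] by (simp flip: mult.assoc del: sdl.simps)
  next
    case False
    then have "sdl d f (x # ys) = 0 \<and> sgen x * prod_list (map sgen ys) = 0"
      using Cons by auto
    then show ?thesis using s p by (simp add: sdl.simps(2)[of d f y] del: sdl.simps) 
  qed
qed simp

text \<open>Sorting a letter into place multiplies the word and its formal derivative by one common
  scalar \<open>e\<close>, a product of transposition signs. Hence the definition by sorted words
  agrees with the Leibniz rule on unsorted ones.\<close>

lemma sdl_insort:
  assumes "graded_on_gens d f" "\<And>z. z \<in> set ys \<Longrightarrow> gen_ok z \<and> gen_odd z" "gen_ok x" "gen_odd x"
  shows "\<exists>e::real. e *\<^sub>R sdl d f (insort_key to_nat x ys) = sdl d f (x # ys) \<and>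
    e *\<^sub>R prod_list (map sgen (insort_key to_nat x ys)) = sgen x * prod_list (map sgen ys)"
  using assms(2)
proof (induction ys)
  case Nil
  then show ?case by (intro exI[of _ 1]) simp
next
  case (Cons y ys)
  show ?case
  proof (cases "to_nat x \<le> to_nat y")
    case True
    then show ?thesis by (intro exI[of _ 1]) simp
  next
    case False
    from Cons obtain e :: real where e: "e *\<^sub>R sdl d f (insort_key to_nat x ys) = sdl d f (x # ys)"
      "e *\<^sub>R prod_list (map sgen (insort_key to_nat x ys)) = sgen x * prod_list (map sgen ys)" by auto
    have y: "gen_ok y" "gen_odd y" using Cons.prems by auto
    have p: "sgen x * (sgen y * q) = - (sgen y * (sgen x * q))" for q
      using sgen_odd_swap[OF assms(4) y(2)] by (simp flip: mult.assoc)
    have "e *\<^sub>R sdl d f (y # insort_key to_nat x ys) = f y * (e *\<^sub>R prod_list (map sgen (insort_key to_nat x ys)))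
        + psg d y *\<^sub>R (sgen y * (e *\<^sub>R sdl d f (insort_key to_nat x ys)))"
      by (simp add: scaleR_add_right mult.commute)
    also have "\<dots> = sdl d f (y # x # ys)" by (simp only: e) simp
    also have "\<dots> = - sdl d f (x # y # ys)"
      using sdl_swap[OF assms(1) assms(3) y(1) assms(4) y(2), of ys] by simp
    finally have "(- e) *\<^sub>R sdl d f (insort_key to_nat x (y # ys)) = sdl d f (x # y # ys)"
      using False by (simp del: sdl.simps)
    moreover have "(- e) *\<^sub>R prod_list (map sgen (insort_key to_nat x (y # ys))) = sgen x * prod_list (map sgen (y # ys))"
    proof -
      have "e *\<^sub>R (sgen y * prod_list (map sgen (insort_key to_nat x ys))) = sgen y * (sgen x * prod_list (map sgen ys))"
        using e(2) by (metis mult_scaleR_right)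
      then show ?thesis using False p by simp
    qed
    ultimately show ?thesis by blast
  qed
qed

text \<open>The Leibniz rule for one generator on the left, from which the general facts on
  derivations follow by peeling off generators. An even generator only enlarges the even multiset;
  an odd one has to be sorted into the odd word.\<close>

lemma sder_gen_mult:
  assumes f: "graded_on_gens d f" and x: "gen_ok x"
  shows "sder d f (sgen x * p) = f x * p + psg d x *\<^sub>R (sgen x * sder d f p)"
proof (induction p rule: salg_linear_induct)
  case (smon m)
  obtain E S where m: "m = (E, S)" by (cases m)
  have ok: "mon_ok (E, S)" using smon mons_ok m by auto
  then have S: "finite S" "\<And>z. z \<in> S \<Longrightarrow> gen_ok z \<and> gen_odd z" and okE: "mon_ok (E, {})" "mon_ok ({#}, S)"
    by (auto simp: mon_ok_def)
  have okE': "mon_ok (E - {#e#}, {})" "mon_ok (E - {#e#}, S)" for e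
    using ok by (auto simp: mon_ok_def dest: in_diffD)
  show ?case
  proof (cases "gen_odd x")
    case False
    have okx: "mon_ok (add_mset x E, S)" "mon_ok ({#x#}, {})" using ok x False by (auto simp: mon_ok_def)
    have cent: "sgen x * q = q * sgen x" for q by (rule sgen_even_central[OF False])
    have 1: "sgen x * smon (E', S') = smon (add_mset x E', S')" if "mon_ok (E', S')" for E' S'
      using smon_mult[OF okx(2) that] by (simp add: sgen_even[OF x False])
    have "f e * smon (add_mset x E - {#e#}, S) = sgen x * (f e * smon (E - {#e#}, S))" if "e \<in># E" for e
    proof -
      have "add_mset x E - {#e#} = add_mset x (E - {#e#})" using that by simp
      then show ?thesis using 1[OF okE'(2)[of e]] cent[of "f e"]
        by (metis mult.assoc)
    qed
    then have "(\<Sum>e\<in>#add_mset x E. f e * smon (add_mset x E - {#e#}, S))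
        = f x * smon (E, S) + sgen x * (\<Sum>e\<in>#E. f e * smon (E - {#e#}, S))"
      by (simp add: sum_mset_distrib_left cong: image_mset_cong)
    then show ?thesis
      using 1[OF okE(1), symmetric] False
      by (simp add: m 1[OF ok] sder_smon[OF ok] sder_smon[OF okx(1)] psg_def distrib_left mult.assoc)
  next
    case True
    \<comment> \<open>The even factor is central, so it can be split off and the odd word treated
      alone.\<close>
    let ?L = "prod_list (map sgen (sorted_odd S))"
    have pL: "smon (E', S) = smon (E', {}) * ?L" if "mon_ok (E', S)" for E'
      using smon_mult[of E' "{#}" S] that prod_sorted_odd[OF S] okE by (simp add: mon_ok_def)
    let ?D = "\<lambda>T. (\<Sum>e\<in>#E. f e * smon (E - {#e#}, T))"
    have D: "?D S = ?D {} * ?L"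
      using pL okE' by (simp add: sum_mset_distrib_right mult.assoc)
    have fe: "f e * smon (E - {#e#}, {}) * sgen x = psg d x *\<^sub>R (sgen x * (f e * smon (E - {#e#}, {})))" if "e \<in># E" for e
    proof -
      have "gen_ok e" "\<not> gen_odd e" using that ok by (auto simp: mon_ok_def)
      then have "f e * sgen x = psg d x *\<^sub>R (sgen x * f e)"
        using f par_commute_gen[of "odd d" "f e" x] True by (auto simp: graded_on_gens_def psg_def minus_one_power_iff)
      then show ?thesis using smon_central[of "E - {#e#}" "sgen x"]
        by (metis (no_types, lifting) mult.assoc mult_scaleR_left)
    qed
    have fe': "?D {} * sgen x = psg d x *\<^sub>R (sgen x * ?D {})"
    proof -
      have "?D {} * sgen x = (\<Sum>e\<in>#E. psg d x *\<^sub>R (sgen x * (f e * smon (E - {#e#}, {}))))"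
        using fe by (simp add: sum_mset_distrib_right cong: image_mset_cong)
      then show ?thesis by (simp add: sum_mset_distrib_left scaleR_sum_mset)
    qed
    let ?M = "smon (E, {})" and ?ys = "sorted_odd S"
    have ys: "\<And>z. z \<in> set ?ys \<Longrightarrow> gen_ok z \<and> gen_odd z" using S by simp
    have lhs: "sgen x * smon (E, S) = ?M * (sgen x * ?L)"
      using pL[OF ok] smon_central[of E "sgen x"] by (metis mult.assoc)
    have rhs: "f x * smon (E, S) + psg d x *\<^sub>R (sgen x * sder d f (smon (E, S)))
        = ?M * sdl d f (x # ?ys) + ?D {} * (sgen x * ?L)"
    proof -
      have "f x * smon (E, S) = ?M * (f x * ?L)"
        using pL[OF ok] smon_central[of E "f x"] by (metis mult.assoc)
      moreover have "sgen x * (?M * q) = ?M * (sgen x * q)" for q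
        by (simp only: mult.assoc[symmetric] smon_central[of E "sgen x"])
      moreover have "psg d x *\<^sub>R (sgen x * ?D S) = ?D {} * (sgen x * ?L)"
      proof -
        have "psg d x *\<^sub>R (sgen x * ?D S) = (psg d x *\<^sub>R (sgen x * ?D {})) * ?L"
          by (simp only: D mult.assoc mult_scaleR_left)
        also have "\<dots> = ?D {} * (sgen x * ?L)"
          by (simp only: fe'[symmetric] mult.assoc)
        finally show ?thesis .
      qed
      ultimately show ?thesis
        by (simp only: sder_smon[OF ok] distrib_left scaleR_add_right sdl.simps mult_scaleR_right) simp
    qed
    \<comment> \<open>If \<open>x\<close> already occurs, both sides vanish by
      \<open>sdl_repeat\<close>; otherwise \<open>sdl_insort\<close> supplies the scalar.\<close>
    show ?thesis
    proof (cases "x \<in> S")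
      case True
      then show ?thesis using sdl_repeat[where x = x and ys = ?ys, OF f ys] lhs rhs S(1) by (simp add: m del: sdl.simps)
    next
      case False
      have okx: "mon_ok (E, insert x S)" "mon_ok ({#}, insert x S)" using ok x True by (auto simp: mon_ok_def)
      have okx': "mon_ok (E - {#e#}, insert x S)" for e
        using okx by (auto simp: mon_ok_def dest: in_diffD)
      let ?N = "prod_list (map sgen (insort_key to_nat x ?ys))"
      have N: "smon ({#}, insert x S) = ?N"
        using prod_sorted_odd[of "insert x S"] S x True sorted_odd_insert[OF S(1) False] by auto
      have pN: "smon (E', insert x S) = smon (E', {}) * ?N" if "mon_ok (E', insert x S)" for E'
        using smon_mult[of E' "{#}" "insert x S"] that okx N by (simp add: mon_ok_def)
      obtain e :: real where e: "e *\<^sub>R sdl d f (insort_key to_nat x ?ys) = sdl d f (x # ?ys)"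
        "e *\<^sub>R ?N = sgen x * ?L"
        using sdl_insort[OF f ys x True] by blast
      have "sgen x * smon (E, S) = e *\<^sub>R smon (E, insert x S)"
        using lhs e(2) pN[OF okx(1)] by (metis mult_scaleR_right)
      then have "sder d f (sgen x * smon (E, S)) = e *\<^sub>R (?D (insert x S) + ?M * sdl d f (insort_key to_nat x ?ys))"
        by (simp add: sder_scaleR sder_smon[OF okx(1)] sorted_odd_insert[OF S(1) False])
      also have "?D (insert x S) = ?D {} * ?N"
        using pN okx' by (simp add: sum_mset_distrib_right mult.assoc)
      also have "e *\<^sub>R (?D {} * ?N + ?M * sdl d f (insort_key to_nat x ?ys))
         = ?D {} * (e *\<^sub>R ?N) + ?M * (e *\<^sub>R sdl d f (insort_key to_nat x ?ys))"
        by (simp add: scaleR_add_right)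
      finally show ?thesis using rhs unfolding e m by (simp add: add.commute)
    qed
  qed
next
  case (add p q)
  then show ?case by (simp add: distrib_left sder_add scaleR_add_right add_ac)
next
  case (scaleR r p)
  have "psg d x *\<^sub>R (sgen x * sder d f (r *\<^sub>R p)) = r *\<^sub>R (psg d x *\<^sub>R (sgen x * sder d f p))"
    by (simp add: sder_scaleR mult.commute)
  then show ?case by (simp only: mult_scaleR_right sder_scaleR scaleR scaleR_add_right)
qed simp

lemma sder_1 [simp]: "sder d f 1 = 0"
  using sder_smon[of "{#}" "{}" d f] by (simp add: mon_ok_def smon_1)

lemma sder_sgen: "graded_on_gens d f \<Longrightarrow> gen_ok x \<Longrightarrow> sder d f (sgen x) = f x"
  using sder_gen_mult[of d f x 1] by simp

lemma mons_sum: "mons (sum f A) \<subseteq> (\<Union>x\<in>A. mons (f x))"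
  unfolding mons_def Rep_salg_sum by (rule keys_sum_subset)

lemma mons_diff: "mons (p - q) \<subseteq> mons p \<union> mons q"
  using mons_add[of p "- q"] by simp

lemma mons_smon_ok: "mon_ok m \<Longrightarrow> mons (smon m) = {m}"
  by (simp add: mons_def smon.rep_eq monp_def)

lemma par_0 [simp]: "par b 0"
  by (simp add: par_def)

lemma par_diff: "par b p \<Longrightarrow> par b q \<Longrightarrow> par b (p - q)"
  unfolding par_def using mons_diff[of p q] by blast

lemma par_sgen: "gen_odd x = b \<Longrightarrow> par b (sgen x)"
  unfolding par_def using mons_sgen[of _ x] by auto

lemma sder_mult:
  assumes f: "graded_on_gens d f" and p: "par b p"
  shows "sder d f (p * q) = sder d f p * q + (if b \<and> odd d then -1 else 1) *\<^sub>R (p * sder d f q)"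
proof -
  have *: "sder d f (smon m * q) = sder d f (smon m) * q
      + ((-1) ^ (d * size (filter_mset gen_odd (gm m)))) *\<^sub>R (smon m * sder d f q)" if "mon_ok m" for m
    using that
  proof (induction rule: mon_gen_induct)
    case empty
    then show ?case by (simp add: smon_1)
  next
    case (step x m m0)
    show ?case
      by (simp add: step(4-6) mult.assoc sder_gen_mult[OF f step(1)] psg_def algebra_simps power_add)
  qed
  have "sder d f (smon m * q) = sder d f (smon m) * q + (if b \<and> odd d then -1 else 1) *\<^sub>R (smon m * sder d f q)"
    if "m \<in> mons p" for m
    using *[OF mons_ok[OF that]] p that by (auto simp: par_def minus_one_power_iff)
  note smon = this
  define s :: real where "s = (if b \<and> odd d then -1 else 1)"
  show ?thesis unfolding s_def[symmetric]
  proof (rule salg_linear_induct[where p = p])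
    show "sder d f (smon m * q) = sder d f (smon m) * q + s *\<^sub>R (smon m * sder d f q)" if "m \<in> mons p" for m
      using smon[OF that] by (simp add: s_def)
  qed (simp_all add: distrib_right sder_add sder_scaleR scaleR_add_right mult.commute)
qed

text \<open>The tool for all gradings and estimates: each surviving monomial arises by trading one
  generator \<open>x\<close> for a monomial of \<open>f x\<close>, so it is enough to control
  \<open>f\<close> on generators.\<close>

lemma mons_sder:
  assumes f: "graded_on_gens d f" and "m' \<in> mons (sder d f p)"
  shows "\<exists>m\<in>mons p. \<exists>x\<in>#gm m. \<exists>m''\<in>mons (f x). gen_ok x \<and> gm m' = gm m - {#x#} + gm m''"
proof -
  have *: "\<exists>x\<in>#gm m. \<exists>m''\<in>mons (f x). gen_ok x \<and> gm m' = gm m - {#x#} + gm m''"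
    if "mon_ok m" "m' \<in> mons (sder d f (smon m))" for m m'
    using that
  proof (induction arbitrary: m' rule: mon_gen_induct)
    case empty
    then show ?case by (simp add: smon_1)
  next
    case (step x m m0)
    have "m' \<in> mons (f x * smon m0 + psg d x *\<^sub>R (sgen x * sder d f (smon m0)))"
      using step.prems by (simp add: step.hyps sder_gen_mult[OF f step.hyps(1)])
    then consider "m' \<in> mons (f x * smon m0)" | "m' \<in> mons (sgen x * sder d f (smon m0))"
      by (blast dest!: subsetD[OF mons_add] subsetD[OF mons_scaleR])
    then show ?case
    proof cases
      case 1
      from mons_mult[OF 1] obtain m1 m2 where m: "m1 \<in> mons (f x)" "m2 \<in> mons (smon m0)" "gm m' = gm m1 + gm m2"
        by blast
      then have "gm m' = gm m - {#x#} + gm m1"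
        using step.hyps by (simp add: mons_smon_ok add.commute)
      then show ?thesis using m(1) step.hyps by (intro bexI[of _ x] bexI[of _ m1] conjI) simp_all
    next
      case 2
      from mons_mult[OF 2] obtain m1 m2 where m: "m1 \<in> mons (sgen x)"
        "m2 \<in> mons (sder d f (smon m0))" "gm m' = gm m1 + gm m2" by blast
      from step.IH[OF m(2)] obtain y m'' where y: "y \<in># gm m0" "m'' \<in> mons (f y)" "gen_ok y"
        "gm m2 = gm m0 - {#y#} + gm m''" by blast
      have "gm m' = gm m - {#y#} + gm m''"
        using m(3) y mons_sgen[OF m(1)] step.hyps(5) by simp
      then show ?thesis using y step.hyps(5) by (intro bexI[of _ y] bexI[of _ m''] conjI) simp_all
    qed
  qed
  have "sder d f p = (\<Sum>m\<in>mons p. coef p m *\<^sub>R sder d f (smon m))"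
    by (subst salg_expand) (simp add: sder_sum sder_scaleR)
  then have "mons (sder d f p) \<subseteq> (\<Union>m\<in>mons p. mons (coef p m *\<^sub>R sder d f (smon m)))"
    by (simp only: mons_sum)
  with assms(2) have "m' \<in> (\<Union>m\<in>mons p. mons (coef p m *\<^sub>R sder d f (smon m)))" ..
  then obtain m where m: "m \<in> mons p" "m' \<in> mons (sder d f (smon m))"
    by (blast dest!: subsetD[OF mons_scaleR])
  from *[OF mons_ok[OF m(1)] m(2)] m(1) show ?thesis by (intro bexI[of _ m])
qed

text \<open>In the square of an odd derivation the cross terms of the Leibniz rule cancel, because
  \<open>f x\<close> and \<open>x\<close> have opposite parity. The square is therefore an even
  derivation, determined by generators.\<close>

lemma sder_square_zero:
  assumes f: "graded_on_gens 1 f" and z: "\<And>x. gen_ok x \<Longrightarrow> sder 1 f (f x) = 0"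
  shows "sder 1 f (sder 1 f p) = 0"
proof (induction p rule: salg_induct)
  case (gen x p)
  have "par (\<not> gen_odd x) (f x)" using f gen(1) by (simp add: graded_on_gens_def)
  from sder_mult[OF f this, of p] show ?case
    using gen z by (simp add: sder_gen_mult[OF f gen(1)] sder_add sder_scaleR psg_def del: One_nat_def)
qed (simp_all add: sder_add sder_scaleR)

text \<open>The anticommutator of two odd derivations is an even derivation. Acting diagonally on
  generators, it acts on a monomial by the sum of their eigenvalues.\<close>

lemma sder_anticommutator:
  assumes f: "graded_on_gens 1 f" and g: "graded_on_gens 1 g"
    and z: "\<And>x. gen_ok x \<Longrightarrow> sder 1 f (g x) + sder 1 g (f x) = c x *\<^sub>R sgen x"
    and m: "mon_ok m"
  shows "sder 1 f (sder 1 g (smon m)) + sder 1 g (sder 1 f (smon m)) = (\<Sum>x\<in>#gm m. c x) *\<^sub>R smon m"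
  using m
proof (induction rule: mon_gen_induct)
  case (step x m m0)
  let ?p = "smon m0"
  have pf: "par (\<not> gen_odd x) (f x)" and pg: "par (\<not> gen_odd x) (g x)"
    using f g step(1) by (simp_all add: graded_on_gens_def)
  let ?A = "\<lambda>p. sder 1 f (sder 1 g p) + sder 1 g (sder 1 f p)"
  have "?A (sgen x * ?p) = (sder 1 f (g x) + sder 1 g (f x)) * ?p + sgen x * ?A ?p"
    using sder_mult[OF f pg, of ?p] sder_mult[OF g pf, of ?p]
    by (simp add: sder_gen_mult[OF f step(1)] sder_gen_mult[OF g step(1)] sder_add sder_scaleR psg_def algebra_simps del: One_nat_def)
  then show ?case
    by (simp add: step z algebra_simps del: One_nat_def)
qed (simp add: smon_1)

lemma sder_commute_even:
  assumes f: "graded_on_gens d f" and g: "graded_on_gens 0 g"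
    and z: "\<And>x. gen_ok x \<Longrightarrow> sder d f (g x) = sder 0 g (f x)"
  shows "sder d f (sder 0 g p) = sder 0 g (sder d f p)"
proof (induction p rule: salg_induct)
  case (gen x p)
  have pf: "par (gen_odd x \<noteq> odd d) (f x)" and pg: "par (gen_odd x) (g x)"
    using f g gen(1) by (simp_all add: graded_on_gens_def)
  from sder_mult[OF f pg, of p] sder_mult[OF g pf, of p] show ?case
    using gen z by (simp add: sder_gen_mult[OF f gen(1)] sder_gen_mult[OF g gen(1)] sder_add sder_scaleR psg_def algebra_simps minus_one_power_iff)
qed (simp_all add: sder_add sder_scaleR)

lemma graded_on_gens_diff:
  "graded_on_gens d f \<Longrightarrow> graded_on_gens d g \<Longrightarrow> graded_on_gens d (\<lambda>x. f x - g x)"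
  by (simp add: graded_on_gens_def par_diff)

lemma sder_diff_gens:
  assumes f: "graded_on_gens d f" and g: "graded_on_gens d g"
  shows "sder d (\<lambda>x. f x - g x) p = sder d f p - sder d g p"
proof (induction p rule: salg_induct)
  case (gen x p)
  then show ?case
    using graded_on_gens_diff[OF f g] f g
    by (simp add: sder_gen_mult left_diff_distrib right_diff_distrib scaleR_diff_right)
next
  case (add p q)
  then show ?case by (simp add: sder_add add_diff_add)
qed (simp_all add: sder_scaleR scaleR_diff_right)

lemma salg_eqI: "(\<And>m. coef p m = coef q m) \<Longrightarrow> p = q"
  by (simp add: Rep_salg_inject[symmetric] poly_mapping_eqI coef_def)

lemma coef_add: "coef (p + q) m = coef p m + coef q m"
  by (simp add: coef_def plus_salg.rep_eq lookup_add)

lemma coef_scaleR: "coef (r *\<^sub>R p) m = r * coef p m"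
  by (simp add: coef_def scaleR_salg.rep_eq lookup_sc)

lemma coef_0 [simp]: "coef 0 m = 0"
  by (simp add: coef_def zero_salg.rep_eq)

lemma coef_sum: "coef (sum f A) m = (\<Sum>x\<in>A. coef (f x) m)"
  by (induction A rule: infinite_finite_induct) (auto simp: coef_add)

lemma coef_smon: "mon_ok m \<Longrightarrow> coef (smon m) m' = (if m = m' then 1 else 0)"
  by (simp add: coef_def smon.rep_eq monp_def lookup_single when_def)

lemma mons_iff_coef: "m \<in> mons p \<longleftrightarrow> coef p m \<noteq> 0"
  by (simp add: mons_def coef_def in_keys_iff)

subsection \<open>Rescaling of monomials\<close>

text \<open>Functions of operators that are diagonal on monomials; with a reciprocal for
  \<open>h\<close> it divides by a counting operator.\<close>

definition mscale :: "(('n, 'g) gen multiset \<Rightarrow> real) \<Rightarrow> ('n::{finite,linorder}, 'g::finite) salg \<Rightarrow> ('n, 'g) salg" where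
  "mscale h p = (\<Sum>m\<in>mons p. (h (gm m) * coef p m) *\<^sub>R smon m)"

lemma coef_mscale: "coef (mscale h p) m = h (gm m) * coef p m"
proof -
  have "coef (mscale h p) m = (\<Sum>m'\<in>mons p. h (gm m') * coef p m' * (if m' = m then 1 else 0))"
    unfolding mscale_def coef_sum
    by (intro sum.cong) (auto simp: coef_scaleR coef_smon mons_ok)
  also have "\<dots> = h (gm m) * coef p m"
    using mons_iff_coef[of m p] by (simp add: if_distrib cong: if_cong)
  finally show ?thesis .
qed

lemma mons_mscale: "mons (mscale h p) \<subseteq> mons p"
  by (auto simp: mons_iff_coef coef_mscale)

lemma mscale_add: "mscale h (p + q) = mscale h p + mscale h q"
  by (rule salg_eqI) (simp add: coef_mscale coef_add distrib_left)

lemma mscale_scaleR: "mscale h (r *\<^sub>R p) = r *\<^sub>R mscale h p"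
  by (rule salg_eqI) (simp add: coef_mscale coef_scaleR)

lemma mscale_0 [simp]: "mscale h 0 = 0"
  by (rule salg_eqI) (simp add: coef_mscale)

lemma mscale_uminus: "mscale h (- p) = - mscale h p"
  using mscale_scaleR[of h "-1" p] by simp

lemma mscale_const: "(\<And>m. m \<in> mons p \<Longrightarrow> h (gm m) = r) \<Longrightarrow> mscale h p = r *\<^sub>R p"
  unfolding mons_iff_coef by (rule salg_eqI) (auto simp: coef_mscale coef_scaleR)

lemma mscale_smon: "mon_ok m \<Longrightarrow> mscale h (smon m) = h (gm m) *\<^sub>R smon m"
  by (rule mscale_const) (simp add: mons_smon_ok)

lemma mscale_mscale_inverse:
  "(\<And>m. m \<in> mons p \<Longrightarrow> h (gm m) * h' (gm m) = 1) \<Longrightarrow> mscale h (mscale h' p) = p"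
  unfolding mons_iff_coef by (rule salg_eqI) (auto simp: coef_mscale simp flip: mult.assoc)

lemma sder_anticommutator_mscale:
  assumes "graded_on_gens 1 f" "graded_on_gens 1 g"
    and "\<And>x. gen_ok x \<Longrightarrow> sder 1 f (g x) + sder 1 g (f x) = c x *\<^sub>R sgen x"
  shows "sder 1 f (sder 1 g p) + sder 1 g (sder 1 f p) = mscale (\<lambda>M. \<Sum>x\<in>#M. c x) p"
proof (induction p rule: salg_linear_induct)
  case (smon m)
  show ?case
    using sder_anticommutator[OF assms mons_ok[OF smon]] by (simp add: mscale_smon mons_ok[OF smon])
next
  case (add p q)
  let ?A = "\<lambda>p. sder 1 f (sder 1 g p) + sder 1 g (sder 1 f p)"
  have "?A (p + q) = ?A p + ?A q" by (simp add: sder_add add_ac)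
  then show ?case by (simp only: add mscale_add)
next
  case (scaleR r p)
  then show ?case by (simp add: sder_scaleR mscale_scaleR flip: scaleR_add_right)
qed simp

text \<open>A derivation whose elementary replacements leave \<open>h\<close> unchanged maps each
  eigenspace of \<open>mscale h\<close> to itself.\<close>

lemma mscale_sder:
  assumes f: "graded_on_gens d f"
    and h: "\<And>M x m. x \<in># M \<Longrightarrow> m \<in> mons (f x) \<Longrightarrow> h (M - {#x#} + gm m) = h M"
  shows "mscale h (sder d f p) = sder d f (mscale h p)"
proof (induction p rule: salg_linear_induct)
  case (smon m)
  have "mscale h (sder d f (smon m)) = h (gm m) *\<^sub>R sder d f (smon m)"
  proof (rule mscale_const)
    fix m' assume "m' \<in> mons (sder d f (smon m))"
    from mons_sder[OF f this] show "h (gm m') = h (gm m)"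
      using h by (auto simp: mons_smon_ok mons_ok[OF smon])
  qed
  then show ?case by (simp add: mscale_smon mons_ok[OF smon] sder_scaleR)
qed (simp_all add: sder_add sder_scaleR mscale_add mscale_scaleR)

lemma sder_mult_even:
  assumes f: "graded_on_gens 0 f"
  shows "sder 0 f (p * q) = sder 0 f p * q + p * sder 0 f q"
proof (induction p rule: salg_linear_induct)
  case (smon m)
  have "par (odd (size (filter_mset gen_odd (gm m)))) (smon m)"
    using mons_ok[OF smon] by (simp add: par_def mons_smon_ok)
  from sder_mult[OF f this] show ?case by simp
qed (simp_all add: distrib_right sder_add sder_scaleR scaleR_add_right)

lemma par_False_central:
  assumes "par False p"
  shows "p * q = q * p"
proof (induction q rule: salg_induct)
  case (gen x q)
  have "p * sgen x = sgen x * p" using par_commute_gen[OF assms, of x] by simp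
  then show ?case using gen by (metis mult.assoc)
qed (simp_all add: distrib_left distrib_right)

lemma mons_empty_iff: "mons p = {} \<longleftrightarrow> p = 0"
  using salg_expand[of p] by auto

lemma dlist_cong:
  "(\<And>x. x \<in> set xs \<Longrightarrow> f x = g x) \<Longrightarrow> dlist d f xs = dlist d g xs"
  by (induction xs) auto

text \<open>The lifted maps and the original ones may differ on generators that are not
  \<open>gen_ok\<close>; elements of \<open>PP\<close> never contain these.\<close>

lemma der_cong:
  assumes "p \<in> PP" "\<And>x. gen_ok x \<Longrightarrow> f x = g x"
  shows "der d f p = der d g p"
proof -
  have "dmon d f m = dmon d g m" if "mon_ok m" for m
    using that assms(2) unfolding dmon_def
    by (intro arg_cong2[of _ _ _ _ "(+)"] sum.cong arg_cong2[of _ _ _ _ "(\<star>)"] dlist_cong)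
      (auto simp: mon_ok_def)
  then show ?thesis using assms(1) unfolding der_def PP_def by simp
qed

section \<open>Total derivatives\<close>

fun pdg :: "'n \<Rightarrow> ('n::{finite,linorder}, 'g::finite) gen \<Rightarrow> ('n, 'g) salg" where
  "pdg mu (Jet f J) = sgen (Jet f (J(mu := Suc (J mu))))"
| "pdg mu (Dx nu) = 0"

definition pd :: "'n \<Rightarrow> ('n::{finite,linorder}, 'g::finite) salg \<Rightarrow> ('n, 'g) salg" where
  "pd mu = sder 0 (pdg mu)"

definition pdJ :: "('n \<Rightarrow> nat) \<Rightarrow> ('n::{finite,linorder}, 'g::finite) salg \<Rightarrow> ('n, 'g) salg" where
  "pdJ J p = fold (\<lambda>mu q. (pd mu ^^ J mu) q) (sorted_list_of_set UNIV) p"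

lemma gen_ok_Jet: "gen_ok (Jet f J) = gen_ok (Jet f J')"
  by (cases f) auto

lemma graded_pdg: "graded_on_gens 0 (pdg mu)"
proof -
  have "par (gen_odd x) (pdg mu x)" for x :: "('a, 'b) gen"
    by (cases x) (auto intro: par_sgen)
  then show ?thesis by (simp add: graded_on_gens_def)
qed

lemma Rep_pd:
  fixes p :: "('n::{finite,linorder}, 'g::finite) salg"
  shows "Rep_salg (pd mu p) = PD mu (Rep_salg p)"
proof -
  have *: "(Rep_salg \<circ> pdg mu) x = pd_gen mu x" if "gen_ok x" for x :: "('n, 'g) gen"
  proof (cases x)
    case (Jet f J)
    then have "gen_ok (Jet f (J(mu := Suc (J mu))))" using that gen_ok_Jet by blast
    then show ?thesis by (simp add: Jet sgen.rep_eq)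
  qed (simp add: zero_salg.rep_eq)
  show ?thesis
    unfolding pd_def PD_def sder.rep_eq comp_id by (rule der_cong[OF Rep_salg *])
qed

lemma Rep_pdJ: "Rep_salg (pdJ J p) = PDJ J (Rep_salg p)"
proof -
  have pow: "Rep_salg ((pd mu ^^ n) p) = (PD mu ^^ n) (Rep_salg p)" for mu n and p :: "('a, 'b) salg"
    by (induction n) (auto simp: Rep_pd)
  have "Rep_salg (fold (\<lambda>mu q. (pd mu ^^ J mu) q) xs p) = fold (\<lambda>mu q. (PD mu ^^ J mu) q) xs (Rep_salg p)" for xs
    by (induction xs arbitrary: p) (auto simp: pow)
  then show ?thesis by (simp add: pdJ_def PDJ_def)
qed

lemma pd_add: "pd mu (p + q) = pd mu p + pd mu q"
  and pd_diff: "pd mu (p - q) = pd mu p - pd mu q"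
  and pd_uminus: "pd mu (- p) = - pd mu p"
  and pd_scaleR: "pd mu (r *\<^sub>R p) = r *\<^sub>R pd mu p"
  and pd_0 [simp]: "pd mu 0 = 0"
  and pd_sum: "pd mu (sum g A) = (\<Sum>x\<in>A. pd mu (g x))"
  by (simp_all add: pd_def sder_add sder_diff sder_uminus sder_scaleR sder_sum)

lemma pd_mult: "pd mu (p * q) = pd mu p * q + p * pd mu q"
  unfolding pd_def by (rule sder_mult_even[OF graded_pdg])

lemma pd_jet: "pd mu (sgen (Jet f J)) = sgen (Jet f (J(mu := Suc (J mu))))"
proof (cases "gen_ok (Jet f J)")
  case True
  then show ?thesis unfolding pd_def by (simp add: sder_sgen graded_pdg)
next
  case False
  then have "\<not> gen_ok (Jet f (J(mu := Suc (J mu))))" using gen_ok_Jet by blast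
  with False show ?thesis by (simp add: sgen_not_ok)
qed

lemma pd_commute: "pd mu (pd nu p) = pd nu (pd mu p)"
  unfolding pd_def
proof (rule sder_commute_even[OF graded_pdg graded_pdg])
  show "sder 0 (pdg mu) (pdg nu x) = sder 0 (pdg nu) (pdg mu x)" for x :: "('a, 'b) gen"
  proof (cases x)
    case (Jet f J)
    have "J(nu := Suc (J nu), mu := Suc ((J(nu := Suc (J nu))) mu)) = J(mu := Suc (J mu), nu := Suc ((J(mu := Suc (J mu))) nu))"
      by auto
    then have "pd mu (pdg nu x) = pd nu (pdg mu x)"
      unfolding Jet by (simp only: pd_jet pdg.simps)
    then show ?thesis unfolding pd_def .
  qed simp
qed

lemma pdJ_induct:
  assumes "Q p" "\<And>mu p. Q p \<Longrightarrow> Q (pd mu p)"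
  shows "Q (pdJ J p)"
proof -
  have pow: "Q p \<Longrightarrow> Q ((pd mu ^^ n) p)" for mu n p
    by (induction n) (auto intro: assms)
  have "Q p \<Longrightarrow> Q (fold (\<lambda>mu q. (pd mu ^^ J mu) q) xs p)" for xs p
    by (induction xs arbitrary: p) (auto intro: pow)
  then show ?thesis using assms(1) by (simp add: pdJ_def)
qed

lemma pdJ_commute_map:
  assumes "\<And>mu p. T (pd mu p) = pd mu (T p)"
  shows "T (pdJ J p) = pdJ J (T p)"
proof -
  have pow: "T ((pd mu ^^ n) p) = (pd mu ^^ n) (T p)" for mu n p
    by (induction n) (auto simp: assms)
  have "T (fold (\<lambda>mu q. (pd mu ^^ J mu) q) xs p) = fold (\<lambda>mu q. (pd mu ^^ J mu) q) xs (T p)" for xs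
    by (induction xs arbitrary: p) (auto simp: pow)
  then show ?thesis by (simp add: pdJ_def)
qed

lemma pdJ_scaleR: "pdJ J (r *\<^sub>R p) = r *\<^sub>R pdJ J p"
  by (rule pdJ_commute_map[symmetric]) (simp add: pd_scaleR)

lemma pdJ_uminus: "pdJ J (- p) = - pdJ J p"
  using pdJ_scaleR[of J "-1" p] by simp

lemma pdJ_add: "pdJ J (p + q) = pdJ J p + pdJ J q"
proof -
  have pow: "(pd mu ^^ n) (p + q) = (pd mu ^^ n) p + (pd mu ^^ n) q" for mu n and p q :: "('a, 'b) salg"
    by (induction n) (auto simp: pd_add)
  have "fold (\<lambda>mu q. (pd mu ^^ J mu) q) xs (p + q) = fold (\<lambda>mu q. (pd mu ^^ J mu) q) xs p + fold (\<lambda>mu q. (pd mu ^^ J mu) q) xs q" for xs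
    by (induction xs arbitrary: p q) (auto simp: pow)
  then show ?thesis by (simp add: pdJ_def)
qed

lemma pdJ_0 [simp]: "pdJ J 0 = 0"
  using pdJ_scaleR[of J 0 0] by simp

lemma pdJ_diff: "pdJ J (p - q) = pdJ J p - pdJ J q"
  using pdJ_add[of J p "- q"] by (simp add: pdJ_uminus)

lemma pdJ_sum: "pdJ J (sum g A) = (\<Sum>x\<in>A. pdJ J (g x))"
  by (induction A rule: infinite_finite_induct) (auto simp: pdJ_add)

lemma pdJ_jet: "pdJ J (sgen (Jet f J')) = sgen (Jet f (\<lambda>mu. J mu + J' mu))"
proof -
  have pow: "(pd mu ^^ n) (sgen (Jet f J')) = sgen (Jet f (J'(mu := n + J' mu)))" for mu n J'
  proof (induction n)
    case (Suc n)
    have "J'(mu := n + J' mu, mu := Suc ((J'(mu := n + J' mu)) mu)) = J'(mu := Suc n + J' mu)" by simp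
    then show ?case by (simp only: funpow.simps comp_apply Suc pd_jet)
  qed simp
  have "distinct xs \<Longrightarrow> fold (\<lambda>mu q. (pd mu ^^ J mu) q) xs (sgen (Jet f J'))
      = sgen (Jet f (\<lambda>mu. (if mu \<in> set xs then J mu else 0) + J' mu))" for xs
  proof (induction xs arbitrary: J')
    case (Cons x xs)
    then have "fold (\<lambda>mu q. (pd mu ^^ J mu) q) (x # xs) (sgen (Jet f J'))
      = sgen (Jet f (\<lambda>mu. (if mu \<in> set xs then J mu else 0) + (J'(x := J x + J' x)) mu))"
      by (simp add: pow)
    also have "(\<lambda>mu. (if mu \<in> set xs then J mu else 0) + (J'(x := J x + J' x)) mu)
      = (\<lambda>mu. (if mu \<in> set (x # xs) then J mu else 0) + J' mu)"
      using Cons.prems by auto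
    finally show ?case .
  qed simp
  from this[of "sorted_list_of_set UNIV"] show ?thesis by (simp add: pdJ_def)
qed

text \<open>\<open>pdJ\<close> applies its derivatives in a fixed order of the indices; since total
  derivatives commute, an additional one can slide to its place. This is why \<open>D\<close>
  commutes with \<open>pd\<close>.\<close>

lemma pdJ_Suc: "pdJ (J(mu := Suc (J mu))) p = pd mu (pdJ J p)"
proof -
  let ?F = "\<lambda>J xs p. fold (\<lambda>mu q. (pd mu ^^ J mu) q) xs p"
  have pow: "pd mu ((pd nu ^^ n) p) = (pd nu ^^ n) (pd mu p)" for nu n p
    by (induction n) (simp_all add: pd_commute[of mu nu])
  have com: "pd mu (?F J xs p) = ?F J xs (pd mu p)" for xs p
    by (induction xs arbitrary: p) (auto simp: pow)
  have "distinct xs \<Longrightarrow> ?F (J(mu := Suc (J mu))) xs p = (if mu \<in> set xs then pd mu (?F J xs p) else ?F J xs p)" for xs p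
    by (induction xs arbitrary: p) (auto simp: com pow)
  from this[of "sorted_list_of_set UNIV"] show ?thesis by (simp add: pdJ_def)
qed

section \<open>Gradings by antighost number\<close>

text \<open>Among the generators only the odd ghosts and the differentials violate \<open>gen_odd x = odd (gen_agh x)\<close>, so on
  the remaining ones antighost number determines parity.\<close>
definition hom :: "nat \<Rightarrow> ('n::{finite,linorder}, 'g::finite) salg \<Rightarrow> bool" where
  "hom n p = (\<forall>m\<in>mons p. (\<Sum>x\<in>#gm m. gen_agh x) = n \<and> (\<forall>x\<in>#gm m. gen_odd x = odd (gen_agh x)))"

lemma hom_0 [simp]: "hom n 0" by (simp add: hom_def)

lemma hom_add: "hom n p \<Longrightarrow> hom n q \<Longrightarrow> hom n (p + q)"
  unfolding hom_def using mons_add[of p q] by blast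

lemma hom_uminus [simp]: "hom n (- p) = hom n p" by (simp add: hom_def)

lemma hom_diff: "hom n p \<Longrightarrow> hom n q \<Longrightarrow> hom n (p - q)"
  unfolding hom_def using mons_diff[of p q] by blast

lemma hom_scaleR: "hom n p \<Longrightarrow> hom n (r *\<^sub>R p)"
  unfolding hom_def using mons_scaleR[of r p] by blast

lemma hom_sum: "(\<And>x. x \<in> A \<Longrightarrow> hom n (f x)) \<Longrightarrow> hom n (sum f A)"
  unfolding hom_def using mons_sum[of f A] by blast

lemma hom_mult:
  assumes "hom n p" "hom l q"
  shows "hom (n + l) (p * q)"
  unfolding hom_def
proof (intro ballI)
  fix m assume "m \<in> mons (p * q)"
  from mons_mult[OF this] obtain m1 m2 where "m1 \<in> mons p" "m2 \<in> mons q" "gm m = gm m1 + gm m2"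
    by blast
  with assms show "(\<Sum>x\<in>#gm m. gen_agh x) = n + l \<and> (\<forall>x\<in>#gm m. gen_odd x = odd (gen_agh x))"
    by (auto simp: hom_def)
qed

lemma hom_mult_0: "hom 0 p \<Longrightarrow> hom n q \<Longrightarrow> hom n (p * q)" "hom n p \<Longrightarrow> hom 0 q \<Longrightarrow> hom n (p * q)"
  using hom_mult[of 0 p n q] hom_mult[of n p 0 q] by auto

lemma hom_sgen: "gen_agh x = n \<Longrightarrow> gen_odd x = odd n \<Longrightarrow> hom n (sgen x)"
  unfolding hom_def using mons_sgen[of _ x] by auto

lemma hom_pd:
  assumes "hom n p"
  shows "hom n (pd mu p)"
  unfolding hom_def
proof (intro ballI)
  fix m assume "m \<in> mons (pd mu p)"
  from mons_sder[OF graded_pdg this[unfolded pd_def]] obtain m0 x m1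
    where m: "m0 \<in> mons p" "x \<in># gm m0" "m1 \<in> mons (pdg mu x)" "gm m = gm m0 - {#x#} + gm m1" by blast
  then obtain f J where x: "x = Jet f J" by (cases x) auto
  from m(3) have g: "gm m1 = {#Jet f (J(mu := Suc (J mu)))#}" unfolding x by (auto dest: mons_sgen)
  from m(2) obtain M where M: "gm m0 = add_mset x M" by (meson mset_add)
  have "(\<Sum>x\<in>#gm m0. gen_agh x) = n" "\<forall>x\<in>#gm m0. gen_odd x = odd (gen_agh x)"
    using assms m(1) by (auto simp: hom_def)
  then show "(\<Sum>x\<in>#gm m. gen_agh x) = n \<and> (\<forall>x\<in>#gm m. gen_odd x = odd (gen_agh x))"
    unfolding m(4) g M x by auto
qed

lemma hom_pdJ: "hom n p \<Longrightarrow> hom n (pdJ J p)"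
  by (rule pdJ_induct) (auto intro: hom_pd)

lemma hom_par: "hom n p \<Longrightarrow> par (odd n) p"
proof -
  have "odd (size (filter_mset gen_odd M)) = odd (\<Sum>x\<in>#M. gen_agh x)"
    if "\<forall>x\<in>#M. gen_odd x = odd (gen_agh x)" for M :: "('a, 'b) gen multiset"
    using that by (induction M) auto
  then show "hom n p \<Longrightarrow> ?thesis" by (auto simp: hom_def par_def)
qed

lemma hom_0_central: "hom 0 p \<Longrightarrow> p * q = q * p"
  using hom_par[of 0 p] par_False_central by auto

lemmas hom_intros = hom_0 hom_add hom_diff hom_uminus[THEN iffD2] hom_scaleR hom_sum hom_mult_0 hom_pd hom_pdJ

lemma sum_antisym_zero:
  fixes f :: "'i::finite \<Rightarrow> 'i \<Rightarrow> 'v::real_vector"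
  assumes "\<And>x y. f x y = - f y x"
  shows "(\<Sum>x\<in>UNIV. \<Sum>y\<in>UNIV. f x y) = 0"
proof -
  have "(\<Sum>x\<in>UNIV. \<Sum>y\<in>UNIV. f x y) = (\<Sum>x\<in>UNIV. \<Sum>y\<in>UNIV. - f y x)"
    by (intro sum.cong refl) (rule assms)
  also have "\<dots> = - (\<Sum>x\<in>UNIV. \<Sum>y\<in>UNIV. f x y)"
    by (subst sum.swap) (simp add: sum_negf)
  finally have "2 *\<^sub>R (\<Sum>x\<in>UNIV. \<Sum>y\<in>UNIV. f x y) = 0" 
    by (simp only: scaleR_2 eq_neg_iff_add_eq_0)
  then show ?thesis by simp
qed

section \<open>The Chapline--Manton model\<close>

locale cm =
  fixes t0 :: "'n::{finite,linorder}" and lam :: real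
    and k :: "'g::finite \<Rightarrow> 'g \<Rightarrow> real" and C :: "'g \<Rightarrow> 'g \<Rightarrow> 'g \<Rightarrow> real"
  assumes simple: "simple_lie_algebra C" and inv: "invariant_metric C k"
begin

section \<open>Fields and Koszul-Tate differential in the ring type, identified with the originals
  by the \<open>Rep_\<close> lemmas\<close>

definition sv :: "('n, 'g) fld \<Rightarrow> ('n, 'g) salg" where "sv f = sgen (Jet f undiff)"
definition A :: "'g \<Rightarrow> 'n \<Rightarrow> ('n, 'g) salg" where "A a mu = sv (FA a mu)"
definition B :: "'n \<Rightarrow> 'n \<Rightarrow> ('n, 'g) salg" where
  "B mu nu = (if mu < nu then sv (FB mu nu) else if nu < mu then - sv (FB nu mu) else 0)"
definition Bs :: "'n \<Rightarrow> 'n \<Rightarrow> ('n, 'g) salg" where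
  "Bs mu nu = (if mu < nu then sv (FBs mu nu) else if nu < mu then - sv (FBs nu mu) else 0)"
definition F :: "'g \<Rightarrow> 'n \<Rightarrow> 'n \<Rightarrow> ('n, 'g) salg" where
  "F a mu nu = pd mu (A a nu) - pd nu (A a mu) - (\<Sum>b\<in>UNIV. \<Sum>c\<in>UNIV. C a b c *\<^sub>R (A b mu * A c nu))"
definition Fl :: "'g \<Rightarrow> 'n \<Rightarrow> 'n \<Rightarrow> ('n, 'g) salg" where
  "Fl a mu nu = (\<Sum>b\<in>UNIV. k a b *\<^sub>R F b mu nu)"
text \<open>The Chern-Simons part of the field strength, kept apart because it ranks below the
  derivatives of \<open>B\<close>.\<close>

definition Hnl :: "'n \<Rightarrow> 'n \<Rightarrow> 'n \<Rightarrow> ('n, 'g) salg" where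
  "Hnl mu nu rho = (2 * lam) *\<^sub>R (\<Sum>a\<in>UNIV. \<Sum>b\<in>UNIV. \<Sum>c\<in>UNIV. Clow k C a b c *\<^sub>R (A a mu * A b nu * A c rho))
     + (2 * lam) *\<^sub>R (\<Sum>a\<in>UNIV. A a mu * Fl a nu rho + A a nu * Fl a rho mu + A a rho * Fl a mu nu)"
definition H :: "'n \<Rightarrow> 'n \<Rightarrow> 'n \<Rightarrow> ('n, 'g) salg" where
  "H mu nu rho = pd mu (B nu rho) + pd nu (B rho mu) + pd rho (B mu nu) - Hnl mu nu rho"
definition Hu :: "'n \<Rightarrow> 'n \<Rightarrow> 'n \<Rightarrow> ('n, 'g) salg" where
  "Hu mu nu rho = (msig t0 mu * msig t0 nu * msig t0 rho) *\<^sub>R H mu nu rho"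
definition Fu :: "'g \<Rightarrow> 'n \<Rightarrow> 'n \<Rightarrow> ('n, 'g) salg" where
  "Fu a mu nu = (msig t0 mu * msig t0 nu) *\<^sub>R F a mu nu"
definition Flu :: "'g \<Rightarrow> 'n \<Rightarrow> 'n \<Rightarrow> ('n, 'g) salg" where
  "Flu a mu nu = (msig t0 mu * msig t0 nu) *\<^sub>R Fl a mu nu"

fun d0 :: "('n, 'g) fld \<Rightarrow> ('n, 'g) salg" where
  "d0 (FBs mu nu) = (\<Sum>rho\<in>UNIV. pd rho (Hu rho mu nu))"
| "d0 (Fetas mu) = - (\<Sum>nu\<in>UNIV. pd nu (Bs nu mu))"
| "d0 Frhos = - (\<Sum>mu\<in>UNIV. pd mu (sv (Fetas mu)))"
| "d0 (FAs a mu) =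
     (\<Sum>nu\<in>UNIV. pd nu (Flu a nu mu)
        - (\<Sum>b\<in>UNIV. \<Sum>c\<in>UNIV. Clow k C a b c *\<^sub>R (A b nu * Fu c nu mu)))
     + (2 * lam) *\<^sub>R (\<Sum>nu\<in>UNIV. \<Sum>rho\<in>UNIV. Hu mu nu rho * Fl a nu rho)"
| "d0 (FCs a) =
     (2 * lam) *\<^sub>R (\<Sum>mu\<in>UNIV. \<Sum>nu\<in>UNIV. Bs mu nu * Fl a mu nu)
     - (\<Sum>mu\<in>UNIV. pd mu (sv (FAs a mu))
        - (\<Sum>b\<in>UNIV. \<Sum>c\<in>UNIV. Clow k C a b c *\<^sub>R
             (A b mu * (\<Sum>e\<in>UNIV. kinv k c e *\<^sub>R sv (FAs e mu)))))"
| "d0 _ = 0"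

fun dg :: "('n, 'g) gen \<Rightarrow> ('n, 'g) salg" where
  "dg (Jet f J) = pdJ J (d0 f)" | "dg (Dx nu) = 0"

definition D :: "('n, 'g) salg \<Rightarrow> ('n, 'g) salg" where "D = sder 1 dg"

lemmas rep_eqs = plus_salg.rep_eq minus_salg.rep_eq uminus_salg.rep_eq times_salg.rep_eq scaleR_salg.rep_eq
  zero_salg.rep_eq one_salg.rep_eq Rep_salg_sum Rep_pd Rep_pdJ

lemma Rep_sv: "gen_ok (Jet f undiff) \<Longrightarrow> Rep_salg (sv f) = fv f"
  by (simp add: sv_def sgen.rep_eq fv_def)

lemma Rep_A: "Rep_salg (A a mu) = Afd a mu"
  by (simp add: A_def Afd_def Rep_sv)

lemma Rep_B: "Rep_salg (B mu nu) = Bfd mu nu"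
  by (simp add: B_def Bfd_def Rep_sv rep_eqs)

lemma Rep_Bs: "Rep_salg (Bs mu nu) = Bsfd mu nu"
  by (simp add: Bs_def Bsfd_def Rep_sv rep_eqs)

lemma Rep_F: "Rep_salg (F a mu nu) = Ffd C a mu nu"
  by (simp add: F_def Ffd_def Rep_A rep_eqs)

lemma Rep_Fl: "Rep_salg (Fl a mu nu) = Flow k C a mu nu"
  by (simp add: Fl_def Flow_def Rep_F rep_eqs)

lemma Rep_H: "Rep_salg (H mu nu rho) = Hfd lam k C mu nu rho"
  by (simp add: H_def Hnl_def Hfd_def Rep_A Rep_B Rep_Fl rep_eqs)

lemma Rep_Hu: "Rep_salg (Hu mu nu rho) = Hup t0 lam k C mu nu rho"
  by (simp add: Hu_def Hup_def Rep_H rep_eqs)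

lemma Rep_Fu: "Rep_salg (Fu a mu nu) = Fup t0 C a mu nu"
  by (simp add: Fu_def Fup_def Rep_F rep_eqs)

lemma Rep_Flu: "Rep_salg (Flu a mu nu) = Flowup t0 k C a mu nu"
  by (simp add: Flu_def Flowup_def Rep_Fl rep_eqs)

lemma Rep_d0: "Rep_salg (d0 f) = delta0 t0 lam k C f"
  by (cases f) (simp_all add: rep_eqs Rep_Hu Rep_Bs Rep_sv Rep_Flu Rep_Fu Rep_Fl Rep_A)

lemma Rep_dg: "Rep_salg (dg x) = delta_gen t0 lam k C x"
  by (cases x) (simp_all add: rep_eqs Rep_d0)

lemma Rep_D: "Rep_salg (D p) = KT t0 lam k C (Rep_salg p)"
proof -
  have "Rep_salg \<circ> dg = delta_gen t0 lam k C" by (auto simp: Rep_dg)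
  then show ?thesis by (simp add: D_def KT_def sder.rep_eq)
qed

lemma hom_A: "hom 0 (A a mu)" and hom_B: "hom 0 (B mu nu)" and hom_Bs: "hom 1 (Bs mu nu)"
  and hom_sv: "fld_odd f = odd (fld_agh f) \<Longrightarrow> hom (fld_agh f) (sv f)"
  by (auto simp: A_def B_def Bs_def sv_def intro!: hom_sgen)

lemma hom_F: "hom 0 (F a mu nu)"
  unfolding F_def by (intro hom_intros hom_A)

lemma hom_Fl: "hom 0 (Fl a mu nu)"
  unfolding Fl_def by (intro hom_intros hom_F)

lemma hom_H: "hom 0 (H mu nu rho)"
  unfolding H_def Hnl_def by (intro hom_intros hom_A hom_B hom_Fl)

lemma hom_Hu: "hom 0 (Hu mu nu rho)"
  unfolding Hu_def by (intro hom_intros hom_H)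

lemma hom_Fu: "hom 0 (Fu a mu nu)" and hom_Flu: "hom 0 (Flu a mu nu)"
  unfolding Fu_def Flu_def by (intro hom_intros hom_F hom_Fl)+

lemma hom_d0: "hom (fld_agh f - 1) (d0 f)"
proof (cases f)
  case (FAs a mu)
  show ?thesis unfolding FAs by (simp, intro hom_intros hom_A hom_Fu hom_Flu hom_Hu hom_Fl)
next
  case (FCs a)
  have *: "hom 1 (sv (FAs b mu))" for b mu using hom_sv[of "FAs b mu"] by simp
  have "hom 1 (d0 f)" unfolding FCs
    by (simp only: d0.simps, intro hom_intros(1-6) hom_mult_0(2)[OF hom_Bs hom_Fl] hom_mult_0(1)[OF hom_A] hom_pd *)
  then show ?thesis by (simp add: FCs)
next
  case (FBs mu nu)
  show ?thesis unfolding FBs by (simp, intro hom_intros hom_Hu)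
next
  case (Fetas mu)
  show ?thesis unfolding Fetas by (simp, intro hom_intros hom_Bs[simplified])
next
  case Frhos
  have "hom 2 (sv (Fetas mu))" for mu using hom_sv[of "Fetas mu"] by simp
  then show ?thesis unfolding Frhos by (simp, intro hom_intros) auto
qed auto

lemma hom_dg: "hom (gen_agh x - 1) (dg x)"
  by (cases x) (auto intro: hom_pdJ hom_d0[unfolded One_nat_def])

lemma dg_agh_0: "gen_agh x = 0 \<Longrightarrow> dg x = 0"
proof (cases x)
  case (Jet f J)
  then show "gen_agh x = 0 \<Longrightarrow> dg x = 0" by (cases f) auto
qed simp

lemma graded_dg: "graded_on_gens 1 dg"
proof -
  have "par (gen_odd x \<noteq> odd 1) (dg x)" for x
  proof (cases "gen_agh x = 0")
    case False
    then have "gen_odd x = odd (gen_agh x)"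
    proof (cases x)
      case (Jet f J)
      then show ?thesis using False by (cases f) auto
    qed simp
    then show ?thesis using hom_par[OF hom_dg[of x]] False by (cases "gen_agh x") auto
  qed (simp add: dg_agh_0)
  then show ?thesis by (simp add: graded_on_gens_def)
qed

lemma D_add: "D (p + q) = D p + D q"
  and D_diff: "D (p - q) = D p - D q"
  and D_uminus: "D (- p) = - D p"
  and D_scaleR: "D (r *\<^sub>R p) = r *\<^sub>R D p"
  and D_0 [simp]: "D 0 = 0"
  and D_sum: "D (sum g X) = (\<Sum>x\<in>X. D (g x))"
  by (simp_all add: D_def sder_add sder_diff sder_uminus sder_scaleR sder_sum)

lemma D_hom_0: "hom 0 p \<Longrightarrow> D p = 0"
proof -
  assume p: "hom 0 p"
  have False if "m \<in> mons (D p)" for m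
  proof -
    from mons_sder[OF graded_dg that[unfolded D_def]] obtain m0 x m1
      where m: "m0 \<in> mons p" "x \<in># gm m0" "m1 \<in> mons (dg x)" by blast
    have "(\<Sum>x\<in>#gm m0. gen_agh x) = 0" using p m(1) by (simp add: hom_def)
    then have "gen_agh x = 0" using m(2) by auto
    then show False using m(3) dg_agh_0 by simp
  qed
  then show "D p = 0" using mons_empty_iff by blast
qed

lemma D_mult_left: "hom 0 p \<Longrightarrow> D (p * q) = p * D q"
  using sder_mult[OF graded_dg, of False p q] hom_par[of 0 p] D_hom_0[of p] by (simp add: D_def)

lemma D_mult_right: "hom n p \<Longrightarrow> hom 0 q \<Longrightarrow> D (p * q) = D p * q"
  using sder_mult[OF graded_dg, of "odd n" p q] hom_par[of n p] D_hom_0[of q] by (simp add: D_def)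

lemma D_pd: "D (pd mu p) = pd mu (D p)"
  unfolding D_def pd_def
proof (rule sder_commute_even[OF graded_dg graded_pdg])
  show "sder 1 dg (pdg mu x) = sder 0 (pdg mu) (dg x)" if "gen_ok x" for x
  proof (cases x)
    case (Jet f J)
    then have "gen_ok (Jet f (J(mu := Suc (J mu))))" using that gen_ok_Jet by blast
    then show ?thesis using pdJ_Suc[of J mu "d0 f"]
      by (simp add: Jet sder_sgen[OF graded_dg] pd_def del: One_nat_def)
  qed simp
qed

lemma D_pdJ: "D (pdJ J p) = pdJ J (D p)"
  by (rule pdJ_commute_map) (rule D_pd)

lemma D_sv: "gen_ok (Jet f undiff) \<Longrightarrow> D (sv f) = d0 f"
proof -
  assume "gen_ok (Jet f undiff)"
  moreover have "pdJ undiff p = p" for p :: "('n, 'g) salg"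
  proof -
    have "fold (\<lambda>mu q. (pd mu ^^ 0) q) xs p = p" for xs :: "'n list"
      by (induction xs) auto
    then show ?thesis by (simp add: pdJ_def undiff_def)
  qed
  ultimately show ?thesis by (simp add: D_def sv_def sder_sgen[OF graded_dg] del: One_nat_def)
qed


subsection \<open>Lie algebra identities\<close>

lemma C_antisym: "C a b c = - C a c b"
  using simple unfolding simple_lie_algebra_def by blast

definition unit :: "'g \<Rightarrow> 'g \<Rightarrow> real" where "unit b = (\<lambda>c. if c = b then 1 else 0)"

lemma lbr_unit_right: "lbr C x (unit d) a = (\<Sum>e\<in>UNIV. C a e d * x e)"
  by (simp add: lbr_def unit_def if_distrib cong: if_cong)

lemma lbr_unit: "lbr C (unit b) (unit c) a = C a b c"
  by (simp add: lbr_unit_right) (simp add: unit_def if_distrib cong: if_cong)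

lemma C_jacobi: "(\<Sum>e\<in>UNIV. C a e d * C e b c) + (\<Sum>e\<in>UNIV. C a e b * C e c d) + (\<Sum>e\<in>UNIV. C a e c * C e d b) = 0"
proof -
  have "\<forall>x y z. (\<lambda>a. lbr C (lbr C x y) z a + lbr C (lbr C y z) x a + lbr C (lbr C z x) y a) = (\<lambda>_. 0)"
    using simple unfolding simple_lie_algebra_def by blast
  from fun_cong[OF this[rule_format, of "unit b" "unit c" "unit d"], of a] show ?thesis
    unfolding lbr_unit_right[of "lbr C (unit _) (unit _)"] lbr_unit .
qed

lemma kform_unit: "kform k x (unit c) = (\<Sum>a\<in>UNIV. k a c * x a)" "kform k (unit c) x = (\<Sum>b\<in>UNIV. k c b * x b)"
proof -
  show "kform k x (unit c) = (\<Sum>a\<in>UNIV. k a c * x a)"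
    by (simp add: kform_def unit_def if_distrib cong: if_cong)
  have "kform k (unit c) x = (\<Sum>a\<in>UNIV. if a = c then (\<Sum>b\<in>UNIV. k a b * x b) else 0)"
    unfolding kform_def unit_def by (intro sum.cong) auto
  then show "kform k (unit c) x = (\<Sum>b\<in>UNIV. k c b * x b)" by simp
qed

lemma k_sym: "k a b = k b a"
  using inv unfolding invariant_metric_def by blast

text \<open>Invariance of the metric, evaluated on basis vectors. Together with
  \<open>Clow_antisym\<close> it yields total antisymmetry.\<close>

lemma Clow_cyclic: "Clow k C c a b = Clow k C a b c"
proof -
  have "kform k (lbr C (unit a) (unit b)) (unit c) = kform k (unit a) (lbr C (unit b) (unit c))"
    using inv unfolding invariant_metric_def by blast
  then have "(\<Sum>d\<in>UNIV. k d c * C d a b) = (\<Sum>d\<in>UNIV. k a d * C d b c)"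
    unfolding kform_unit lbr_unit .
  then show ?thesis unfolding Clow_def by (simp add: k_sym)
qed

lemma Clow_antisym: "Clow k C a b c = - Clow k C a c b"
  unfolding Clow_def sum_negf[symmetric] using C_antisym by (intro sum.cong refl) (metis mult_minus_right)

text \<open>Nondegeneracy says that the matrix of \<open>k\<close> has trivial kernel, hence an
  inverse, and then the choice in \<open>matrix_inv\<close> picks one.\<close>

lemma kinv_k: "(\<Sum>e\<in>UNIV. kinv k c e * k e d) = (if c = d then 1 else 0)"
proof -
  let ?K = "(\<chi> i j. k i j) :: real ^ 'g ^ 'g"
  have "x = 0" if "?K *v x = 0" for x :: "real ^ 'g"
  proof -
    have "kform k (\<lambda>i. x $ i) y = 0" for y
    proof -
      have "kform k (\<lambda>i. x $ i) y = (\<Sum>b\<in>UNIV. \<Sum>a\<in>UNIV. k b a * (x $ a) * y b)"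
        unfolding kform_def by (subst sum.swap) (simp add: k_sym)
      also have "\<dots> = (\<Sum>b\<in>UNIV. ((?K *v x) $ b) * y b)"
        by (simp add: matrix_vector_mult_def sum_distrib_right)
      finally show ?thesis using that by simp
    qed
    then have "(\<lambda>i. x $ i) = (\<lambda>_. 0)" using inv unfolding invariant_metric_def by blast
    then show ?thesis by (simp add: vec_eq_iff fun_eq_iff)
  qed
  then have "invertible ?K"
    using matrix_left_invertible_ker invertible_left_inverse by blast
  then have "matrix_inv ?K ** ?K = mat 1" 
    unfolding matrix_inv_def invertible_def by (rule someI2_ex) blast
  then have "(matrix_inv ?K ** ?K) $ c $ d = mat 1 $ c $ d" by simp
  then show ?thesis by (simp add: matrix_matrix_mult_def mat_def kinv_def)
qed

lemma k_kinv: "(\<Sum>e\<in>UNIV. k c e * kinv k e d) = (if c = d then 1 else 0)"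
proof -
  let ?K = "(\<chi> i j. k i j) :: real ^ 'g ^ 'g"
  have "matrix_inv ?K ** ?K = mat 1"
    using kinv_k by (simp add: matrix_matrix_mult_def mat_def kinv_def vec_eq_iff)
  then have "?K ** matrix_inv ?K = mat 1" using matrix_left_right_inverse by blast
  then have "(?K ** matrix_inv ?K) $ c $ d = mat 1 $ c $ d" by simp
  then show ?thesis by (simp add: matrix_matrix_mult_def mat_def kinv_def)
qed

subsection \<open>Covariant derivatives\<close>

text \<open>The Lie bracket extended to ring coefficients. Its antisymmetry and Jacobi identity need
  coefficients that commute; \<open>hom0\<close> guarantees this, as antighost number 0 in the sense
  of \<open>hom\<close> forces even parity.\<close>

definition br :: "('g \<Rightarrow> ('n, 'g) salg) \<Rightarrow> ('g \<Rightarrow> ('n, 'g) salg) \<Rightarrow> 'g \<Rightarrow> ('n, 'g) salg" where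
  "br X Y a = (\<Sum>b\<in>UNIV. \<Sum>c\<in>UNIV. C a b c *\<^sub>R (X b * Y c))"

definition hom0 :: "('g \<Rightarrow> ('n, 'g) salg) \<Rightarrow> bool" where "hom0 X = (\<forall>a. hom 0 (X a))"

lemma br_anti:
  assumes "hom0 X"
  shows "br X Y a = - br Y X a"
proof -
  have "br X Y a = (\<Sum>b\<in>UNIV. \<Sum>c\<in>UNIV. - (C a c b *\<^sub>R (Y c * X b)))"
    unfolding br_def
  proof (intro sum.cong refl)
    fix b c
    have "X b * Y c = Y c * X b" using assms hom_0_central unfolding hom0_def by blast
    then show "C a b c *\<^sub>R (X b * Y c) = - (C a c b *\<^sub>R (Y c * X b))"
      using C_antisym[of a b c] by simp
  qed
  then show ?thesis unfolding br_def by (subst sum.swap) (simp add: sum_negf)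
qed

lemma br_self: "hom0 X \<Longrightarrow> br X X a = 0"
proof -
  assume "hom0 X"
  then have "br X X a = - br X X a" by (rule br_anti)
  then have "2 *\<^sub>R br X X a = 0" by (simp only: scaleR_2 eq_neg_iff_add_eq_0)
  then show ?thesis by simp
qed

lemma br_add_right: "br Z (\<lambda>a. X a + Y a) a = br Z X a + br Z Y a"
  and br_diff_left: "br (\<lambda>a. X a - Y a) Z a = br X Z a - br Y Z a"
  and br_diff_right: "br Z (\<lambda>a. X a - Y a) a = br Z X a - br Z Y a"
  and br_uminus_left: "br (\<lambda>a. - X a) Z a = - br X Z a"
  and br_uminus_right: "br Z (\<lambda>a. - X a) a = - br Z X a"
  and br_scaleR_right: "br Z (\<lambda>a. r *\<^sub>R X a) a = r *\<^sub>R br Z X a"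
  by (simp_all add: br_def distrib_left distrib_right left_diff_distrib right_diff_distrib
      scaleR_add_right scaleR_diff_right sum.distrib sum_subtractf sum_negf scaleR_sum_right mult.commute)

lemma br_sum_right: "br Z (\<lambda>a. \<Sum>i\<in>I. X i a) a = (\<Sum>i\<in>I. br Z (X i) a)"
proof (induction I rule: infinite_finite_induct)
  case (insert i I)
  then show ?case by (simp add: br_add_right)
qed (simp_all add: br_def)

lemma br_br: "br (br X Y) Z a = (\<Sum>b\<in>UNIV. \<Sum>c\<in>UNIV. \<Sum>d\<in>UNIV. (\<Sum>e\<in>UNIV. C a e d * C e b c) *\<^sub>R (X b * Y c * Z d))"
proof -
  have "br (br X Y) Z a = (\<Sum>e\<in>UNIV. \<Sum>d\<in>UNIV. \<Sum>b\<in>UNIV. \<Sum>c\<in>UNIV. (C a e d * C e b c) *\<^sub>R (X b * Y c * Z d))"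
    by (simp add: br_def sum_distrib_right scaleR_sum_right)
  also have "\<dots> = (\<Sum>e\<in>UNIV. \<Sum>b\<in>UNIV. \<Sum>c\<in>UNIV. \<Sum>d\<in>UNIV. (C a e d * C e b c) *\<^sub>R (X b * Y c * Z d))"
    by (rule sum.cong[OF refl], rule trans[OF sum.swap], rule sum.cong[OF refl], rule sum.swap)
  also have "\<dots> = (\<Sum>b\<in>UNIV. \<Sum>c\<in>UNIV. \<Sum>d\<in>UNIV. \<Sum>e\<in>UNIV. (C a e d * C e b c) *\<^sub>R (X b * Y c * Z d))"
    by (rule trans[OF sum.swap], rule sum.cong[OF refl], rule trans[OF sum.swap], rule sum.cong[OF refl], rule sum.swap)
  finally show ?thesis by (simp add: scaleR_sum_left)
qed

lemma br_jacobi: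
  assumes "hom0 X" "hom0 Y" "hom0 Z"
  shows "br (br X Y) Z a + br (br Y Z) X a + br (br Z X) Y a = 0"
proof -
  let ?c = "\<lambda>b c d. (\<Sum>e\<in>UNIV. C a e d * C e b c)"
  have com: "Y c * Z d * X b = X b * Y c * Z d" "Z d * X b * Y c = X b * Y c * Z d" for b c d
    using assms hom_0_central unfolding hom0_def by (metis mult.assoc)+
  have 2: "br (br Y Z) X a = (\<Sum>b\<in>UNIV. \<Sum>c\<in>UNIV. \<Sum>d\<in>UNIV. ?c c d b *\<^sub>R (X b * Y c * Z d))"
  proof -
    have "br (br Y Z) X a = (\<Sum>c\<in>UNIV. \<Sum>d\<in>UNIV. \<Sum>b\<in>UNIV. ?c c d b *\<^sub>R (X b * Y c * Z d))"
      unfolding br_br com ..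
    also have "\<dots> = (\<Sum>c\<in>UNIV. \<Sum>b\<in>UNIV. \<Sum>d\<in>UNIV. ?c c d b *\<^sub>R (X b * Y c * Z d))"
      by (rule sum.cong[OF refl], rule sum.swap)
    also have "\<dots> = (\<Sum>b\<in>UNIV. \<Sum>c\<in>UNIV. \<Sum>d\<in>UNIV. ?c c d b *\<^sub>R (X b * Y c * Z d))"
      by (rule sum.swap)
    finally show ?thesis .
  qed
  have 3: "br (br Z X) Y a = (\<Sum>b\<in>UNIV. \<Sum>c\<in>UNIV. \<Sum>d\<in>UNIV. ?c d b c *\<^sub>R (X b * Y c * Z d))"
  proof -
    have "br (br Z X) Y a = (\<Sum>d\<in>UNIV. \<Sum>b\<in>UNIV. \<Sum>c\<in>UNIV. ?c d b c *\<^sub>R (X b * Y c * Z d))"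
      unfolding br_br com ..
    also have "\<dots> = (\<Sum>b\<in>UNIV. \<Sum>d\<in>UNIV. \<Sum>c\<in>UNIV. ?c d b c *\<^sub>R (X b * Y c * Z d))"
      by (rule sum.swap)
    also have "\<dots> = (\<Sum>b\<in>UNIV. \<Sum>c\<in>UNIV. \<Sum>d\<in>UNIV. ?c d b c *\<^sub>R (X b * Y c * Z d))"
      by (rule sum.cong[OF refl], rule sum.swap)
    finally show ?thesis .
  qed
  have "br (br X Y) Z a + br (br Y Z) X a + br (br Z X) Y a
      = (\<Sum>b\<in>UNIV. \<Sum>c\<in>UNIV. \<Sum>d\<in>UNIV. (?c b c d + ?c c d b + ?c d b c) *\<^sub>R (X b * Y c * Z d))"
    unfolding 2 3 br_br[of X Y Z] by (simp only: scaleR_add_left sum.distrib)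
  also have "\<dots> = 0" unfolding C_jacobi by simp
  finally show ?thesis .
qed

lemma pd_br: "pd mu (br X Y a) = br (\<lambda>a. pd mu (X a)) Y a + br X (\<lambda>a. pd mu (Y a)) a"
  by (simp add: br_def pd_sum pd_scaleR pd_mult scaleR_add_right sum.distrib)

lemma hom0_br: "hom0 X \<Longrightarrow> hom0 Y \<Longrightarrow> hom0 (br X Y)"
  unfolding hom0_def br_def by (auto intro!: hom_intros)

abbreviation AA :: "'n \<Rightarrow> 'g \<Rightarrow> ('n, 'g) salg" where "AA mu \<equiv> \<lambda>a. A a mu"
abbreviation FF :: "'n \<Rightarrow> 'n \<Rightarrow> 'g \<Rightarrow> ('n, 'g) salg" where "FF mu nu \<equiv> \<lambda>a. F a mu nu"

definition cD :: "'n \<Rightarrow> ('g \<Rightarrow> ('n, 'g) salg) \<Rightarrow> 'g \<Rightarrow> ('n, 'g) salg" where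
  "cD mu X a = pd mu (X a) - br (AA mu) X a"

lemma hom0_AA: "hom0 (AA mu)" and hom0_FF: "hom0 (FF mu nu)"
  by (auto simp: hom0_def hom_A hom_F)

lemma FF_eq: "F a mu nu = pd mu (A a nu) - pd nu (A a mu) - br (AA mu) (AA nu) a"
  by (simp add: F_def br_def)

lemma F_antisym: "F a mu nu = - F a nu mu"
  using br_anti[OF hom0_AA, of mu "AA nu" a] by (simp add: FF_eq)

lemma cD_add: "cD mu (\<lambda>a. X a + Y a) a = cD mu X a + cD mu Y a"
  by (simp add: cD_def br_add_right pd_add)

lemma cD_scaleR: "cD mu (\<lambda>a. r *\<^sub>R X a) a = r *\<^sub>R cD mu X a"
  by (simp add: cD_def br_scaleR_right pd_scaleR scaleR_diff_right)

lemma cD_uminus: "cD mu (\<lambda>a. - X a) a = - cD mu X a"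
  by (simp add: cD_def br_uminus_right pd_uminus)

lemma cD_sum: "cD mu (\<lambda>a. \<Sum>i\<in>I. X i a) a = (\<Sum>i\<in>I. cD mu (X i) a)"
  by (simp add: cD_def br_sum_right pd_sum sum_subtractf)

lemma cD_mult:
  assumes "hom 0 h"
  shows "cD mu (\<lambda>a. h * X a) a = pd mu h * X a + h * cD mu X a"
proof -
  have "A b mu * (h * X c) = h * (A b mu * X c)" for b c
    using hom_0_central[OF assms] by (metis mult.assoc)
  then have "br (AA mu) (\<lambda>a. h * X a) a = h * br (AA mu) X a"
    by (simp add: br_def sum_distrib_left)
  then show ?thesis by (simp add: cD_def pd_mult right_diff_distrib)
qed

lemma br_br_left:
  assumes X: "hom0 X"
  shows "br (br (AA mu) (AA nu)) X a = br (AA mu) (br (AA nu) X) a - br (AA nu) (br (AA mu) X) a"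
proof -
  have 1: "br (br (AA nu) X) (AA mu) a = - br (AA mu) (br (AA nu) X) a"
    by (intro br_anti hom0_br hom0_AA X)
  have "br X (AA mu) = (\<lambda>a. - br (AA mu) X a)" using br_anti[OF X] by auto
  then have 2: "br (br X (AA mu)) (AA nu) a = br (AA nu) (br (AA mu) X) a"
    using br_anti[OF hom0_br[OF hom0_AA[of mu] X], of "AA nu" a] by (simp add: br_uminus_left)
  show ?thesis using br_jacobi[OF hom0_AA[of mu] hom0_AA[of nu] X, of a] unfolding 1 2
    by (simp add: algebra_simps add_eq_0_iff)
qed

text \<open>The Ricci identity. Mixed first-derivative terms cancel in pairs, and the Jacobi
  identity turns the double brackets into the quadratic part of the curvature.\<close>

lemma cD_commutator:
  assumes X: "hom0 X"
  shows "cD mu (cD nu X) a - cD nu (cD mu X) a = - br (FF mu nu) X a"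
proof -
  have e: "cD mu (cD nu X) a = pd mu (pd nu (X a)) - br (\<lambda>a. pd mu (A a nu)) X a - br (AA nu) (\<lambda>a. pd mu (X a)) a
      - br (AA mu) (\<lambda>a. pd nu (X a)) a + br (AA mu) (br (AA nu) X) a" for mu nu
  proof -
    have "br (AA mu) (cD nu X) a = br (AA mu) (\<lambda>a. pd nu (X a)) a - br (AA mu) (br (AA nu) X) a"
      using br_diff_right[of "AA mu" "\<lambda>a. pd nu (X a)" "br (AA nu) X" a] by (simp add: cD_def[abs_def])
    then show ?thesis by (simp add: cD_def[of mu] cD_def[of nu X] pd_diff pd_br)
  qed
  have f: "br (FF mu nu) X a = br (\<lambda>a. pd mu (A a nu)) X a - br (\<lambda>a. pd nu (A a mu)) X a - br (br (AA mu) (AA nu)) X a"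
    unfolding FF_eq by (simp add: br_diff_left)
  show ?thesis unfolding e f br_br_left[OF X] pd_commute[of mu nu] by (simp add: algebra_simps)
qed

text \<open>In the cyclic sum second derivatives cancel because \<open>pd\<close> commutes, brackets
  with first derivatives cancel in pairs, and the cubic terms add up to a Jacobi identity.\<close>

lemma bianchi: "cD mu (FF nu rho) a + cD nu (FF rho mu) a + cD rho (FF mu nu) a = 0"
proof -
  have e: "cD mu (FF nu rho) a = pd mu (pd nu (A a rho)) - pd mu (pd rho (A a nu))
      + br (AA rho) (\<lambda>a. pd mu (A a nu)) a - br (AA nu) (\<lambda>a. pd mu (A a rho)) a
      - br (AA mu) (\<lambda>a. pd nu (A a rho)) a + br (AA mu) (\<lambda>a. pd rho (A a nu)) a
      + br (AA mu) (br (AA nu) (AA rho)) a" for mu nu rho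
    using br_anti[OF hom0_AA[of rho], of "\<lambda>a. pd mu (A a nu)" a]
    by (simp add: cD_def FF_eq br_diff_right pd_diff pd_br)
  have j: "br (AA mu) (br (AA nu) (AA rho)) a = - br (br (AA nu) (AA rho)) (AA mu) a" for mu nu rho
    by (rule br_anti[OF hom0_AA])
  \<comment> \<open>Jacobi solved for one double bracket, so that rewriting can eliminate
    it.\<close>
  have J: "br (br (AA nu) (AA rho)) (AA mu) a = - br (br (AA rho) (AA mu)) (AA nu) a - br (br (AA mu) (AA nu)) (AA rho) a"
  proof -
    have "x = - y - z" if "x + y + z = 0" for x y z :: "('n, 'g) salg"
    proof -
      have "x = - (y + z)" using that by (simp only: eq_neg_iff_add_eq_0 add.assoc)
      then show ?thesis by simp
    qed
    then show ?thesis using br_jacobi[OF hom0_AA hom0_AA hom0_AA, of nu rho mu a] by blast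
  qed
  show ?thesis unfolding e j J pd_commute[of mu nu] pd_commute[of rho nu] pd_commute[of rho mu]
    by (simp add: algebra_simps)
qed

subsection \<open>Antisymmetry of the three-form field strength\<close>

lemma B_antisym: "B mu nu = - B nu mu" and Bs_antisym: "Bs mu nu = - Bs nu mu"
  by (auto simp: B_def Bs_def)

lemma Fl_antisym: "Fl a mu nu = - Fl a nu mu"
  unfolding Fl_def using F_antisym[of _ mu nu] by (simp add: sum_negf)

lemma CAAA_swap:
  "(\<Sum>a\<in>UNIV. \<Sum>b\<in>UNIV. \<Sum>c\<in>UNIV. Clow k C a b c *\<^sub>R (A a mu * A b nu * A c rho))
    = - (\<Sum>a\<in>UNIV. \<Sum>b\<in>UNIV. \<Sum>c\<in>UNIV. Clow k C a b c *\<^sub>R (A a mu * A b rho * A c nu))"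
proof -
  have "Clow k C a b c *\<^sub>R (A a mu * A b nu * A c rho) = - (Clow k C a c b *\<^sub>R (A a mu * A c rho * A b nu))" for a b c
    using Clow_antisym[of a b c] hom_0_central[OF hom_A, of b nu "A c rho"] by (simp add: mult.assoc)
  then have "(\<Sum>a\<in>UNIV. \<Sum>b\<in>UNIV. \<Sum>c\<in>UNIV. Clow k C a b c *\<^sub>R (A a mu * A b nu * A c rho))
    = (\<Sum>a\<in>UNIV. \<Sum>b\<in>UNIV. \<Sum>c\<in>UNIV. - (Clow k C a c b *\<^sub>R (A a mu * A c rho * A b nu)))" by simp
  also have "\<dots> = (\<Sum>a\<in>UNIV. \<Sum>b\<in>UNIV. \<Sum>c\<in>UNIV. - (Clow k C a b c *\<^sub>R (A a mu * A b rho * A c nu)))"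
    by (rule sum.cong[OF refl], rule sum.swap)
  finally show ?thesis by (simp add: sum_negf)
qed

lemma CAAA_cyclic:
  "(\<Sum>a\<in>UNIV. \<Sum>b\<in>UNIV. \<Sum>c\<in>UNIV. Clow k C a b c *\<^sub>R (A a mu * A b nu * A c rho))
    = (\<Sum>a\<in>UNIV. \<Sum>b\<in>UNIV. \<Sum>c\<in>UNIV. Clow k C a b c *\<^sub>R (A a rho * A b mu * A c nu))"
proof -
  have "Clow k C a b c *\<^sub>R (A a mu * A b nu * A c rho) = Clow k C c a b *\<^sub>R (A c rho * A a mu * A b nu)" for a b c
    using Clow_cyclic[of c a b] hom_0_central[OF hom_A, of c rho "A a mu * A b nu"] by (simp add: mult.assoc)
  then have "(\<Sum>a\<in>UNIV. \<Sum>b\<in>UNIV. \<Sum>c\<in>UNIV. Clow k C a b c *\<^sub>R (A a mu * A b nu * A c rho))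
    = (\<Sum>a\<in>UNIV. \<Sum>b\<in>UNIV. \<Sum>c\<in>UNIV. Clow k C c a b *\<^sub>R (A c rho * A a mu * A b nu))" by simp
  also have "\<dots> = (\<Sum>a\<in>UNIV. \<Sum>c\<in>UNIV. \<Sum>b\<in>UNIV. Clow k C c a b *\<^sub>R (A c rho * A a mu * A b nu))"
    by (rule sum.cong[OF refl], rule sum.swap)
  also have "\<dots> = (\<Sum>c\<in>UNIV. \<Sum>a\<in>UNIV. \<Sum>b\<in>UNIV. Clow k C c a b *\<^sub>R (A c rho * A a mu * A b nu))"
    by (rule sum.swap)
  finally show ?thesis .
qed

lemma Hnl_swap: "Hnl mu nu rho = - Hnl mu rho nu"
proof -
  have "A a mu * Fl a rho nu + A a rho * Fl a nu mu + A a nu * Fl a mu rho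
    = - (A a mu * Fl a nu rho + A a nu * Fl a rho mu + A a rho * Fl a mu nu)" for a
    using Fl_antisym[of a rho nu] Fl_antisym[of a nu mu] Fl_antisym[of a mu rho] by simp
  then have S: "(\<Sum>a\<in>UNIV. A a mu * Fl a rho nu + A a rho * Fl a nu mu + A a nu * Fl a mu rho)
    = - (\<Sum>a\<in>UNIV. A a mu * Fl a nu rho + A a nu * Fl a rho mu + A a rho * Fl a mu nu)"
    unfolding sum_negf[symmetric] by (intro sum.cong refl)
  show ?thesis unfolding Hnl_def S CAAA_swap[of mu nu rho] by simp
qed

lemma Hnl_cyclic: "Hnl mu nu rho = Hnl rho mu nu"
proof -
  have "A a mu * Fl a nu rho + A a nu * Fl a rho mu + A a rho * Fl a mu nu
    = A a rho * Fl a mu nu + A a mu * Fl a nu rho + A a nu * Fl a rho mu" for a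
    by (simp add: add_ac)
  then have S: "(\<Sum>a\<in>UNIV. A a mu * Fl a nu rho + A a nu * Fl a rho mu + A a rho * Fl a mu nu)
    = (\<Sum>a\<in>UNIV. A a rho * Fl a mu nu + A a mu * Fl a nu rho + A a nu * Fl a rho mu)"
    by (intro sum.cong refl)
  show ?thesis unfolding Hnl_def S CAAA_cyclic[of mu nu rho] ..
qed

lemma H_swap: "H mu nu rho = - H mu rho nu"
  using Hnl_swap[of mu nu rho] B_antisym[of nu rho] B_antisym[of rho mu] B_antisym[of mu nu]
  by (simp add: H_def pd_uminus)

lemma H_cyclic: "H mu nu rho = H rho mu nu"
  using Hnl_cyclic[of mu nu rho] by (simp add: H_def add_ac)

lemma H_swap12: "H mu nu rho = - H nu mu rho"
  using H_cyclic[of mu nu rho] H_swap[of rho mu nu] H_cyclic[of nu mu rho] by simp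

lemma H_diag: "H mu mu rho = 0"
proof -
  have "2 *\<^sub>R H mu mu rho = 0" unfolding scaleR_2 eq_neg_iff_add_eq_0[symmetric] by (rule H_swap12)
  then show ?thesis by simp
qed

lemma Hu_swap: "Hu mu nu rho = - Hu mu rho nu" and Hu_swap12: "Hu mu nu rho = - Hu nu mu rho"
  and Hu_cyclic: "Hu mu nu rho = Hu rho mu nu"
  using H_swap[of mu nu rho] H_swap12[of mu nu rho] H_cyclic[of mu nu rho] by (simp_all add: Hu_def mult_ac)


subsection \<open>Nilpotency\<close>

lemma Hu_diag: "Hu mu nu nu = 0"
proof -
  have "2 *\<^sub>R Hu mu nu nu = 0" unfolding scaleR_2 eq_neg_iff_add_eq_0[symmetric] by (rule Hu_swap)
  then show ?thesis by simp
qed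

lemma D_Bs: "D (Bs mu nu) = (\<Sum>rho\<in>UNIV. pd rho (Hu rho mu nu))"
proof (cases mu nu rule: linorder_cases)
  case less
  then show ?thesis by (simp add: Bs_def D_sv)
next
  case equal
  then show ?thesis by (simp add: Bs_def Hu_diag)
next
  case greater
  then have "D (Bs mu nu) = - (\<Sum>rho\<in>UNIV. pd rho (Hu rho nu mu))" by (simp add: Bs_def D_uminus D_sv)
  also have "\<dots> = (\<Sum>rho\<in>UNIV. pd rho (Hu rho mu nu))"
    unfolding sum_negf[symmetric] pd_uminus[symmetric] using Hu_swap by (intro sum.cong refl) metis
  finally show ?thesis .
qed

lemma D_d0_Fetas: "D (d0 (Fetas mu)) = 0"
proof -
  have "D (d0 (Fetas mu)) = - (\<Sum>nu\<in>UNIV. \<Sum>rho\<in>UNIV. pd nu (pd rho (Hu rho nu mu)))"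
    by (simp add: D_uminus D_sum D_pd D_Bs pd_sum)
  also have "(\<Sum>nu\<in>UNIV. \<Sum>rho\<in>UNIV. pd nu (pd rho (Hu rho nu mu))) = 0"
  proof (rule sum_antisym_zero)
    fix nu rho
    show "pd nu (pd rho (Hu rho nu mu)) = - pd rho (pd nu (Hu nu rho mu))"
      using Hu_swap12[of rho nu mu] by (simp add: pd_uminus pd_commute[of nu rho])
  qed
  finally show ?thesis by simp
qed

lemma D_d0_Frhos: "D (d0 Frhos) = 0"
proof -
  have "D (d0 Frhos) = (\<Sum>mu\<in>UNIV. \<Sum>nu\<in>UNIV. pd mu (pd nu (Bs nu mu)))"
    by (simp add: D_uminus D_sum D_pd D_sv pd_sum pd_uminus sum_negf)
  also have "\<dots> = 0"
  proof (rule sum_antisym_zero)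
    fix nu rho
    show "pd nu (pd rho (Bs rho nu)) = - pd rho (pd nu (Bs nu rho))"
      using Bs_antisym[of rho nu] by (simp add: pd_uminus pd_commute[of nu rho])
  qed
  finally show ?thesis .
qed

text \<open>Antisymmetry of \<open>F\<close> makes twice the double divergence a sum of commutators
  of covariant derivatives. By the Ricci identity each is a bracket of \<open>F\<close> with a
  multiple of itself, hence 0.\<close>

lemma cD_cD_F: "(\<Sum>mu\<in>UNIV. \<Sum>nu\<in>UNIV. cD mu (cD nu (\<lambda>a. Fu a nu mu)) a) = 0"
proof -
  let ?g = "\<lambda>mu nu. msig t0 nu * msig t0 mu"
  let ?S = "\<Sum>mu\<in>UNIV. \<Sum>nu\<in>UNIV. ?g mu nu *\<^sub>R cD mu (cD nu (FF nu mu)) a"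
  have Fu: "cD mu (cD nu (\<lambda>a. Fu a nu mu)) a = ?g mu nu *\<^sub>R cD mu (cD nu (FF nu mu)) a" for mu nu
  proof -
    have "cD nu (\<lambda>a. Fu a nu mu) = (\<lambda>a. ?g mu nu *\<^sub>R cD nu (FF nu mu) a)"
      unfolding Fu_def by (auto simp: cD_scaleR)
    then show ?thesis by (simp add: cD_scaleR)
  qed
  have anti: "cD mu (cD nu (FF mu nu)) a = - cD mu (cD nu (FF nu mu)) a" for mu nu
  proof -
    have 1: "FF mu nu = (\<lambda>a. - F a nu mu)" by (rule ext) (rule F_antisym)
    have 2: "cD nu (FF mu nu) = (\<lambda>a. - cD nu (FF nu mu) a)" unfolding 1 by (rule ext) (rule cD_uminus)
    show ?thesis unfolding 2 by (rule cD_uminus)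
  qed
  have "?S = (\<Sum>mu\<in>UNIV. \<Sum>nu\<in>UNIV. ?g mu nu *\<^sub>R cD nu (cD mu (FF mu nu)) a)"
    by (subst sum.swap) (simp add: mult.commute)
  also have "\<dots> = (\<Sum>mu\<in>UNIV. \<Sum>nu\<in>UNIV. - (?g mu nu *\<^sub>R cD nu (cD mu (FF nu mu)) a))"
    by (intro sum.cong refl) (subst anti, simp)
  finally have "2 *\<^sub>R ?S = ?S + (\<Sum>mu\<in>UNIV. \<Sum>nu\<in>UNIV. - (?g mu nu *\<^sub>R cD nu (cD mu (FF nu mu)) a))"
    by (simp only: scaleR_2)
  also have "\<dots> = (\<Sum>mu\<in>UNIV. \<Sum>nu\<in>UNIV. ?g mu nu *\<^sub>R (cD mu (cD nu (FF nu mu)) a - cD nu (cD mu (FF nu mu)) a))"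
    by (simp add: sum.distrib[symmetric] scaleR_diff_right)
  also have "\<dots> = 0"
  proof -
    have "br (FF mu nu) (FF nu mu) a = 0" for mu nu
    proof -
      have 1: "FF nu mu = (\<lambda>a. - F a mu nu)" by (rule ext) (rule F_antisym)
      show ?thesis unfolding 1 using br_self[OF hom0_FF[of mu nu]] by (simp add: br_uminus_right)
    qed
    then show ?thesis by (simp add: cD_commutator[OF hom0_FF])
  qed
  finally have "?S = 0" by simp
  then show ?thesis unfolding Fu .
qed

lemma sum_cyclic: "(\<Sum>x\<in>UNIV. \<Sum>y\<in>UNIV. \<Sum>z\<in>UNIV. f x y z) = (\<Sum>x\<in>UNIV. \<Sum>y\<in>UNIV. \<Sum>z\<in>UNIV. f y z x)"
  for f :: "'i::finite \<Rightarrow> 'i \<Rightarrow> 'i \<Rightarrow> 'v::comm_monoid_add"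
  by (rule sym, rule trans[OF sum.swap], rule sum.cong[OF refl], rule sum.swap)

text \<open>\<open>Hu\<close> is cyclically symmetric, so three relabelled copies of the sum
  coincide; together they contract \<open>Hu\<close> with the Bianchi identity.\<close>

lemma H_cD_F: "(\<Sum>mu\<in>UNIV. \<Sum>nu\<in>UNIV. \<Sum>rho\<in>UNIV. Hu mu nu rho * cD mu (FF nu rho) a) = 0"
proof -
  let ?f = "\<lambda>mu nu rho. Hu mu nu rho * cD mu (FF nu rho) a"
  let ?S = "\<lambda>f. \<Sum>mu\<in>UNIV. \<Sum>nu\<in>UNIV. \<Sum>rho\<in>UNIV. f mu nu rho :: ('n, 'g) salg"
  have 1: "?S ?f = ?S (\<lambda>mu nu rho. Hu mu nu rho * cD nu (FF rho mu) a)"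
    unfolding sum_cyclic[of ?f] by (intro sum.cong refl) (subst Hu_cyclic, rule refl)
  have 2: "?S ?f = ?S (\<lambda>mu nu rho. Hu mu nu rho * cD rho (FF mu nu) a)"
    unfolding 1 sum_cyclic[of "\<lambda>mu nu rho. Hu mu nu rho * cD nu (FF rho mu) a"]
    by (intro sum.cong refl) (subst Hu_cyclic, rule refl)
  have "3 *\<^sub>R ?S ?f = ?S ?f + ?S ?f + ?S ?f"
    using scaleR_left_distrib[of 2 1 "?S ?f"] by (simp add: scaleR_2)
  also have "\<dots> = ?S (\<lambda>mu nu rho. Hu mu nu rho * (cD mu (FF nu rho) a + cD nu (FF rho mu) a + cD rho (FF mu nu) a))"
    by (subst (2) 1, subst (2) 2) (simp only: distrib_left sum.distrib)
  finally show ?thesis by (simp add: bianchi)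
qed

text \<open>The left side of the \<open>A\<close> equation with its internal index raised. In this
  position \<open>cD\<close> applies directly, and \<open>k\<close> and \<open>kinv\<close> only
  convert at the ends.\<close>

definition Eh :: "'n \<Rightarrow> 'g \<Rightarrow> ('n, 'g) salg" where
  "Eh mu d = (\<Sum>nu\<in>UNIV. cD nu (\<lambda>c. Fu c nu mu) d) + (2 * lam) *\<^sub>R (\<Sum>nu\<in>UNIV. \<Sum>rho\<in>UNIV. Hu mu nu rho * F d nu rho)"

lemma Clow_br: "(\<Sum>b\<in>UNIV. \<Sum>c\<in>UNIV. Clow k C a b c *\<^sub>R (X b * Y c)) = (\<Sum>d\<in>UNIV. k a d *\<^sub>R br X Y d)"
proof -
  have "(\<Sum>b\<in>UNIV. \<Sum>c\<in>UNIV. Clow k C a b c *\<^sub>R (X b * Y c))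
      = (\<Sum>b\<in>UNIV. \<Sum>c\<in>UNIV. \<Sum>d\<in>UNIV. (k a d * C d b c) *\<^sub>R (X b * Y c))"
    by (simp add: Clow_def scaleR_sum_left)
  also have "\<dots> = (\<Sum>b\<in>UNIV. \<Sum>d\<in>UNIV. \<Sum>c\<in>UNIV. (k a d * C d b c) *\<^sub>R (X b * Y c))"
    by (rule sum.cong[OF refl], rule sum.swap)
  also have "\<dots> = (\<Sum>d\<in>UNIV. \<Sum>b\<in>UNIV. \<Sum>c\<in>UNIV. (k a d * C d b c) *\<^sub>R (X b * Y c))"
    by (rule sum.swap)
  finally show ?thesis by (simp add: br_def scaleR_sum_right)
qed

lemma Flu_k: "Flu a nu mu = (\<Sum>d\<in>UNIV. k a d *\<^sub>R Fu d nu mu)"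
  by (simp add: Flu_def Fl_def Fu_def scaleR_sum_right mult.commute)

lemma d0_FAs: "d0 (FAs a mu) = (\<Sum>d\<in>UNIV. k a d *\<^sub>R Eh mu d)"
proof -
  have "(\<Sum>nu\<in>UNIV. pd nu (Flu a nu mu) - (\<Sum>b\<in>UNIV. \<Sum>c\<in>UNIV. Clow k C a b c *\<^sub>R (A b nu * Fu c nu mu)))
      = (\<Sum>nu\<in>UNIV. \<Sum>d\<in>UNIV. k a d *\<^sub>R cD nu (\<lambda>c. Fu c nu mu) d)"
    unfolding Clow_br[of a "AA _" "\<lambda>c. Fu c _ _"]
    by (simp add: Flu_k pd_sum pd_scaleR cD_def scaleR_diff_right sum_subtractf)
  also have "\<dots> = (\<Sum>d\<in>UNIV. k a d *\<^sub>R (\<Sum>nu\<in>UNIV. cD nu (\<lambda>c. Fu c nu mu) d))"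
    by (rule trans[OF sum.swap]) (simp add: scaleR_sum_right)
  finally have 1: "(\<Sum>nu\<in>UNIV. pd nu (Flu a nu mu) - (\<Sum>b\<in>UNIV. \<Sum>c\<in>UNIV. Clow k C a b c *\<^sub>R (A b nu * Fu c nu mu)))
      = (\<Sum>d\<in>UNIV. k a d *\<^sub>R (\<Sum>nu\<in>UNIV. cD nu (\<lambda>c. Fu c nu mu) d))" .
  have "(\<Sum>nu\<in>UNIV. \<Sum>rho\<in>UNIV. Hu mu nu rho * Fl a nu rho)
      = (\<Sum>nu\<in>UNIV. \<Sum>rho\<in>UNIV. \<Sum>d\<in>UNIV. k a d *\<^sub>R (Hu mu nu rho * F d nu rho))"
    by (simp add: Fl_def sum_distrib_left)
  also have "\<dots> = (\<Sum>nu\<in>UNIV. \<Sum>d\<in>UNIV. \<Sum>rho\<in>UNIV. k a d *\<^sub>R (Hu mu nu rho * F d nu rho))"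
    by (rule sum.cong[OF refl], rule sum.swap)
  also have "\<dots> = (\<Sum>d\<in>UNIV. \<Sum>nu\<in>UNIV. \<Sum>rho\<in>UNIV. k a d *\<^sub>R (Hu mu nu rho * F d nu rho))"
    by (rule sum.swap)
  finally have 2: "(\<Sum>nu\<in>UNIV. \<Sum>rho\<in>UNIV. Hu mu nu rho * Fl a nu rho)
      = (\<Sum>d\<in>UNIV. k a d *\<^sub>R (\<Sum>nu\<in>UNIV. \<Sum>rho\<in>UNIV. Hu mu nu rho * F d nu rho))"
    by (simp add: scaleR_sum_right)
  show ?thesis unfolding d0.simps 1 2 Eh_def scaleR_add_right sum.distrib scaleR_sum_right[of "2 * lam" _ UNIV]
    by (simp add: mult.commute scaleR_sum_right)
qed

lemma kinv_d0_FAs: "(\<Sum>e\<in>UNIV. kinv k c e *\<^sub>R d0 (FAs e mu)) = Eh mu c"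
proof -
  have "(\<Sum>e\<in>UNIV. kinv k c e *\<^sub>R d0 (FAs e mu)) = (\<Sum>e\<in>UNIV. \<Sum>d\<in>UNIV. (kinv k c e * k e d) *\<^sub>R Eh mu d)"
    by (simp only: d0_FAs scaleR_sum_right scaleR_scaleR)
  also have "\<dots> = (\<Sum>d\<in>UNIV. (\<Sum>e\<in>UNIV. kinv k c e * k e d) *\<^sub>R Eh mu d)"
    by (subst sum.swap) (simp add: scaleR_sum_left)
  also have "\<dots> = (\<Sum>d\<in>UNIV. if c = d then Eh mu d else 0)"
    unfolding kinv_k by (intro sum.cong) auto
  finally show ?thesis by simp
qed

text \<open>The Noether identity of the gauge symmetry: the Yang-Mills part drops out by
  \<open>cD_cD_F\<close> and the terms with a derivative of \<open>F\<close> by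
  \<open>H_cD_F\<close>, leaving a multiple of the \<open>B\<close> equation.\<close>

lemma cD_Eh: "(\<Sum>mu\<in>UNIV. cD mu (Eh mu) d)
    = (2 * lam) *\<^sub>R (\<Sum>mu\<in>UNIV. \<Sum>nu\<in>UNIV. \<Sum>rho\<in>UNIV. pd mu (Hu mu nu rho) * F d nu rho)"
proof -
  have "cD mu (Eh mu) d = (\<Sum>nu\<in>UNIV. cD mu (cD nu (\<lambda>c. Fu c nu mu)) d)
      + (2 * lam) *\<^sub>R (\<Sum>nu\<in>UNIV. \<Sum>rho\<in>UNIV. pd mu (Hu mu nu rho) * F d nu rho)
      + (2 * lam) *\<^sub>R (\<Sum>nu\<in>UNIV. \<Sum>rho\<in>UNIV. Hu mu nu rho * cD mu (FF nu rho) d)" for mu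
  proof -
    have "cD mu (Eh mu) d = (\<Sum>nu\<in>UNIV. cD mu (\<lambda>d. cD nu (\<lambda>c. Fu c nu mu) d) d)
      + (2 * lam) *\<^sub>R (\<Sum>nu\<in>UNIV. \<Sum>rho\<in>UNIV. cD mu (\<lambda>d. Hu mu nu rho * F d nu rho) d)"
      unfolding Eh_def[abs_def] by (simp only: cD_add cD_sum cD_scaleR)
    then show ?thesis by (simp add: cD_mult[OF hom_Hu] sum.distrib scaleR_add_right)
  qed
  then show ?thesis
    using cD_cD_F[of d] H_cD_F[of d] by (simp add: sum.distrib flip: scaleR_sum_right)
qed

text \<open>By \<open>cD_Eh\<close> the divergence of the \<open>A\<close> equation equals the
  divergence of \<open>Hu\<close> contracted with \<open>F\<close>, which is what \<open>D\<close>
  makes of the \<open>Bs\<close> term.\<close>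

lemma D_d0_FCs: "D (d0 (FCs a)) = 0"
proof -
  have 1: "D (Bs mu nu * Fl a mu nu) = D (Bs mu nu) * Fl a mu nu" for mu nu
    by (rule D_mult_right[OF hom_Bs hom_Fl])
  have "D (d0 (FCs a)) = (2 * lam) *\<^sub>R (\<Sum>mu\<in>UNIV. \<Sum>nu\<in>UNIV. D (Bs mu nu) * Fl a mu nu)
     - (\<Sum>mu\<in>UNIV. pd mu (d0 (FAs a mu))
        - (\<Sum>b\<in>UNIV. \<Sum>c\<in>UNIV. Clow k C a b c *\<^sub>R (A b mu * (\<Sum>e\<in>UNIV. kinv k c e *\<^sub>R d0 (FAs e mu)))))"
    unfolding d0.simps(5) by (simp only: D_diff D_scaleR D_sum D_pd D_mult_left[OF hom_A] 1) (simp add: D_sv)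
  also have "(\<Sum>mu\<in>UNIV. pd mu (d0 (FAs a mu))
        - (\<Sum>b\<in>UNIV. \<Sum>c\<in>UNIV. Clow k C a b c *\<^sub>R (A b mu * (\<Sum>e\<in>UNIV. kinv k c e *\<^sub>R d0 (FAs e mu)))))
     = (\<Sum>mu\<in>UNIV. \<Sum>d\<in>UNIV. k a d *\<^sub>R cD mu (Eh mu) d)"
    unfolding kinv_d0_FAs Clow_br[of a "AA _" "Eh _"]
    by (simp only: d0_FAs) (simp add: pd_sum pd_scaleR cD_def scaleR_diff_right sum_subtractf)
  also have "\<dots> = (\<Sum>d\<in>UNIV. k a d *\<^sub>R (\<Sum>mu\<in>UNIV. cD mu (Eh mu) d))"
    by (rule trans[OF sum.swap]) (simp add: scaleR_sum_right)
  also have "\<dots> = (2 * lam) *\<^sub>R (\<Sum>mu\<in>UNIV. \<Sum>nu\<in>UNIV. D (Bs mu nu) * Fl a mu nu)"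
  proof -
    have "(\<Sum>mu\<in>UNIV. \<Sum>nu\<in>UNIV. D (Bs mu nu) * Fl a mu nu)
        = (\<Sum>nu\<in>UNIV. \<Sum>rho\<in>UNIV. \<Sum>mu\<in>UNIV. pd mu (Hu mu nu rho) * Fl a nu rho)"
      by (simp add: D_Bs sum_distrib_right)
    also have "\<dots> = (\<Sum>mu\<in>UNIV. \<Sum>nu\<in>UNIV. \<Sum>rho\<in>UNIV. pd mu (Hu mu nu rho) * Fl a nu rho)"
      by (rule sum_cyclic)
    also have "\<dots> = (\<Sum>mu\<in>UNIV. \<Sum>nu\<in>UNIV. \<Sum>rho\<in>UNIV. \<Sum>d\<in>UNIV. k a d *\<^sub>R (pd mu (Hu mu nu rho) * F d nu rho))"
      by (simp add: Fl_def sum_distrib_left)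
    also have "\<dots> = (\<Sum>d\<in>UNIV. \<Sum>mu\<in>UNIV. \<Sum>nu\<in>UNIV. \<Sum>rho\<in>UNIV. k a d *\<^sub>R (pd mu (Hu mu nu rho) * F d nu rho))"
      by (rule sym, rule trans[OF sum.swap], rule sum.cong[OF refl], rule trans[OF sum.swap],
          rule sum.cong[OF refl], rule sum.swap)
    finally show ?thesis
      unfolding cD_Eh by (simp add: scaleR_sum_right mult.commute)
  qed
  finally show ?thesis by simp
qed

lemma D_D: "D (D p) = 0"
  unfolding D_def
proof (rule sder_square_zero[OF graded_dg])
  show "sder 1 dg (dg x) = 0" for x
  proof (cases x)
    case (Jet f J)
    \<comment> \<open>For \<open>FAs\<close> and \<open>FBs\<close> the image has antighost number 0
      and is killed by \<open>D\<close>; the other antifields need the Noether and reducibility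
      identities.\<close>
    have "D (d0 f) = 0"
    proof (cases f)
      case (FAs a mu)
      then show ?thesis using D_hom_0 hom_d0[of f] by simp
    next
      case (FBs a mu)
      then show ?thesis using D_hom_0 hom_d0[of f] by simp
    qed (use D_d0_FCs D_d0_Frhos D_d0_Fetas in auto)
    then have "D (dg x) = 0" by (simp add: Jet D_pdJ)
    then show ?thesis by (simp only: D_def)
  qed simp
qed

end

section \<open>Ranks of generators\<close>

definition ad :: "('n \<Rightarrow> nat) \<Rightarrow> 'n \<Rightarrow> 'n \<Rightarrow> nat" where
  "ad J mu = (\<lambda>x. J x + (if x = mu then 1 else 0))"

definition sb :: "('n \<Rightarrow> nat) \<Rightarrow> 'n \<Rightarrow> 'n \<Rightarrow> nat" where
  "sb J mu = (\<lambda>x. J x - (if x = mu then 1 else 0))"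

lemma ad_same [simp]: "ad J mu mu = Suc (J mu)" and ad_other: "mu \<noteq> nu \<Longrightarrow> ad J mu nu = J nu"
  by (simp_all add: ad_def)

lemma sb_same [simp]: "sb J mu mu = J mu - 1" and sb_other: "mu \<noteq> nu \<Longrightarrow> sb J mu nu = J nu"
  by (simp_all add: sb_def)

lemma sb_ad [simp]: "sb (ad J mu) mu = J"
  by (auto simp: ad_def sb_def)

lemma ad_sb: "J mu \<noteq> 0 \<Longrightarrow> ad (sb J mu) mu = J"
  by (auto simp: ad_def sb_def)

lemma pd_ad: "pd mu (sgen (Jet f J)) = sgen (Jet f (ad J mu))"
proof -
  have "J(mu := Suc (J mu)) = ad J mu" by (auto simp: ad_def)
  then show ?thesis using pd_jet[of mu f J] by (simp only:)
qed

lemma pdJ_pd: "pdJ J (pd mu p) = pd mu (pdJ J p)"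
  by (rule pdJ_commute_map[symmetric]) (rule pd_commute)

text \<open>Minimality of \<open>e0\<close> and \<open>e1\<close> ensures that
  \<open>FBs e0 n\<close> and \<open>FB e1 n\<close> are independent components for every further
  index \<open>n\<close>, so that pairing them produces no reordering signs. The index
  \<open>e2\<close> may be any third one.\<close>

locale cm3 = cm t0 lam k C for t0 :: "'n::{finite,linorder}" and lam :: real
    and k :: "'g::finite \<Rightarrow> 'g \<Rightarrow> real" and C :: "'g \<Rightarrow> 'g \<Rightarrow> 'g \<Rightarrow> real" +
  fixes e0 e1 e2 :: 'n
  assumes e0_min: "x \<noteq> e0 \<Longrightarrow> e0 < x" and e1_min: "x \<noteq> e0 \<Longrightarrow> x \<noteq> e1 \<Longrightarrow> e1 < x"
    and e_distinct: "e1 \<noteq> e0" "e2 \<noteq> e0" "e2 \<noteq> e1"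
begin

text \<open>Strictly decreasing weights single out one leading derivative: along \<open>e0\<close>
  if it survives, otherwise along \<open>e1\<close>, otherwise along \<open>e2\<close>.\<close>

definition v :: "'n \<Rightarrow> nat" where
  "v mu = (if mu = e0 then 4 else if mu = e1 then 3 else if mu = e2 then 2 else 1)"

definition wJ :: "('n \<Rightarrow> nat) \<Rightarrow> nat" where "wJ J = (\<Sum>mu\<in>UNIV. v mu * J mu)"

lemma v_e [simp]: "v e0 = 4" "v e1 = 3" "v e2 = 2"
  using e_distinct by (auto simp: v_def)

lemma v_le: "v mu \<le> 4" "mu \<noteq> e0 \<Longrightarrow> v mu \<le> 3" "mu \<noteq> e0 \<Longrightarrow> mu \<noteq> e1 \<Longrightarrow> v mu \<le> 2"
    "mu \<noteq> e0 \<Longrightarrow> mu \<noteq> e1 \<Longrightarrow> mu \<noteq> e2 \<Longrightarrow> v mu \<le> 1"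
  by (auto simp: v_def)

lemma wJ_ad: "wJ (ad J mu) = wJ J + v mu"
proof -
  have "wJ (ad J mu) = (\<Sum>x\<in>UNIV. v x * J x + (if x = mu then v mu else 0))"
    unfolding wJ_def ad_def by (intro sum.cong) (auto simp: distrib_left)
  then show ?thesis by (simp add: sum.distrib wJ_def)
qed

lemma wJ_sb: "J mu \<noteq> 0 \<Longrightarrow> wJ (sb J mu) + v mu = wJ J"
  using wJ_ad[of "sb J mu" mu] by (simp add: ad_sb)

text \<open>An antifield gets the rank of its generic leading term: 8 and 9 for two
  \<open>e0\<close> derivatives of \<open>A\<close> and of \<open>B\<close>, then 4 more for each
  step through one \<open>e0\<close> derivative of an antifield: 12 = 8 + 4, 13 = 9 + 4, 17 = 13 +
  4.\<close>

fun cf :: "('n, 'g) fld \<Rightarrow> nat" where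
  "cf (FB m n) = 1" | "cf (FAs a m) = 8" | "cf (FBs m n) = 9" | "cf (FCs a) = 12" | "cf (Fetas m) = 13"
| "cf Frhos = 17" | "cf _ = 0"

fun Ru :: "('n, 'g) gen \<Rightarrow> nat" where
  "Ru (Jet f J) = wJ J + cf f" | "Ru (Dx m) = 0"

text \<open>\<open>Ru\<close> is the rank up to the corrections that are needed for the leading terms of the
  antifields with an index \<open>e0\<close>, whose equations contain no second derivative along \<open>e0\<close>.\<close>
fun rk :: "('n, 'g) gen \<Rightarrow> nat" where
  "rk (Jet (FA a m) J) = wJ J"
| "rk (Jet (FB m n) J) = wJ J + 1"
| "rk (Jet (FAs a m) J) = wJ J + (if m = e0 \<and> J e0 = 0 then 7 else 8)"
| "rk (Jet (FBs m n) J) = wJ J + (if m = e0 \<and> J e0 = 0 then (if n = e1 \<and> J e1 = 0 then 7 else 8) else 9)"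
| "rk (Jet (FCs a) J) = wJ J + 12"
| "rk (Jet (Fetas m) J) = wJ J + (if m = e0 \<and> J e0 = 0 then 11 else 13)"
| "rk (Jet Frhos J) = wJ J + 17"
| "rk _ = 0"

lemma rk_le_Ru: "rk x \<le> Ru x"
  by (cases x rule: rk.cases) auto

text \<open>Bounds degree and rank together. It uses \<open>Ru\<close> since a derivative along
  \<open>mu\<close> raises \<open>Ru\<close> of a jet by exactly \<open>v mu\<close>, whereas the
  corrections in \<open>rk\<close> depend on the jet.\<close>

definition bnd :: "nat \<Rightarrow> nat \<Rightarrow> ('n, 'g) salg \<Rightarrow> bool" where
  "bnd d r p = (\<forall>m\<in>mons p. size (gm m) \<le> d \<and> (\<forall>x\<in>#gm m. Ru x \<le> r))"

lemma bnd_0 [simp]: "bnd d r 0" by (simp add: bnd_def)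

lemma bnd_add: "bnd d r p \<Longrightarrow> bnd d r q \<Longrightarrow> bnd d r (p + q)"
  unfolding bnd_def using mons_add[of p q] by blast

lemma bnd_uminus: "bnd d r p \<Longrightarrow> bnd d r (- p)" by (simp add: bnd_def)

lemma bnd_diff: "bnd d r p \<Longrightarrow> bnd d r q \<Longrightarrow> bnd d r (p - q)"
  unfolding bnd_def using mons_diff[of p q] by blast

lemma bnd_scaleR: "bnd d r p \<Longrightarrow> bnd d r (c *\<^sub>R p)"
  unfolding bnd_def using mons_scaleR[of c p] by blast

lemma bnd_sum: "(\<And>x. x \<in> X \<Longrightarrow> bnd d r (f x)) \<Longrightarrow> bnd d r (sum f X)"
  unfolding bnd_def using mons_sum[of f X] by blast

lemma bnd_mono: "bnd d r p \<Longrightarrow> d \<le> d' \<Longrightarrow> r \<le> r' \<Longrightarrow> bnd d' r' p"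
  unfolding bnd_def by (meson order_trans)

lemma bnd_mult:
  assumes "bnd d r p" "bnd d' r q" "d + d' \<le> l"
  shows "bnd l r (p * q)"
  unfolding bnd_def
proof (intro ballI)
  fix m assume "m \<in> mons (p * q)"
  from mons_mult[OF this] obtain m1 m2 where m: "m1 \<in> mons p" "m2 \<in> mons q" "gm m = gm m1 + gm m2"
    by blast
  with assms have "size (gm m1) \<le> d" "size (gm m2) \<le> d'" "\<forall>x\<in>#gm m1. Ru x \<le> r" "\<forall>x\<in>#gm m2. Ru x \<le> r"
    by (auto simp: bnd_def)
  with m assms(3) show "size (gm m) \<le> l \<and> (\<forall>x\<in>#gm m. Ru x \<le> r)" by auto
qed

lemma bnd_sgen: "Ru x \<le> r \<Longrightarrow> 1 \<le> d \<Longrightarrow> bnd d r (sgen x)"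
  unfolding bnd_def using mons_sgen[of _ x] by auto

lemma bnd_pd:
  assumes "bnd d r p" "r + v mu \<le> r'"
  shows "bnd d r' (pd mu p)"
  unfolding bnd_def
proof (intro ballI)
  fix m assume "m \<in> mons (pd mu p)"
  from mons_sder[OF graded_pdg this[unfolded pd_def]] obtain m0 x m1
    where m: "m0 \<in> mons p" "x \<in># gm m0" "m1 \<in> mons (pdg mu x)" "gm m = gm m0 - {#x#} + gm m1" by blast
  then obtain f J where x: "x = Jet f J" by (cases x) auto
  have "J(mu := Suc (J mu)) = ad J mu" by (auto simp: ad_def)
  with m(3) have g: "gm m1 = {#Jet f (ad J mu)#}" unfolding x by (auto dest: mons_sgen)
  from m(2) obtain M where M: "gm m0 = add_mset x M" by (meson mset_add)
  have "size (gm m0) \<le> d" "\<forall>x\<in>#gm m0. Ru x \<le> r"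
    using assms m(1) by (auto simp: bnd_def)
  then show "size (gm m) \<le> d \<and> (\<forall>x\<in>#gm m. Ru x \<le> r')"
    using assms(2) unfolding m(4) g M x by (auto simp: wJ_ad intro: order_trans)
qed

lemma bnd_pdJ:
  assumes "bnd d r p"
  shows "bnd d (r + wJ J) (pdJ J p)"
proof -
  have pow: "bnd d r p \<Longrightarrow> bnd d (r + v mu * n) ((pd mu ^^ n) p)" for mu n r p
    by (induction n) (auto intro: bnd_pd)
  have "distinct xs \<Longrightarrow> bnd d r p \<Longrightarrow>
      bnd d (r + (\<Sum>x\<in>set xs. v x * J x)) (fold (\<lambda>mu q. (pd mu ^^ J mu) q) xs p)" for xs r p
  proof (induction xs arbitrary: r p)
    case (Cons x xs)
    from Cons.IH[OF _ pow[OF Cons.prems(2)], of x "J x"] Cons.prems(1) show ?case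
      by (simp add: add.assoc)
  qed simp
  from this[of "sorted_list_of_set UNIV", OF _ assms] show ?thesis by (simp add: pdJ_def wJ_def)
qed

text \<open>Divergences have their leading term \<open>l\<close> in the single summand
  \<open>e\<close>; the others only need the crude bound.\<close>

lemma bnd_sum_remove:
  fixes T :: "'n \<Rightarrow> ('n, 'g) salg"
  assumes "bnd d r (T e - l)" "\<And>x. x \<noteq> e \<Longrightarrow> bnd d r (T x)"
  shows "bnd d r (sum T UNIV - l)"
proof -
  have "sum T UNIV - l = (T e - l) + sum T (UNIV - {e})"
    by (subst sum.remove[of UNIV e]) auto
  moreover have "bnd d r ((T e - l) + sum T (UNIV - {e}))"
    using assms by (intro bnd_add bnd_sum) auto
  ultimately show ?thesis by (simp only:)
qed

lemmas bnd_intros = bnd_0 bnd_add bnd_uminus bnd_diff bnd_scaleR bnd_sum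

lemma bnd_sv: "cf f \<le> r \<Longrightarrow> 1 \<le> d \<Longrightarrow> bnd d r (sv f)"
  unfolding sv_def by (intro bnd_sgen) (auto simp: wJ_def undiff_def)

lemma bnd_A: "1 \<le> d \<Longrightarrow> bnd d r (A a mu)"
  unfolding A_def by (intro bnd_sv) auto

lemma bnd_B: "1 \<le> r \<Longrightarrow> 1 \<le> d \<Longrightarrow> bnd d r (B mu nu)"
  unfolding B_def by (auto intro!: bnd_sv bnd_uminus)

lemma bnd_Bs: "9 \<le> r \<Longrightarrow> 1 \<le> d \<Longrightarrow> bnd d r (Bs mu nu)"
  unfolding Bs_def by (auto intro!: bnd_sv bnd_uminus)

lemma bnd_AA: "bnd 2 r (A a mu * A b nu)"
  by (rule bnd_mult[OF bnd_A[of 1] bnd_A[of 1]]) auto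

lemma bnd_br: "bnd 2 r (br (AA mu) (AA nu) a)"
  unfolding br_def by (intro bnd_intros bnd_AA)

lemma bnd_F:
  assumes "v mu \<le> M" "v nu \<le> M"
  shows "bnd 2 M (F a mu nu)"
  unfolding FF_eq using assms
  by (intro bnd_intros bnd_br bnd_pd[OF bnd_A[of 2 0]]) auto

lemma bnd_Fl: "v mu \<le> M \<Longrightarrow> v nu \<le> M \<Longrightarrow> bnd 2 M (Fl a mu nu)"
  unfolding Fl_def by (intro bnd_intros bnd_F)

lemma bnd_Hnl:
  assumes "v mu \<le> M" "v nu \<le> M" "v rho \<le> M"
  shows "bnd 3 M (Hnl mu nu rho)"
  unfolding Hnl_def using assms
  by (intro bnd_intros bnd_mult[OF bnd_AA bnd_A[of 1]] bnd_mult[OF bnd_A[of 1] bnd_Fl]) auto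

lemma bnd_H:
  assumes "v mu \<le> M" "v nu \<le> M" "v rho \<le> M"
  shows "bnd 3 (Suc M) (H mu nu rho)"
  unfolding H_def using assms
  by (intro bnd_intros bnd_pd[OF bnd_B[of 1]] bnd_mono[OF bnd_Hnl[of _ M]]) auto

lemma bnd_pd_Hu:
  assumes "v mu \<le> M" "v nu \<le> M" "v rho \<le> M" "v mu + Suc M \<le> r"
  shows "bnd 5 r (pd mu (Hu mu nu rho))"
  unfolding Hu_def pd_scaleR using assms
  by (intro bnd_intros bnd_pd[OF bnd_mono[OF bnd_H[of _ M], of _ _ _ 5]]) auto

lemma bnd_pd_Hnl:
  assumes "v mu \<le> M" "v nu \<le> M" "v rho \<le> M" "v mu + M \<le> r"
  shows "bnd 5 r (pd mu (Hnl mu nu rho))"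
  using assms by (intro bnd_pd[OF bnd_mono[OF bnd_Hnl[of _ M], of _ _ _ 5]]) auto

lemma bnd_pd_pd_B: "v mu + v nu + 1 \<le> r \<Longrightarrow> bnd 5 r (pd mu (pd nu (B x y)))"
  by (rule bnd_pd[OF bnd_pd[OF bnd_B[of 1 5]]]) auto

lemma bnd_pd_pd_A: "v mu + v nu \<le> r \<Longrightarrow> bnd 5 r (pd mu (pd nu (A a x)))"
  by (rule bnd_pd[OF bnd_pd[OF bnd_A[of 5 0]]]) auto

section \<open>Leading terms of the field equations and of the Noether and reducibility
  identities\<close>

lemma Hu_diag12: "Hu mu mu nu = 0" and Hu_diag13: "Hu mu nu mu = 0"
  using Hu_diag[of nu mu] Hu_cyclic[of mu mu nu] Hu_cyclic[of mu nu mu] by (simp_all add: Hu_def H_diag)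

lemma pd_Hu:
  "pd rho (Hu rho m n) = (msig t0 rho * msig t0 m * msig t0 n) *\<^sub>R
     (pd rho (pd rho (B m n)) + pd rho (pd m (B n rho)) + pd rho (pd n (B rho m)) - pd rho (Hnl rho m n))"
  by (simp add: Hu_def H_def pd_scaleR pd_add pd_diff)

text \<open>The leading term has rank 4 + 4 + 1 = 9. Elsewhere at most one derivative of
  \<open>B\<close> runs along \<open>e0\<close>, giving at most 4 + 3 + 1, and the Chern-Simons part
  lacks the unit of \<open>B\<close>.\<close>

lemma bnd_FBs_spatial:
  assumes "m \<noteq> e0" "n \<noteq> e0"
  shows "bnd 5 8 (d0 (FBs m n) - (msig t0 e0 * msig t0 m * msig t0 n) *\<^sub>R pd e0 (pd e0 (B m n)))"
  unfolding d0.simps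
proof (rule bnd_sum_remove[of _ _ _ e0])
  have "pd e0 (Hu e0 m n) - (msig t0 e0 * msig t0 m * msig t0 n) *\<^sub>R pd e0 (pd e0 (B m n))
    = (msig t0 e0 * msig t0 m * msig t0 n) *\<^sub>R (pd e0 (pd m (B n e0)) + pd e0 (pd n (B e0 m)) - pd e0 (Hnl e0 m n))"
    unfolding pd_Hu scaleR_diff_right[symmetric] by simp
  also have "bnd 5 8 \<dots>"
    using v_le(2)[OF assms(1)] v_le(2)[OF assms(2)]
    by (intro bnd_intros bnd_pd_pd_B bnd_pd_Hnl[of _ 4] v_le) auto
  finally show "bnd 5 8 (pd e0 (Hu e0 m n) - (msig t0 e0 * msig t0 m * msig t0 n) *\<^sub>R pd e0 (pd e0 (B m n)))" .
  show "bnd 5 8 (pd x (Hu x m n))" if "x \<noteq> e0" for x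
    using v_le(2)[OF assms(1)] v_le(2)[OF assms(2)] v_le(2)[OF that] by (intro bnd_pd_Hu[of _ 3]) auto
qed

text \<open>The summand \<open>e0\<close> vanishes by antisymmetry, so the direction
  \<open>e1\<close> leads, with rank 3 + 4 + 1 = 8.\<close>

lemma bnd_FBs_mixed:
  assumes "n \<noteq> e0" "n \<noteq> e1"
  shows "bnd 5 7 (d0 (FBs e0 n) - (- (msig t0 e1 * msig t0 e0 * msig t0 n)) *\<^sub>R pd e1 (pd e0 (B e1 n)))"
  unfolding d0.simps
proof (rule bnd_sum_remove[of _ _ _ e1])
  have "pd e1 (Hu e1 e0 n) - (- (msig t0 e1 * msig t0 e0 * msig t0 n)) *\<^sub>R pd e1 (pd e0 (B e1 n))
    = (msig t0 e1 * msig t0 e0 * msig t0 n) *\<^sub>R (pd e1 (pd e1 (B e0 n)) + pd e1 (pd n (B e1 e0)) - pd e1 (Hnl e1 e0 n))"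
    unfolding pd_Hu B_antisym[of n e1] by (simp add: pd_uminus scaleR_add_right scaleR_diff_right)
  also have "bnd 5 7 \<dots>"
    using v_le(3)[OF assms]
    by (intro bnd_intros bnd_pd_pd_B bnd_pd_Hnl[of _ 4] v_le) auto
  finally show "bnd 5 7 (pd e1 (Hu e1 e0 n) - (- (msig t0 e1 * msig t0 e0 * msig t0 n)) *\<^sub>R pd e1 (pd e0 (B e1 n)))" .
  show "bnd 5 7 (pd x (Hu x e0 n))" if "x \<noteq> e1" for x
  proof (cases "x = e0")
    case False
    show ?thesis using v_le(3)[OF False that] by (intro bnd_pd_Hu[of _ 4] v_le) auto
  qed (simp add: Hu_diag12)
qed

text \<open>Antisymmetry removes the summands \<open>e0\<close> and \<open>e1\<close>; the direction
  \<open>e2\<close> leads, with rank 2 + 4 + 1 = 7. Here a third dimension is indispensable.\<close>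

lemma bnd_FBs_01:
  "bnd 5 6 (d0 (FBs e0 e1) - (msig t0 e2 * msig t0 e0 * msig t0 e1) *\<^sub>R pd e2 (pd e0 (B e1 e2)))"
  unfolding d0.simps
proof (rule bnd_sum_remove[of _ _ _ e2])
  have "pd e2 (Hu e2 e0 e1) - (msig t0 e2 * msig t0 e0 * msig t0 e1) *\<^sub>R pd e2 (pd e0 (B e1 e2))
    = (msig t0 e2 * msig t0 e0 * msig t0 e1) *\<^sub>R (pd e2 (pd e2 (B e0 e1)) + pd e2 (pd e1 (B e2 e0)) - pd e2 (Hnl e2 e0 e1))"
    unfolding pd_Hu by (simp add: scaleR_add_right scaleR_diff_right)
  also have "bnd 5 6 \<dots>"
    by (intro bnd_intros bnd_pd_pd_B bnd_pd_Hnl[of _ 4] v_le) auto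
  finally show "bnd 5 6 (pd e2 (Hu e2 e0 e1) - (msig t0 e2 * msig t0 e0 * msig t0 e1) *\<^sub>R pd e2 (pd e0 (B e1 e2)))" .
  show "bnd 5 6 (pd x (Hu x e0 e1))" if "x \<noteq> e2" for x
  proof (cases "x = e0 \<or> x = e1")
    case False
    then show ?thesis using v_le(4)[of x] that by (intro bnd_pd_Hu[of _ 4] v_le) auto
  qed (auto simp: Hu_diag12 Hu_diag13)
qed

text \<open>For jets differentiated along \<open>e0\<close>: they have rank offset 9 and get no
  leading term, so the whole image must lie below.\<close>

lemma bnd_FBs_0: "bnd 5 8 (d0 (FBs e0 n))"
  unfolding d0.simps
proof (intro bnd_sum)
  show "bnd 5 8 (pd x (Hu x e0 n))" for x
  proof (cases "x = e0")
    case False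
    show ?thesis using v_le(2)[OF False] by (intro bnd_pd_Hu[of _ 4] v_le) auto
  qed (simp add: Hu_diag12)
qed

text \<open>For jets differentiated along \<open>e1\<close> but not \<open>e0\<close>, of rank
  offset 8; they are left to \<open>Fetas e0\<close>.\<close>

lemma bnd_FBs_01': "bnd 5 7 (d0 (FBs e0 e1))"
  unfolding d0.simps
proof (intro bnd_sum)
  show "bnd 5 7 (pd x (Hu x e0 e1))" for x
  proof (cases "x = e0 \<or> x = e1")
    case False
    then show ?thesis using v_le(3)[of x] by (intro bnd_pd_Hu[of _ 4] v_le) auto
  qed (auto simp: Hu_diag12 Hu_diag13)
qed

text \<open>One summand of the covariant divergence in the \<open>A\<close> equation, without the
  coupling to \<open>H\<close>, whose rank is at most 5.\<close>

definition TA :: "'g \<Rightarrow> 'n \<Rightarrow> 'n \<Rightarrow> ('n, 'g) salg" where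
  "TA a mu nu = pd nu (Flu a nu mu) - (\<Sum>b\<in>UNIV. \<Sum>c\<in>UNIV. Clow k C a b c *\<^sub>R (A b nu * Fu c nu mu))"

lemma bnd_AFu: "4 \<le> r \<Longrightarrow> bnd 5 r (\<Sum>b\<in>UNIV. \<Sum>c\<in>UNIV. Clow k C a b c *\<^sub>R (A b nu * Fu c nu mu))"
  unfolding Fu_def mult_scaleR_right
  by (intro bnd_intros bnd_mult[OF bnd_A[of 1] bnd_mono[OF bnd_F[of _ 4], of _ _ 2]] v_le) auto

lemma bnd_HF: "5 \<le> r \<Longrightarrow> bnd 5 r (c *\<^sub>R (\<Sum>nu\<in>UNIV. \<Sum>rho\<in>UNIV. Hu mu nu rho * Fl a nu rho))"
  unfolding Hu_def mult_scaleR_left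
  by (intro bnd_intros bnd_mult[OF bnd_mono[OF bnd_H[of _ 4], of _ _ _ 3] bnd_mono[OF bnd_Fl[of _ 4], of _ _ 2]] v_le) auto

lemma bnd_TA:
  assumes "v mu \<le> M" "v nu \<le> M" "v nu + M \<le> r" "4 \<le> r"
  shows "bnd 5 r (TA a mu nu)"
  unfolding TA_def Flu_def pd_scaleR using assms
  by (intro bnd_diff bnd_AFu bnd_scaleR bnd_pd[OF bnd_mono[OF bnd_Fl[of _ M], of _ _ 5 M]]) auto

lemma TA_diag: "TA a mu mu = 0"
proof -
  have "F b mu mu = 0" for b
  proof -
    have "2 *\<^sub>R F b mu mu = 0" unfolding scaleR_2 eq_neg_iff_add_eq_0[symmetric] by (rule F_antisym)
    then show ?thesis by simp
  qed
  then show ?thesis by (simp add: TA_def Flu_def Fl_def Fu_def)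
qed

lemma TA_expand:
  "TA a mu nu = (msig t0 nu * msig t0 mu) *\<^sub>R ((\<Sum>b\<in>UNIV. k a b *\<^sub>R pd nu (pd nu (A b mu))) - (\<Sum>b\<in>UNIV. k a b *\<^sub>R pd nu (pd mu (A b nu)))
      - (\<Sum>b\<in>UNIV. k a b *\<^sub>R pd nu (br (AA nu) (AA mu) b)))
    - (\<Sum>b\<in>UNIV. \<Sum>c\<in>UNIV. Clow k C a b c *\<^sub>R (A b nu * Fu c nu mu))"
  by (simp add: TA_def Flu_def Fl_def FF_eq pd_scaleR pd_sum pd_diff scaleR_diff_right sum_subtractf)

lemma d0_FAs_TA: "d0 (FAs a mu) - l = (sum (TA a mu) UNIV - l)
    + (2 * lam) *\<^sub>R (\<Sum>nu\<in>UNIV. \<Sum>rho\<in>UNIV. Hu mu nu rho * Fl a nu rho)"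
  unfolding d0.simps TA_def by simp

lemma bnd_FAs_spatial:
  assumes "m \<noteq> e0"
  shows "bnd 5 7 (d0 (FAs a m) - (msig t0 e0 * msig t0 m) *\<^sub>R (\<Sum>b\<in>UNIV. k a b *\<^sub>R pd e0 (pd e0 (A b m))))"
  unfolding d0_FAs_TA
proof (intro bnd_add bnd_HF bnd_sum_remove[of _ _ _ e0])
  have "TA a m e0 - (msig t0 e0 * msig t0 m) *\<^sub>R (\<Sum>b\<in>UNIV. k a b *\<^sub>R pd e0 (pd e0 (A b m)))
    = (msig t0 e0 * msig t0 m) *\<^sub>R (- (\<Sum>b\<in>UNIV. k a b *\<^sub>R pd e0 (pd m (A b e0)))
      - (\<Sum>b\<in>UNIV. k a b *\<^sub>R pd e0 (br (AA e0) (AA m) b)))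
    - (\<Sum>b\<in>UNIV. \<Sum>c\<in>UNIV. Clow k C a b c *\<^sub>R (A b e0 * Fu c e0 m))"
    unfolding TA_expand by (simp add: scaleR_diff_right)
  also have "bnd 5 7 \<dots>"
    using v_le(2)[OF assms]
    by (intro bnd_intros bnd_pd_pd_A bnd_AFu bnd_pd[OF bnd_mono[OF bnd_br[of 0], of 5 0]]) auto
  finally show "bnd 5 7 (TA a m e0 - (msig t0 e0 * msig t0 m) *\<^sub>R (\<Sum>b\<in>UNIV. k a b *\<^sub>R pd e0 (pd e0 (A b m))))" .
  show "bnd 5 7 (TA a m x)" if "x \<noteq> e0" for x
    using v_le(2)[OF assms] v_le(2)[OF that] by (intro bnd_TA[of _ 3]) auto
qed auto

text \<open>The summand \<open>e0\<close> vanishes because \<open>F\<close> is antisymmetric, so the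
  mixed derivative leads, with rank 3 + 4 = 7.\<close>

lemma bnd_FAs_0:
  "bnd 5 6 (d0 (FAs a e0) - (- (msig t0 e1 * msig t0 e0)) *\<^sub>R (\<Sum>b\<in>UNIV. k a b *\<^sub>R pd e1 (pd e0 (A b e1))))"
  unfolding d0_FAs_TA
proof (intro bnd_add bnd_HF bnd_sum_remove[of _ _ _ e1])
  have "TA a e0 e1 - (- (msig t0 e1 * msig t0 e0)) *\<^sub>R (\<Sum>b\<in>UNIV. k a b *\<^sub>R pd e1 (pd e0 (A b e1)))
    = (msig t0 e1 * msig t0 e0) *\<^sub>R ((\<Sum>b\<in>UNIV. k a b *\<^sub>R pd e1 (pd e1 (A b e0)))
      - (\<Sum>b\<in>UNIV. k a b *\<^sub>R pd e1 (br (AA e1) (AA e0) b)))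
    - (\<Sum>b\<in>UNIV. \<Sum>c\<in>UNIV. Clow k C a b c *\<^sub>R (A b e1 * Fu c e1 e0))"
    unfolding TA_expand by (simp add: scaleR_diff_right)
  also have "bnd 5 6 \<dots>"
    by (intro bnd_intros bnd_pd_pd_A bnd_AFu bnd_pd[OF bnd_mono[OF bnd_br[of 0], of 5 0]]) auto
  finally show "bnd 5 6 (TA a e0 e1 - (- (msig t0 e1 * msig t0 e0)) *\<^sub>R (\<Sum>b\<in>UNIV. k a b *\<^sub>R pd e1 (pd e0 (A b e1))))" .
  show "bnd 5 6 (TA a e0 x)" if "x \<noteq> e1" for x
  proof (cases "x = e0")
    case False
    show ?thesis using v_le(3)[OF False that] by (intro bnd_TA[of _ 4] v_le) auto
  qed (simp add: TA_diag)
qed auto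

lemma bnd_FAs_0': "bnd 5 7 (d0 (FAs a e0))"
proof -
  have "bnd 5 7 (d0 (FAs a e0) - 0)"
    unfolding d0_FAs_TA
  proof (intro bnd_add bnd_HF)
    have "bnd 5 7 (TA a e0 x)" for x
    proof (cases "x = e0")
      case False
      show ?thesis using v_le(2)[OF False] by (intro bnd_TA[of _ 4] v_le) auto
    qed (simp add: TA_diag)
    then show "bnd 5 7 (sum (TA a e0) UNIV - 0)" by (simp add: bnd_sum)
  qed simp
  then show ?thesis by simp
qed

text \<open>A divergence term along \<open>e0\<close> has rank 8 + 4 = 12, along any other direction
  at most 8 + 3; the undifferentiated \<open>Bs\<close> contributes only 9.\<close>

lemma bnd_FCs: "bnd 5 11 (d0 (FCs a) - (- pd e0 (sv (FAs a e0))))"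
proof -
  let ?T = "\<lambda>mu. pd mu (sv (FAs a mu)) - (\<Sum>b\<in>UNIV. \<Sum>c\<in>UNIV. Clow k C a b c *\<^sub>R
             (A b mu * (\<Sum>e\<in>UNIV. kinv k c e *\<^sub>R sv (FAs e mu))))"
  have nl: "bnd 5 11 (\<Sum>b\<in>UNIV. \<Sum>c\<in>UNIV. Clow k C a b c *\<^sub>R
             (A b mu * (\<Sum>e\<in>UNIV. kinv k c e *\<^sub>R sv (FAs e mu))))" for mu
    by (intro bnd_sum bnd_scaleR bnd_mult[OF bnd_A[of 1], where d' = 1] bnd_sv) auto
  have "bnd 5 11 (sum ?T UNIV - pd e0 (sv (FAs a e0)))"
  proof (rule bnd_sum_remove[of _ _ _ e0])
    show "bnd 5 11 (?T e0 - pd e0 (sv (FAs a e0)))"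
      using bnd_uminus[OF nl[of e0]] by simp
    show "bnd 5 11 (?T x)" if "x \<noteq> e0" for x
      using v_le(2)[OF that] by (intro bnd_diff nl bnd_pd[OF bnd_sv[of _ 8 5]]) auto
  qed
  moreover have "bnd 5 11 ((2 * lam) *\<^sub>R (\<Sum>mu\<in>UNIV. \<Sum>nu\<in>UNIV. Bs mu nu * Fl a mu nu))"
    by (intro bnd_intros bnd_mult[OF bnd_Bs[of _ 1] bnd_mono[OF bnd_Fl[of _ 4], of _ _ 2]] v_le) auto
  ultimately have "bnd 5 11 ((2 * lam) *\<^sub>R (\<Sum>mu\<in>UNIV. \<Sum>nu\<in>UNIV. Bs mu nu * Fl a mu nu)
      - (sum ?T UNIV - pd e0 (sv (FAs a e0))))" by (rule bnd_diff[rotated])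
  then show ?thesis by (simp add: algebra_simps)
qed

lemma bnd_Fetas_spatial: "bnd 5 12 (d0 (Fetas m) - (- pd e0 (Bs e0 m)))"
proof -
  have "bnd 5 12 (sum (\<lambda>nu. pd nu (Bs nu m)) UNIV - pd e0 (Bs e0 m))"
  proof (rule bnd_sum_remove[of _ _ _ e0])
    show "bnd 5 12 (pd x (Bs x m))" if "x \<noteq> e0" for x
      using v_le(2)[OF that] by (intro bnd_pd[OF bnd_Bs[of 9 5]]) auto
  qed simp
  from bnd_uminus[OF this] show ?thesis by simp
qed

lemma bnd_Fetas_0: "bnd 5 12 (d0 (Fetas e0))"
  using bnd_Fetas_spatial[of e0] by (simp add: Bs_def)

lemma bnd_Frhos: "bnd 5 16 (d0 Frhos - (- pd e0 (sv (Fetas e0))))"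
proof -
  have "bnd 5 16 (sum (\<lambda>nu. pd nu (sv (Fetas nu))) UNIV - pd e0 (sv (Fetas e0)))"
  proof (rule bnd_sum_remove[of _ _ _ e0])
    show "bnd 5 16 (pd x (sv (Fetas x)))" if "x \<noteq> e0" for x
      using v_le(2)[OF that] by (intro bnd_pd[OF bnd_sv[of _ 13 5]]) auto
  qed simp
  from bnd_uminus[OF this] show ?thesis by simp
qed

end

section \<open>Shifts of multi-indices, linear polynomials and weights\<close>

lemma sb_sb_ad_ad: "mu \<noteq> nu \<Longrightarrow> sb (sb (ad (ad J mu) nu) mu) nu = J"
  by (auto simp: ad_def sb_def)

lemma ad_ad_sb_sb: "mu \<noteq> nu \<Longrightarrow> J mu \<noteq> 0 \<Longrightarrow> J nu \<noteq> 0 \<Longrightarrow> ad (ad (sb (sb J mu) nu) mu) nu = J"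
  by (auto simp: ad_def sb_def)

lemma ad_ad_sb_sb_same: "2 \<le> J mu \<Longrightarrow> ad (ad (sb (sb J mu) mu) mu) mu = J"
  by (auto simp: ad_def sb_def)

definition lin :: "('n, 'g) gen set \<Rightarrow> ('n::{finite,linorder}, 'g::finite) salg \<Rightarrow> bool" where
  "lin S p = (\<forall>m\<in>mons p. \<exists>y\<in>S. gm m = {#y#})"

lemma lin_0: "lin S 0" by (simp add: lin_def)

lemma lin_scaleR: "lin S p \<Longrightarrow> lin S (c *\<^sub>R p)"
  unfolding lin_def using mons_scaleR[of c p] by blast

lemma lin_uminus: "lin S p \<Longrightarrow> lin S (- p)" by (simp add: lin_def)

lemma lin_sum: "(\<And>x. x \<in> X \<Longrightarrow> lin S (f x)) \<Longrightarrow> lin S (sum f X)"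
  unfolding lin_def using mons_sum[of f X] by blast

lemma lin_sgen: "y \<in> S \<Longrightarrow> lin S (sgen y)"
  unfolding lin_def using mons_sgen[of _ y] by blast

lemmas lin_intros = lin_0 lin_scaleR lin_uminus lin_sum lin_sgen

lemma lin_par: "lin {y. gen_odd y = b} p \<Longrightarrow> par b p"
  unfolding lin_def par_def by auto

context cm3
begin

lemma pdJ_sv: "pdJ J (sv f) = sgen (Jet f J)"
  by (simp add: sv_def pdJ_jet undiff_def)

definition wt :: "('n, 'g) gen multiset \<Rightarrow> nat" where "wt M = (\<Sum>x\<in>#M. 6 ^ rk x)"

definition low :: "nat \<Rightarrow> ('n, 'g) salg \<Rightarrow> bool" where "low N p = (\<forall>m\<in>mons p. wt (gm m) < N)"

lemma low_0 [simp]: "low N 0" by (simp add: low_def)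

lemma low_diff: "low N p \<Longrightarrow> low N q \<Longrightarrow> low N (p - q)"
  unfolding low_def using mons_diff[of p q] by blast

lemma low_uminus: "low N p \<Longrightarrow> low N (- p)" by (simp add: low_def)

lemma low_sum: "(\<And>x. x \<in> X \<Longrightarrow> low N (f x)) \<Longrightarrow> low N (sum f X)"
  unfolding low_def using mons_sum[of f X] by blast

lemma low_sgen: "rk x < n \<Longrightarrow> low (6 ^ n) (sgen x)"
  unfolding low_def wt_def using mons_sgen[of _ x] by auto

lemma low_mscale: "low N p \<Longrightarrow> low N (mscale h p)"
  unfolding low_def using mons_mscale[of h p] by blast

lemma low_bnd:
  assumes "bnd 5 r p" "r < n"
  shows "low (6 ^ n) p"
  unfolding low_def
proof
  fix m assume "m \<in> mons p"
  then have m: "size (gm m) \<le> 5" "\<forall>x\<in>#gm m. Ru x \<le> r" using assms by (auto simp: bnd_def)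
  have "wt (gm m) \<le> (\<Sum>x\<in>#gm m. 6 ^ r)"
    unfolding wt_def using m(2) rk_le_Ru
    by (intro sum_mset_mono power_increasing) (auto intro: order_trans)
  also have "\<dots> \<le> 5 * 6 ^ r" using m(1) by (simp add: sum_mset_constant)
  also have "\<dots> < 6 ^ Suc r" by simp
  also have "\<dots> \<le> 6 ^ n" using assms(2) by (intro power_increasing) auto
  finally show "wt (gm m) < 6 ^ n" .
qed

lemma low_pdJ:
  assumes "bnd 5 r p" "r + wJ J < n"
  shows "low (6 ^ n) (pdJ J p)"
  by (rule low_bnd[OF bnd_pdJ[OF assms(1)] assms(2)])

section \<open>The contracting homotopy\<close>

abbreviation g :: "'n \<Rightarrow> real" where "g \<equiv> msig t0"

text \<open>Leading part of the differential: every antifield jet is either mapped to a single field or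
  antifield jet of the same rank (up to the metric \<open>k\<close>), or is itself such an image.\<close>
fun dl :: "('n, 'g) gen \<Rightarrow> ('n, 'g) salg" where
  "dl (Jet (FAs a m) J) = (if m \<noteq> e0 then (g e0 * g m) *\<^sub>R (\<Sum>b\<in>UNIV. k a b *\<^sub>R sgen (Jet (FA b m) (ad (ad J e0) e0)))
     else if J e0 = 0 then (- (g e1 * g e0)) *\<^sub>R (\<Sum>b\<in>UNIV. k a b *\<^sub>R sgen (Jet (FA b e1) (ad (ad J e0) e1)))
     else 0)"
| "dl (Jet (FCs a) J) = - sgen (Jet (FAs a e0) (ad J e0))"
| "dl (Jet (FBs m n) J) = (if m \<noteq> e0 then (g e0 * g m * g n) *\<^sub>R sgen (Jet (FB m n) (ad (ad J e0) e0))
     else if J e0 \<noteq> 0 then 0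
     else if n \<noteq> e1 then (- (g e1 * g e0 * g n)) *\<^sub>R sgen (Jet (FB e1 n) (ad (ad J e0) e1))
     else if J e1 = 0 then (g e2 * g e0 * g e1) *\<^sub>R sgen (Jet (FB e1 e2) (ad (ad J e0) e2))
     else 0)"
| "dl (Jet (Fetas m) J) = (if m \<noteq> e0 then - sgen (Jet (FBs e0 m) (ad J e0))
     else if J e0 = 0 then sgen (Jet (FBs e0 e1) (ad J e1)) else 0)"
| "dl (Jet Frhos J) = - sgen (Jet (Fetas e0) (ad J e0))"
| "dl _ = 0"

text \<open>The inverse of \<open>dl\<close>: \<open>sb\<close> removes the derivatives that
  \<open>dl\<close> added, \<open>kinv\<close> undoes \<open>k\<close>, and the metric signs are
  their own inverses. The guards on \<open>J e0\<close>, \<open>J e1\<close> and \<open>J e2\<close>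
  keep the targets of the different cases disjoint, so each jet has at most one preimage up to the
  internal index.\<close>

fun hs :: "('n, 'g) gen \<Rightarrow> ('n, 'g) salg" where
  "hs (Jet (FA b m) J) = (if m \<noteq> e0 \<and> 2 \<le> J e0 then (g e0 * g m) *\<^sub>R (\<Sum>a\<in>UNIV. kinv k b a *\<^sub>R sgen (Jet (FAs a m) (sb (sb J e0) e0)))
     else if m = e1 \<and> J e0 = 1 \<and> J e1 \<noteq> 0 then (- (g e1 * g e0)) *\<^sub>R (\<Sum>a\<in>UNIV. kinv k b a *\<^sub>R sgen (Jet (FAs a e0) (sb (sb J e0) e1)))
     else 0)"
| "hs (Jet (FAs a m) J) = (if m = e0 \<and> J e0 \<noteq> 0 then - sgen (Jet (FCs a) (sb J e0)) else 0)"
| "hs (Jet (FB m n) J) = (if m \<noteq> e0 \<and> 2 \<le> J e0 then (g e0 * g m * g n) *\<^sub>R sgen (Jet (FBs m n) (sb (sb J e0) e0))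
     else if m = e1 \<and> J e0 = 1 \<and> J e1 \<noteq> 0 then (- (g e1 * g e0 * g n)) *\<^sub>R sgen (Jet (FBs e0 n) (sb (sb J e0) e1))
     else if m = e1 \<and> n = e2 \<and> J e0 = 1 \<and> J e1 = 0 \<and> J e2 \<noteq> 0 then (g e2 * g e0 * g e1) *\<^sub>R sgen (Jet (FBs e0 e1) (sb (sb J e0) e2))
     else 0)"
| "hs (Jet (FBs m n) J) = (if m \<noteq> e0 then 0 else if J e0 \<noteq> 0 then - sgen (Jet (Fetas n) (sb J e0))
     else if n = e1 \<and> J e1 \<noteq> 0 then sgen (Jet (Fetas e0) (sb J e1)) else 0)"
| "hs (Jet (Fetas m) J) = (if m = e0 \<and> J e0 \<noteq> 0 then - sgen (Jet Frhos (sb J e0)) else 0)"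
| "hs _ = 0"

text \<open>All antifield jets, together with the field jets that occur as leading terms of the
  \<open>A\<close> and \<open>B\<close> equations.\<close>

fun paired :: "('n, 'g) gen \<Rightarrow> bool" where
  "paired (Jet (FA b m) J) = (m \<noteq> e0 \<and> 2 \<le> J e0 \<or> m = e1 \<and> J e0 = 1 \<and> J e1 \<noteq> 0)"
| "paired (Jet (FB m n) J) = (m \<noteq> e0 \<and> 2 \<le> J e0 \<or> m = e1 \<and> J e0 = 1 \<and> J e1 \<noteq> 0
     \<or> m = e1 \<and> n = e2 \<and> J e0 = 1 \<and> J e1 = 0 \<and> J e2 \<noteq> 0)"
| "paired x = (gen_agh x \<noteq> 0)"

lemma order_facts: "e0 < e1" "e0 < e2" "e1 < e2" "\<not> x < e0" "e0 < x \<longleftrightarrow> x \<noteq> e0"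
    "e1 < x \<longleftrightarrow> x \<noteq> e0 \<and> x \<noteq> e1"
  using e0_min e1_min e_distinct by (metis less_asym order_less_irrefl)+

lemma graded_dl: "graded_on_gens 1 dl"
proof -
  have "par (gen_odd x \<noteq> odd 1) (dl x)" for x
    by (rule lin_par, cases x rule: dl.cases) (auto intro!: lin_intros)
  then show ?thesis by (simp add: graded_on_gens_def)
qed

lemma graded_hs: "graded_on_gens 1 hs"
proof -
  have "par (gen_odd x \<noteq> odd 1) (hs x)" for x
    by (rule lin_par, cases x rule: hs.cases) (auto intro!: lin_intros)
  then show ?thesis by (simp add: graded_on_gens_def)
qed

definition DL :: "('n, 'g) salg \<Rightarrow> ('n, 'g) salg" where "DL = sder 1 dl"
definition HS :: "('n, 'g) salg \<Rightarrow> ('n, 'g) salg" where "HS = sder 1 hs"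

lemma DL_simps: "DL (c *\<^sub>R p) = c *\<^sub>R DL p" "DL (- p) = - DL p" "DL (sum f X) = (\<Sum>x\<in>X. DL (f x))" "DL 0 = 0"
  "gen_ok x \<Longrightarrow> DL (sgen x) = dl x"
  and HS_simps: "HS (c *\<^sub>R p) = c *\<^sub>R HS p" "HS (- p) = - HS p" "HS (sum f X) = (\<Sum>x\<in>X. HS (f x))" "HS 0 = 0"
  "gen_ok x \<Longrightarrow> HS (sgen x) = hs x"
  by (simp_all only: DL_def HS_def sder_scaleR sder_uminus sder_sum sder_0 sder_sgen[OF graded_dl] sder_sgen[OF graded_hs])

lemma sum_kinv_k: "(\<Sum>a\<in>UNIV. kinv k b a *\<^sub>R (\<Sum>c\<in>UNIV. k a c *\<^sub>R (X c :: ('n, 'g) salg))) = X b"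
proof -
  have "(\<Sum>a\<in>UNIV. kinv k b a *\<^sub>R (\<Sum>c\<in>UNIV. k a c *\<^sub>R X c)) = (\<Sum>a\<in>UNIV. \<Sum>c\<in>UNIV. (kinv k b a * k a c) *\<^sub>R X c)"
    by (simp add: scaleR_sum_right)
  also have "\<dots> = (\<Sum>c\<in>UNIV. (\<Sum>a\<in>UNIV. kinv k b a * k a c) *\<^sub>R X c)"
    by (subst sum.swap) (simp add: scaleR_sum_left)
  also have "\<dots> = (\<Sum>c\<in>UNIV. if b = c then X c else 0)"
    unfolding kinv_k by (intro sum.cong) auto
  finally show ?thesis by simp
qed

lemma sum_k_kinv: "(\<Sum>a\<in>UNIV. k b a *\<^sub>R (\<Sum>c\<in>UNIV. kinv k a c *\<^sub>R (X c :: ('n, 'g) salg))) = X b"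
proof -
  have "(\<Sum>a\<in>UNIV. k b a *\<^sub>R (\<Sum>c\<in>UNIV. kinv k a c *\<^sub>R X c)) = (\<Sum>a\<in>UNIV. \<Sum>c\<in>UNIV. (k b a * kinv k a c) *\<^sub>R X c)"
    by (simp add: scaleR_sum_right)
  also have "\<dots> = (\<Sum>c\<in>UNIV. (\<Sum>a\<in>UNIV. k b a * kinv k a c) *\<^sub>R X c)"
    by (subst sum.swap) (simp add: scaleR_sum_left)
  also have "\<dots> = (\<Sum>c\<in>UNIV. if b = c then X c else 0)"
    unfolding k_kinv by (intro sum.cong) auto
  finally show ?thesis by simp
qed

lemma pull_scaleR:
  "(\<Sum>a\<in>UNIV. c a *\<^sub>R (r *\<^sub>R (X a :: ('n, 'g) salg))) = r *\<^sub>R (\<Sum>a\<in>UNIV. c a *\<^sub>R X a)"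
  by (simp add: scaleR_sum_right mult.commute)

lemma gg: "(g x * g y) * (g x * g y) = 1" "(g x * g y * g z) * (g x * g y * g z) = 1"
  by (simp_all add: msig_def)

lemmas e_neq = e_distinct e_distinct[symmetric]

text \<open>The pairing is exclusive: a paired generator is either a source or a target of
  \<open>dl\<close>, so one of the two terms vanishes and the other returns the generator. Unpaired
  generators are killed by both maps.\<close>

lemma anticommutator_gen:
  assumes "gen_ok x"
  shows "DL (hs x) + HS (dl x) = (if paired x then 1 else 0) *\<^sub>R sgen x"
proof (cases x)
  case (Dx n)
  then show ?thesis by (simp add: DL_simps HS_simps)
next
  case (Jet f J)
  show ?thesis
  proof (cases f)
    case (FA b m)
    consider "m \<noteq> e0 \<and> 2 \<le> J e0" | "m = e1 \<and> J e0 = 1 \<and> J e1 \<noteq> 0" "\<not> (m \<noteq> e0 \<and> 2 \<le> J e0)" | "\<not> paired x"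
      unfolding Jet FA paired.simps by blast
    then show ?thesis
    proof cases
      case 1
      then have "DL (hs x) = (g e0 * g m) *\<^sub>R (g e0 * g m) *\<^sub>R sgen x"
        unfolding Jet FA by (simp only: hs.simps DL_simps gen_ok.simps dl.simps if_True pull_scaleR sum_kinv_k ad_ad_sb_sb_same simp_thms)
      then show ?thesis using 1 unfolding Jet FA by (simp add: gg HS_simps)
    next
      case 2
      let ?J = "sb (sb J e0) e1"
      have J: "?J e0 = 0" "ad (ad ?J e0) e1 = J" using 2 e_neq by (simp_all add: sb_other ad_ad_sb_sb)
      have "DL (sgen (Jet (FAs a e0) ?J)) = (- (g e1 * g e0)) *\<^sub>R (\<Sum>c\<in>UNIV. k a c *\<^sub>R sgen (Jet (FA c e1) J))" for a
        using J by (simp add: DL_simps)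
      moreover have "hs x = (- (g e1 * g e0)) *\<^sub>R (\<Sum>a\<in>UNIV. kinv k b a *\<^sub>R sgen (Jet (FAs a e0) ?J))"
        using 2 unfolding Jet FA by simp
      ultimately have "DL (hs x) = (- (g e1 * g e0)) *\<^sub>R (- (g e1 * g e0)) *\<^sub>R sgen x"
        using 2 unfolding Jet FA by (simp only: DL_simps(1,3) pull_scaleR sum_kinv_k)
      then show ?thesis using 2 unfolding Jet FA by (simp add: gg HS_simps)
    next
      case 3
      then show ?thesis unfolding Jet FA by (auto simp: HS_simps DL_simps)
    qed
  next
    case (FAs a m)
    consider "m \<noteq> e0" | "m = e0" "J e0 = 0" | "m = e0" "J e0 \<noteq> 0" by blast
    then show ?thesis
    proof cases
      case 1
      have "HS (sgen (Jet (FA b m) (ad (ad J e0) e0))) = (g e0 * g m) *\<^sub>R (\<Sum>c\<in>UNIV. kinv k b c *\<^sub>R sgen (Jet (FAs c m) J))" for b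
        using 1 by (simp add: HS_simps)
      moreover have "dl x = (g e0 * g m) *\<^sub>R (\<Sum>b\<in>UNIV. k a b *\<^sub>R sgen (Jet (FA b m) (ad (ad J e0) e0)))"
        using 1 unfolding Jet FAs by simp
      ultimately have "HS (dl x) = (g e0 * g m) *\<^sub>R (g e0 * g m) *\<^sub>R sgen x"
        unfolding Jet FAs by (simp only: HS_simps(1,3) pull_scaleR sum_k_kinv)
      then show ?thesis using 1 unfolding Jet FAs by (simp add: gg DL_simps)
    next
      case 2
      have "HS (sgen (Jet (FA b e1) (ad (ad J e0) e1))) = (- (g e1 * g e0)) *\<^sub>R (\<Sum>c\<in>UNIV. kinv k b c *\<^sub>R sgen (Jet (FAs c e0) J))" for b
        using 2 e_neq by (simp add: HS_simps sb_sb_ad_ad ad_other)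
      moreover have "dl x = (- (g e1 * g e0)) *\<^sub>R (\<Sum>b\<in>UNIV. k a b *\<^sub>R sgen (Jet (FA b e1) (ad (ad J e0) e1)))"
        using 2 unfolding Jet FAs by simp
      ultimately have "HS (dl x) = (- (g e1 * g e0)) *\<^sub>R (- (g e1 * g e0)) *\<^sub>R sgen x"
        using 2(1) unfolding Jet FAs by (simp only: HS_simps(1,3) pull_scaleR sum_k_kinv)
      then show ?thesis using 2 unfolding Jet FAs by (simp add: gg DL_simps)
    next
      case 3
      then show ?thesis unfolding Jet FAs by (simp add: DL_simps HS_simps ad_sb)
    qed
  next
    case (FB m n)
    then have mn: "m < n" "n \<noteq> e0" using assms order_facts(4) unfolding Jet FB by auto
    consider "m \<noteq> e0 \<and> 2 \<le> J e0" | "m = e1" "n \<noteq> e1" "J e0 = 1" "J e1 \<noteq> 0"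
      | "m = e1" "n = e2" "J e0 = 1" "J e1 = 0" "J e2 \<noteq> 0" | "\<not> paired x"
      using mn unfolding Jet FB by auto
    then show ?thesis
    proof cases
      case 1
      then show ?thesis using mn unfolding Jet FB
        by (simp add: DL_simps HS_simps ad_ad_sb_sb_same gg)
    next
      case 2
      then show ?thesis using mn unfolding Jet FB
        by (simp add: DL_simps HS_simps ad_ad_sb_sb gg e_neq sb_other order_facts)
    next
      case 3
      then show ?thesis using mn unfolding Jet FB
        by (simp add: DL_simps HS_simps ad_ad_sb_sb gg e_neq sb_other order_facts)
    next
      case 4
      then show ?thesis unfolding Jet FB by (auto simp: HS_simps DL_simps)
    qed
  next
    case (FBs m n)
    then have mn: "m < n" "n \<noteq> e0" using assms order_facts(4) unfolding Jet FBs by auto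
    consider "m \<noteq> e0" | "m = e0" "J e0 \<noteq> 0" | "m = e0" "J e0 = 0" "n \<noteq> e1"
      | "m = e0" "J e0 = 0" "n = e1" "J e1 \<noteq> 0" | "m = e0" "J e0 = 0" "n = e1" "J e1 = 0" by blast
    then show ?thesis
    proof cases
      case 1
      then show ?thesis using mn unfolding Jet FBs
        by (simp add: DL_simps HS_simps gg)
    next
      case 2
      then show ?thesis using mn unfolding Jet FBs
        by (simp add: DL_simps HS_simps ad_sb)
    next
      case 3
      then show ?thesis using mn unfolding Jet FBs
        by (simp add: DL_simps HS_simps gg sb_sb_ad_ad e_neq ad_other order_facts)
    next
      case 4
      then show ?thesis using mn unfolding Jet FBs
        by (simp add: DL_simps HS_simps ad_sb sb_other e_neq)
    next
      case 5
      then show ?thesis using mn unfolding Jet FBs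
        by (simp add: DL_simps HS_simps gg sb_sb_ad_ad e_neq ad_other order_facts)
    qed
  next
    case (Fetas m)
    consider "m \<noteq> e0" | "m = e0" "J e0 \<noteq> 0" | "m = e0" "J e0 = 0" by blast
    then show ?thesis
      by cases (simp_all add: Jet Fetas DL_simps HS_simps ad_sb ad_other e_neq order_facts)
  next
    case (FCs a)
    then show ?thesis by (simp add: Jet DL_simps HS_simps)
  next
    case Frhos
    then show ?thesis by (simp add: Jet DL_simps HS_simps)
  qed (simp_all add: Jet DL_simps HS_simps)
qed

text \<open>The corrections in \<open>rk\<close> are made for this equality of ranks. For instance,
  an \<open>A\<close> jet hit by the mixed leading term loses 3 + 4 = 7, the offset of
  \<open>FAs a e0\<close> without \<open>e0\<close> derivative.\<close>

lemma lin_hs: "gen_ok x \<Longrightarrow> lin {y. rk y = rk x \<and> gen_agh y = gen_agh x + 1} (hs x)"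
proof (cases x rule: hs.cases)
  case (1 b m J)
  have "wJ J = wJ (sb (sb J e0) e0) + 8" if "2 \<le> J e0"
    using wJ_sb[of J e0] wJ_sb[of "sb J e0" e0] that by simp
  moreover have "wJ J = wJ (sb (sb J e0) e1) + 7" if "J e0 = 1" "J e1 \<noteq> 0"
    using wJ_sb[of J e0] wJ_sb[of "sb J e0" e1] that e_neq by (simp add: sb_other)
  ultimately show ?thesis unfolding 1 by (auto intro!: lin_intros simp: e_neq sb_other)
next
  case (2 a m J)
  show ?thesis unfolding 2 using wJ_sb[of J e0] by (auto intro!: lin_intros)
next
  case (3 m n J)
  assume "gen_ok x"
  then have mn: "m < n" "n \<noteq> e0" using order_facts(4) unfolding 3 by auto
  have "wJ J = wJ (sb (sb J e0) e0) + 8" if "2 \<le> J e0"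
    using wJ_sb[of J e0] wJ_sb[of "sb J e0" e0] that by simp
  moreover have "wJ J = wJ (sb (sb J e0) e1) + 7" if "J e0 = 1" "J e1 \<noteq> 0"
    using wJ_sb[of J e0] wJ_sb[of "sb J e0" e1] that e_neq by (simp add: sb_other)
  moreover have "wJ J = wJ (sb (sb J e0) e2) + 6" if "J e0 = 1" "J e2 \<noteq> 0"
    using wJ_sb[of J e0] wJ_sb[of "sb J e0" e2] that e_neq by (simp add: sb_other)
  ultimately show ?thesis using mn unfolding 3 by (auto intro!: lin_intros simp: e_neq sb_other)
next
  case (4 m n J)
  assume "gen_ok x"
  then have "m < n" "n \<noteq> e0" using order_facts(4) unfolding 4 by auto
  then show ?thesis using wJ_sb[of J e0] wJ_sb[of J e1] unfolding 4
    by (auto intro!: lin_intros simp: e_neq sb_other)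
next
  case (5 m J)
  show ?thesis unfolding 5 using wJ_sb[of J e0] by (auto intro!: lin_intros)
qed (simp_all add: lin_0)

lemma lin_dl: "lin {y. paired x \<and> paired y} (dl x)"
  by (cases x rule: dl.cases) (auto intro!: lin_intros simp: e_neq ad_other)

lemma dl_pdJ_FAs:
  "pdJ J (c *\<^sub>R (\<Sum>b\<in>UNIV. k a b *\<^sub>R pd mu (pd nu (A b m)))) = c *\<^sub>R (\<Sum>b\<in>UNIV. k a b *\<^sub>R sgen (Jet (FA b m) (ad (ad J nu) mu)))"
  by (simp add: pdJ_scaleR pdJ_sum pdJ_pd A_def pdJ_sv pd_ad)

lemma dl_pdJ_FBs: "m < n \<Longrightarrow> pdJ J (c *\<^sub>R pd mu (pd nu (B m n))) = c *\<^sub>R sgen (Jet (FB m n) (ad (ad J nu) mu))"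
  by (simp add: pdJ_scaleR pdJ_pd B_def pdJ_sv pd_ad)

text \<open>Triangularity. Jets with a leading term use the bound with that term subtracted; jets
  that are themselves leading terms have \<open>dl x = 0\<close> and need a bound on the entire
  image.\<close>

lemma low_dg_dl:
  assumes "gen_ok x"
  shows "low (6 ^ rk x) (dg x - dl x)"
proof (cases x)
  case (Dx n)
  then show ?thesis by simp
next
  case (Jet f J)
  have L: "low (6 ^ rk x) (dg x - dl x)" if "dl x = pdJ J l" "bnd 5 r (d0 f - l)" "r + wJ J < rk x" for l r
    using low_pdJ[OF that(2,3)] that(1) by (simp add: Jet pdJ_diff)
  show ?thesis
  proof (cases f)
    case (FAs a m)
    consider "m \<noteq> e0" | "m = e0" "J e0 = 0" | "m = e0" "J e0 \<noteq> 0" by blast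
    then show ?thesis
    proof cases
      case 1
      show ?thesis
        by (rule L[OF _ bnd_FAs_spatial[OF 1, of a, folded FAs]]) (use 1 in \<open>simp_all add: Jet FAs dl_pdJ_FAs\<close>)
    next
      case 2
      have f: "f = FAs a e0" using FAs 2 by simp
      show ?thesis
        by (rule L[OF _ bnd_FAs_0[of a, folded f]])
          (use 2 in \<open>simp_all add: Jet FAs dl_pdJ_FAs pdJ_uminus\<close>)
    next
      case 3
      show ?thesis
        \<comment> \<open>The leading term is taken to be 0: this jet is already the partner of a
          jet of \<open>FCs\<close>.\<close>
        by (rule L[of 0 7]) (use 3 bnd_FAs_0'[of a] in \<open>simp_all add: Jet FAs del: d0.simps\<close>)
    qed
  next
    case (FBs m n)
    then have mn: "m < n" "n \<noteq> e0" using assms order_facts(4) unfolding Jet FBs by auto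
    consider "m \<noteq> e0" | "m = e0" "J e0 \<noteq> 0" | "m = e0" "J e0 = 0" "n \<noteq> e1"
      | "m = e0" "J e0 = 0" "n = e1" "J e1 \<noteq> 0" | "m = e0" "J e0 = 0" "n = e1" "J e1 = 0" by blast
    then show ?thesis
    proof cases
      case 1
      show ?thesis
        by (rule L[OF _ bnd_FBs_spatial[OF 1 mn(2), folded FBs]]) (use 1 mn in \<open>simp_all add: Jet FBs dl_pdJ_FBs\<close>)
    next
      case 2
      show ?thesis
        by (rule L[of 0 8]) (use 2 bnd_FBs_0[of n] in \<open>simp_all add: Jet FBs del: d0.simps\<close>)
    next
      case 3
      have f: "f = FBs e0 n" using FBs 3 by simp
      show ?thesis
        by (rule L[OF _ bnd_FBs_mixed[OF mn(2) 3(3), folded f]])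
          (use 3 mn in \<open>simp_all add: Jet FBs dl_pdJ_FBs pdJ_uminus order_facts\<close>)
    next
      case 4
      show ?thesis
        by (rule L[of 0 7]) (use 4 bnd_FBs_01' in \<open>simp_all add: Jet FBs del: d0.simps\<close>)
    next
      case 5
      have f: "f = FBs e0 e1" using FBs 5 by simp
      show ?thesis
        by (rule L[OF _ bnd_FBs_01[folded f]])
          (use 5 mn e_neq in \<open>simp_all add: Jet FBs dl_pdJ_FBs order_facts\<close>)
    qed
  next
    case (FCs a)
    show ?thesis
      by (rule L[OF _ bnd_FCs[of a, folded FCs]]) (simp_all add: Jet FCs pdJ_uminus pdJ_pd pdJ_sv pd_ad)
  next
    case Frhos
    show ?thesis
      by (rule L[OF _ bnd_Frhos[folded Frhos]]) (simp_all add: Jet Frhos pdJ_uminus pdJ_pd pdJ_sv pd_ad)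
  next
    case (Fetas m)
    consider "m \<noteq> e0" | "m = e0" "J e0 \<noteq> 0" | "m = e0" "J e0 = 0" by blast
    then show ?thesis
    proof cases
      case 1
      show ?thesis
        by (rule L[OF _ bnd_Fetas_spatial[of m, folded Fetas]])
          (use 1 in \<open>simp_all add: Jet Fetas pdJ_uminus pdJ_pd Bs_def pdJ_sv pd_ad order_facts\<close>)
    next
      case 2
      show ?thesis
        by (rule L[of 0 12]) (use 2 bnd_Fetas_0 in \<open>simp_all add: Jet Fetas del: d0.simps\<close>)
    next
      case 3
      \<comment> \<open>Bounds by \<open>Ru\<close> are too coarse here: a direction of weight 2
        would give 9 + 2 = 11, which is the rank offset itself. The image is computed exactly, and
        the corrected ranks of \<open>FBs e0 nu\<close> give at most 8 + 2 = 10.\<close>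
      let ?T = "\<lambda>nu. if nu = e0 then 0 else sgen (Jet (FBs e0 nu) (ad J nu))"
      have "pdJ J (pd nu (Bs nu e0)) = - ?T nu" for nu
        by (simp add: pdJ_pd Bs_def pdJ_uminus pdJ_sv pd_ad pd_uminus order_facts)
      then have "dg x = sum ?T UNIV"
        unfolding Jet Fetas 3 by (simp add: pdJ_uminus pdJ_sum sum_negf)
      also have "\<dots> = ?T e1 + sum ?T (UNIV - {e1})" by (subst sum.remove[of UNIV e1]) auto
      finally have "dg x - dl x = sum ?T (UNIV - {e1})"
        using 3 e_neq unfolding Jet Fetas by simp
      moreover have "low (6 ^ rk x) (sum ?T (UNIV - {e1}))"
      proof (rule low_sum)
        fix nu assume nu: "nu \<in> UNIV - {e1}"
        show "low (6 ^ rk x) (?T nu)"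
        proof (cases "nu = e0")
          case False
          then have "rk (Jet (FBs e0 nu) (ad J nu)) < rk x"
            using nu v_le(3)[of nu] 3 unfolding Jet Fetas by (simp add: wJ_ad ad_other)
          with low_sgen[OF this] False show ?thesis by simp
        qed simp
      qed
      ultimately show ?thesis by simp
    qed
  qed (simp_all add: Jet)
qed

section \<open>Acyclicity\<close>

definition ag :: "nat \<Rightarrow> ('n, 'g) salg \<Rightarrow> bool" where
  "ag i p = (\<forall>m\<in>mons p. (\<Sum>x\<in>#gm m. gen_agh x) = i)"

lemma ag_diff: "ag n p \<Longrightarrow> ag n q \<Longrightarrow> ag n (p - q)"
  unfolding ag_def using mons_diff[of p q] by blast

lemma ag_add: "ag n p \<Longrightarrow> ag n q \<Longrightarrow> ag n (p + q)"
  unfolding ag_def using mons_add[of p q] by blast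

lemma ag_mscale: "ag n p \<Longrightarrow> ag n (mscale h p)"
  unfolding ag_def using mons_mscale[of h p] by blast

lemma ag_D:
  assumes "ag (Suc i) p"
  shows "ag i (D p)"
  unfolding ag_def
proof
  fix m assume "m \<in> mons (D p)"
  from mons_sder[OF graded_dg this[unfolded D_def]] obtain m0 x m1
    where m: "m0 \<in> mons p" "x \<in># gm m0" "m1 \<in> mons (dg x)" "gm m = gm m0 - {#x#} + gm m1" by blast
  have 1: "(\<Sum>x\<in>#gm m1. gen_agh x) = gen_agh x - 1" using hom_dg[of x] m(3) by (simp add: hom_def)
  \<comment> \<open>Excludes the truncated case of \<open>gen_agh x - 1\<close>.\<close>
  have 2: "gen_agh x \<noteq> 0" using m(3) dg_agh_0[of x] by (metis empty_iff mons_0)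
  from m(2) obtain M where M: "gm m0 = add_mset x M" by (meson mset_add)
  have "(\<Sum>x\<in>#gm m0. gen_agh x) = Suc i" using assms m(1) by (simp add: ag_def)
  then show "(\<Sum>x\<in>#gm m. gen_agh x) = i" using 1 2 unfolding m(4) M by simp
qed

text \<open>Each replacement made by \<open>HS\<close> trades one generator for a single one of
  equal rank; hence \<open>HS\<close> preserves the weight and raises the antighost number by
  one.\<close>

lemma HS_mons:
  assumes "m \<in> mons (HS p)"
  shows "\<exists>m0\<in>mons p. \<exists>M x y. gm m0 = add_mset x M \<and> gm m = add_mset y M \<and> rk y = rk x \<and> gen_agh y = gen_agh x + 1"
proof -
  from mons_sder[OF graded_hs assms[unfolded HS_def]] obtain m0 x m1
    where m: "m0 \<in> mons p" "x \<in># gm m0" "m1 \<in> mons (hs x)" "gen_ok x" "gm m = gm m0 - {#x#} + gm m1" by blast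
  from lin_hs[OF m(4)] m(3) obtain y where y: "gm m1 = {#y#}" "rk y = rk x" "gen_agh y = gen_agh x + 1"
    unfolding lin_def by blast
  from m(2) obtain M where M: "gm m0 = add_mset x M" by (meson mset_add)
  then have "gm m = add_mset y M" using m(5) y(1) by simp
  with m(1) M y show ?thesis by blast
qed

lemma ag_HS: "ag i p \<Longrightarrow> ag (i + 1) (HS p)"
  unfolding ag_def
proof
  fix m assume p: "\<forall>m\<in>mons p. (\<Sum>x\<in>#gm m. gen_agh x) = i" and m: "m \<in> mons (HS p)"
  from HS_mons[OF m] obtain m0 M x y where m: "m0 \<in> mons p" "gm m0 = add_mset x M" "gm m = add_mset y M"
    "gen_agh y = gen_agh x + 1" by blast
  with p have "(\<Sum>x\<in>#gm m0. gen_agh x) = i" by blast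
  with m show "(\<Sum>x\<in>#gm m. gen_agh x) = i + 1" by simp
qed

lemma low_HS: "low N p \<Longrightarrow> low N (HS p)"
  unfolding low_def
proof
  fix m assume p: "\<forall>m\<in>mons p. wt (gm m) < N" and m: "m \<in> mons (HS p)"
  from HS_mons[OF m] obtain m0 M x y where m: "m0 \<in> mons p" "gm m0 = add_mset x M" "gm m = add_mset y M"
    "rk y = rk x" by blast
  with p have "wt (gm m0) < N" by blast
  with m show "wt (gm m) < N" by (simp add: wt_def)
qed

text \<open>Weights are natural numbers and every replacement lowers them strictly, so the bound
  \<open>Suc N\<close> drops to \<open>N\<close>.\<close>

lemma low_D_DL:
  assumes "low (Suc N) p"
  shows "low N (D p - DL p)"
  unfolding low_def
proof
  let ?f = "\<lambda>x. dg x - dl x"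
  have eq: "D p - DL p = sder 1 ?f p"
    unfolding D_def DL_def by (rule sder_diff_gens[OF graded_dg graded_dl, symmetric])
  fix m assume "m \<in> mons (D p - DL p)"
  from mons_sder[OF graded_on_gens_diff[OF graded_dg graded_dl] this[unfolded eq]] obtain m0 x m1
    where m: "m0 \<in> mons p" "x \<in># gm m0" "m1 \<in> mons (?f x)" "gen_ok x" "gm m = gm m0 - {#x#} + gm m1" by blast
  have 1: "wt (gm m1) < 6 ^ rk x" using low_dg_dl[OF m(4)] m(3) by (simp add: low_def)
  from m(2) obtain M where M: "gm m0 = add_mset x M" by (meson mset_add)
  have "wt (gm m0) < Suc N" using assms m(1) by (simp add: low_def)
  then show "wt (gm m) < N" using 1 unfolding m(5) M by (simp add: wt_def)
qed

definition np :: "('n, 'g) gen multiset \<Rightarrow> real" where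
  "np M = (\<Sum>x\<in>#M. if paired x then 1 else 0)"

lemma np_pos: "(\<Sum>x\<in>#M. gen_agh x) \<noteq> 0 \<Longrightarrow> np M \<noteq> 0"
proof -
  have nn: "0 \<le> np M" for M unfolding np_def by (induction M) auto
  have "gen_agh x \<noteq> 0 \<Longrightarrow> paired x" for x
    by (cases x rule: paired.cases) auto
  then have "(\<Sum>x\<in>#M. gen_agh x) \<noteq> 0 \<longrightarrow> 0 < np M"
  proof (induction M)
    case (add x M)
    show ?case using add nn[of M] by (auto simp: np_def)
  qed simp
  then show "(\<Sum>x\<in>#M. gen_agh x) \<noteq> 0 \<Longrightarrow> np M \<noteq> 0" by auto
qed

lemma DL_HS: "DL (HS p) + HS (DL p) = mscale np p"
  unfolding DL_def HS_def np_def
  by (rule sder_anticommutator_mscale[OF graded_dl graded_hs anticommutator_gen[unfolded DL_def HS_def]])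

text \<open>\<open>dl\<close> exchanges one paired generator for another, so the count is unchanged
  and division by it commutes with \<open>DL\<close>.\<close>

lemma mscale_DL: "mscale (\<lambda>M. 1 / np M) (DL p) = DL (mscale (\<lambda>M. 1 / np M) p)"
  unfolding DL_def
proof (rule mscale_sder[OF graded_dl])
  fix M :: "('n, 'g) gen multiset" and x m
  assume x: "x \<in># M" and m: "m \<in> mons (dl x)"
  from lin_dl[of x] m obtain y where y: "gm m = {#y#}" "paired x" "paired y" unfolding lin_def by blast
  from x obtain M' where M: "M = add_mset x M'" by (meson mset_add)
  show "1 / np (M - {#x#} + gm m) = 1 / np M" using y unfolding M by (simp add: np_def)
qed

lemma acyclic:
  assumes "low N a" "ag i a" "i > 0" "D a = 0"
  shows "\<exists>b. ag (i + 1) b \<and> a = D b"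
  using assms
proof (induction N arbitrary: a)
  case 0
  \<comment> \<open>The bound is strict, so below 0 there are no monomials at all.\<close>
  then have "mons a = {}" by (auto simp: low_def)
  then have "a = 0" by (simp add: mons_empty_iff)
  then show ?case by (intro exI[of _ 0]) (simp add: ag_def)
next
  case (Suc N)
  let ?T = "mscale (\<lambda>M. 1 / np M)"
  define b where "b = HS (?T a)"
  have b: "ag (i + 1) b" "low (Suc N) b"
    unfolding b_def using Suc.prems by (auto intro: ag_HS[simplified] ag_mscale low_HS low_mscale)
  \<comment> \<open>Positive antighost number enters here: every antifield jet is paired, so the
    division is legitimate.\<close>
  have "np (gm m) \<noteq> 0" if "m \<in> mons a" for m
    using that Suc.prems(2,3) unfolding ag_def by (intro np_pos) (metis less_irrefl)
  then have "mscale np (?T a) = a"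
    by (intro mscale_mscale_inverse) simp
  then have "DL b = a - HS (?T (DL a))"
    using DL_HS[of "?T a"] mscale_DL[of a] by (simp add: b_def algebra_simps)
  \<comment> \<open>As \<open>a\<close> is a cycle, its leading differential is minus the
    lower-order part and thus of smaller weight.\<close>
  moreover have "DL a = - (D a - DL a)" using Suc.prems by simp
  ultimately have "DL b = a + HS (?T (D a - DL a))"
    using Suc.prems by (simp add: mscale_uminus HS_simps)
  \<comment> \<open>Both remainders contain a factor \<open>D - DL\<close>, and \<open>HS\<close>
    and division do not raise the weight again.\<close>
  then have eq: "a - D b = - HS (?T (D a - DL a)) - (D b - DL b)" by simp
  have "low N (a - D b)"
    unfolding eq using b Suc.prems by (intro low_diff low_uminus low_HS low_mscale low_D_DL) auto
  moreover have "ag i (a - D b)" using Suc.prems b ag_D[of i b] by (intro ag_diff) auto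
  moreover have "D (a - D b) = 0" using Suc.prems by (simp add: D_diff D_D)
  ultimately obtain c where "ag (i + 1) c" "a - D b = D c" using Suc.IH Suc.prems by blast
  then have "a = D (b + c)" by (simp add: D_add algebra_simps)
  then show ?case using b \<open>ag (i + 1) c\<close> by (blast intro: ag_add)
qed

lemma has_agh_ag: "has_agh i (Rep_salg p) = ag i p"
proof -
  have "mon_agh m = (\<Sum>x\<in>#gm m. gen_agh x)" for m :: "('n, 'g) mon"
    by (simp add: mon_agh_def gm_def sum_unfold_sum_mset)
  then show ?thesis by (simp add: has_agh_def ag_def mons_def)
qed

end

theorem theorem3p1:
  fixes t0 :: "'n::{finite,linorder}"
    and C :: "'g::finite \<Rightarrow> 'g \<Rightarrow> 'g \<Rightarrow> real"
    and k :: "'g \<Rightarrow> 'g \<Rightarrow> real"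
    and lam :: real
    and i :: nat
    and a :: "('n, 'g) poly"
  assumes "CARD('n) \<ge> 3"
    and "simple_lie_algebra C"
    and "invariant_metric C k"
    and "a \<in> PP"
    and "has_agh i a"
    and "i > 0"
    and "KT t0 lam k C a = 0"
  shows "\<exists>b\<in>PP. has_agh (i + 1) b \<and> a = KT t0 lam k C b"
proof -
  define e0 :: 'n where "e0 = Min UNIV"
  define e1 :: 'n where "e1 = Min (UNIV - {e0})"
  have c1: "card (UNIV - {e0} :: 'n set) \<ge> 2" using assms(1) by simp
  then have n1: "UNIV - {e0} \<noteq> {}" by (metis card.empty not_numeral_le_zero)
  have e1: "e1 \<noteq> e0" using Min_in[OF _ n1] by (auto simp: e1_def)
  have "card (UNIV - {e0} - {e1}) \<ge> 1" using c1 e1 by simp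
  then have "UNIV - {e0} - {e1} \<noteq> {}" by (metis card.empty not_one_le_zero)
  then obtain e2 where e2: "e2 \<noteq> e0" "e2 \<noteq> e1" by blast
  interpret cm3 t0 lam k C e0 e1 e2
  proof
    show "e0 < x" if "x \<noteq> e0" for x
      using that Min_le[of UNIV x] by (simp add: e0_def order_less_le)
    show "e1 < x" if "x \<noteq> e0" "x \<noteq> e1" for x
      using that Min_le[of "UNIV - {e0}" x] by (simp add: e1_def order_less_le)
  qed (use assms e1 e2 in auto)
  define a' where "a' = Abs_salg a"
  have a: "Rep_salg a' = a" using assms(4) by (simp add: a'_def Abs_salg_inverse)
  have "D a' = 0"
    using assms(7) Rep_D[of a'] by (simp add: a zero_salg.rep_eq flip: Rep_salg_inject)
  moreover have "ag i a'" using assms(5) has_agh_ag[of i a'] a by simp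
  moreover have "\<exists>N. low N a'"
  proof
    \<comment> \<open>The support is finite, so the sum of all its weights bounds each of
      them.\<close>
    show "low (Suc (\<Sum>m\<in>mons a'. wt (gm m))) a'"
      unfolding low_def by (auto simp: less_Suc_eq_le intro!: member_le_sum)
  qed
  ultimately obtain b where "ag (i + 1) b" "a' = D b" using acyclic assms(6) by blast
  then show ?thesis
    using has_agh_ag[of "i + 1" b] Rep_D[of b] a Rep_salg[of b] by (intro bexI[of _ "Rep_salg b"]) auto
qed

end
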